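(* Let $n$ be a positive integer and $0<\beta<\infty$. Let $\mathcal J$ be from the $G\beta E_n$ ensemble, and let $l$ be a random variable independent of $\mathcal J$ distributed according to an absolutely continuous probability distribution $F(l)\,dl$ on $(0,+\infty)$. Then the eigenvalues $z_1,\dots,z_n$ of $\mathcal J+i\,l\,I_{1\times1}$ are distributed on $(\mathbb C_+)^n$ according to $$\frac{1}{h_{\beta,n}}\,e^{-\frac12\sum_{j=1}^n(\operatorname{Re}z_j)^2-\sum_{j<k}(\operatorname{Im}z_j)(\operatorname{Im}z_k)}\prod_{j,k=1}^n|z_j-\bar z_k|^{\frac\beta2-1}\prod_{j<k}|z_j-z_k|^2\,\frac{F(l)}{l^{\frac{\beta n}{2}-1}}\,d^2z_1\cdots d^2z_n,$$ where in this formula $l=\sum_{j=1}^n\operatorname{Im}z_j$, $d^2z$ stands for the 2-dimensional Lebesgue measure on $\mathbb C$, and $$h_{\beta,n}=2^{n(\beta/2-1)}g_{\beta,n}c_{\beta,n},\qquad g_{\beta,n}=(2\pi)^{n/2}\prod_{j=1}^n\frac{\Gamma(1+\beta j/2)}{\Gamma(1+\beta/2)},\qquad c_{\beta,n}=\frac{\Gamma(\beta/2)^n}{\Gamma(\beta n/2)}.$$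
   Context: $\mathbb C_+=\{z\in\mathbb C:\operatorname{Im}z>0\}$. $I_{1\times1}$ is the $n\times n$ matrix with $(1,1)$-entry equal to $1$ and all other entries $0$. $N(0,1)$ is the standard real normal law, and for $k>0$, $\tilde\chi_k$ is the law on $(0,\infty)$ with density $\frac{2}{\Gamma(k/2)}x^{k-1}e^{-x^2}$. $G\beta E_n$ (Gaussian $\beta$-ensemble): the random $n\times n$ real symmetric tridiagonal matrix with diagonal entries $b_1,\dots,b_n$ and off-diagonal entries (in positions $(j,j+1)$ and $(j+1,j)$) $a_1,\dots,a_{n-1}$, all independent, with $a_j\sim\tilde\chi_{\beta(n-j)}$ for $1\le j\le n-1$ and $b_j\sim N(0,1)$ for $1\le j\le n$. Conventions: statements hold with probability $1$. Eigenvalues are counted with algebraic multiplicity and are unordered, i.e. the (symmetric) density is that of the eigenvalues listed in a uniformly random order. *)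

theory Defs
  imports "HOL-Probability.Probability" "Jordan_Normal_Form.Char_Poly"
begin

definition chi_tilde_density :: "real \<Rightarrow> real \<Rightarrow> real" where
  "chi_tilde_density k x =
     (if 0 < x then 2 / Gamma (k / 2) * x powr (k - 1) * exp (- x\<^sup>2) else 0)"

text \<open>The sequences \<open>a\<close> and \<open>b\<close> are indexed from 1, matrix positions from 0.\<close>

definition jacobi_matrix :: "nat \<Rightarrow> (nat \<Rightarrow> real) \<Rightarrow> (nat \<Rightarrow> real) \<Rightarrow> real mat" where
  "jacobi_matrix n a b = mat n n (\<lambda>(i, j).
     if i = j then b (Suc i)
     else if j = Suc i then a (Suc i)
     else if i = Suc j then a (Suc j)
     else 0)"

definition gaussian_beta_ensemble :: "'w measure \<Rightarrow> real \<Rightarrow> nat \<Rightarrow> ('w \<Rightarrow> real mat) \<Rightarrow> bool" where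
  "gaussian_beta_ensemble M \<beta> n J \<longleftrightarrow>
     (\<exists>a b :: nat \<Rightarrow> 'w \<Rightarrow> real.
        (\<forall>\<omega>\<in>space M. J \<omega> = jacobi_matrix n (\<lambda>j. a j \<omega>) (\<lambda>j. b j \<omega>)) \<and>
        prob_space.indep_vars M (\<lambda>_. borel) (case_sum a b) ({1..<n} <+> {1..n}) \<and>
        (\<forall>j\<in>{1..<n}. distributed M lborel (a j)
            (\<lambda>x. ennreal (chi_tilde_density (\<beta> * real (n - j)) x))) \<and>
        (\<forall>j\<in>{1..n}. distributed M lborel (b j) (\<lambda>x. ennreal (std_normal_density x))))"

text \<open>
  Independence of two random variables of possibly different types, which
  \<^const>\<open>prob_space.indep_var\<close> does not cover.
\<close>

definition indep_rv :: "'w measure \<Rightarrow> 'a measure \<Rightarrow> ('w \<Rightarrow> 'a) \<Rightarrow> 'b measure \<Rightarrow> ('w \<Rightarrow> 'b) \<Rightarrow> bool" where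
  "indep_rv M S X T Y \<longleftrightarrow> X \<in> measurable M S \<and> Y \<in> measurable M T \<and>
     prob_space.indep_set M (sets (vimage_algebra (space M) X S)) (sets (vimage_algebra (space M) Y T))"

lemma indep_rv_iff_indep_var:
  assumes "prob_space M"
  shows "indep_rv M S X T Y \<longleftrightarrow> prob_space.indep_var M S X T Y"
  unfolding indep_rv_def prob_space.indep_var_eq[OF assms] sets_vimage_algebra by auto

definition I11 :: "nat \<Rightarrow> complex mat" where
  "I11 n = mat n n (\<lambda>(i, j). if i = 0 \<and> j = 0 then 1 else 0)"

definition lex_le :: "complex \<Rightarrow> complex \<Rightarrow> bool" where
  "lex_le z w \<longleftrightarrow> Re z < Re w \<or> Re z = Re w \<and> Im z \<le> Im w"

text \<open>
  The eigenvalues with algebraic multiplicity, in lexicographic order of (Re, Im). This order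
  only serves to fix some measurable listing; it is destroyed again in \<open>random_order\<close>.
\<close>

definition eigenvalue_list :: "complex mat \<Rightarrow> complex list" where
  "eigenvalue_list A = (THE zs. mset zs = proots (char_poly A) \<and> sorted_wrt lex_le zs)"

lemma lex_le_sorted_unique:
  "sorted_wrt lex_le xs \<Longrightarrow> sorted_wrt lex_le ys \<Longrightarrow> mset xs = mset ys \<Longrightarrow> xs = ys"
proof (induction xs arbitrary: ys)
  case Nil
  then show ?case by simp
next
  case (Cons x xs)
  then obtain y ys' where ys: "ys = y # ys'" by (cases ys) auto
  have sets: "set (x # xs) = set (y # ys')"
    using Cons.prems(3) unfolding ys by (metis set_mset_mset)
  have "lex_le x y" "lex_le y x"
    using Cons.prems(1,2) sets unfolding ys by (auto simp: lex_le_def)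
  then have "x = y" by (auto simp: lex_le_def complex_eq_iff)
  with Cons ys show ?case by auto
qed

lemma lex_le_sorted_exists: "\<exists>zs. mset zs = A \<and> sorted_wrt lex_le zs"
proof (induction A)
  case empty
  then show ?case by auto
next
  case (add x A)
  then obtain zs where zs: "mset zs = A" "sorted_wrt lex_le zs" by blast
  define us vs where "us = filter (\<lambda>z. lex_le z x) zs" and "vs = filter (\<lambda>z. \<not> lex_le z x) zs"
  have "sorted_wrt lex_le (us @ x # vs)"
    using zs(2) unfolding us_def vs_def
    by (auto simp: sorted_wrt_append sorted_wrt_filter lex_le_def)
  moreover have "mset (us @ x # vs) = add_mset x A"
    using zs(1) unfolding us_def vs_def by (auto simp flip: multiset_partition)
  ultimately show ?case by blast
qed

lemma eigenvalue_list:
  shows mset_eigenvalue_list: "mset (eigenvalue_list A) = proots (char_poly A)"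
    and sorted_eigenvalue_list: "sorted_wrt lex_le (eigenvalue_list A)"
proof -
  have "\<exists>!zs. mset zs = proots (char_poly A) \<and> sorted_wrt lex_le zs"
    using lex_le_sorted_exists lex_le_sorted_unique by metis
  from theI'[OF this]
  show "mset (eigenvalue_list A) = proots (char_poly A)"
    and "sorted_wrt lex_le (eigenvalue_list A)"
    unfolding eigenvalue_list_def by auto
qed

lemma length_eigenvalue_list:
  assumes "A \<in> carrier_mat n n"
  shows "length (eigenvalue_list A) = n"
  using degree_monic_char_poly[OF assms]
  by (metis mset_eigenvalue_list size_mset size_proots_complex)

text \<open>
  A uniformly random order: the probability space is enlarged by an independent, uniformly
  distributed permutation \<open>\<pi>\<close> of the positions.
\<close>

definition shuffle_space :: "nat \<Rightarrow> 'w measure \<Rightarrow> ('w \<times> (nat \<Rightarrow> nat)) measure" where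
  "shuffle_space n M = M \<Otimes>\<^sub>M uniform_count_measure {\<pi>. \<pi> permutes {..<n}}"

definition random_order :: "nat \<Rightarrow> ('w \<Rightarrow> complex list) \<Rightarrow> 'w \<times> (nat \<Rightarrow> nat) \<Rightarrow> nat \<Rightarrow> complex" where
  "random_order n zs = (\<lambda>(\<omega>, \<pi>). \<lambda>j\<in>{..<n}. zs \<omega> ! \<pi> j)"

definition g_const :: "real \<Rightarrow> nat \<Rightarrow> real" where
  "g_const \<beta> n = (2 * pi) powr (real n / 2) *
     (\<Prod>j=1..n. Gamma (1 + \<beta> * real j / 2) / Gamma (1 + \<beta> / 2))"

definition c_const :: "real \<Rightarrow> nat \<Rightarrow> real" where
  "c_const \<beta> n = Gamma (\<beta> / 2) ^ n / Gamma (\<beta> * real n / 2)"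

definition h_const :: "real \<Rightarrow> nat \<Rightarrow> real" where
  "h_const \<beta> n = 2 powr (real n * (\<beta> / 2 - 1)) * g_const \<beta> n * c_const \<beta> n"

definition eigenvalue_density :: "real \<Rightarrow> nat \<Rightarrow> (real \<Rightarrow> real) \<Rightarrow> (nat \<Rightarrow> complex) \<Rightarrow> real" where
  "eigenvalue_density \<beta> n F z =
     (if \<forall>j<n. 0 < Im (z j) then
        (let l = (\<Sum>j<n. Im (z j)) in
          1 / h_const \<beta> n
          * exp (- (1 / 2) * (\<Sum>j<n. (Re (z j))\<^sup>2) - (\<Sum>k<n. \<Sum>j<k. Im (z j) * Im (z k)))
          * (\<Prod>j<n. \<Prod>k<n. cmod (z j - cnj (z k)) powr (\<beta> / 2 - 1))
          * (\<Prod>k<n. \<Prod>j<k. (cmod (z j - z k))\<^sup>2)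
          * (F l / l powr (\<beta> * real n / 2 - 1)))
      else 0)"

end

theory Submission
  imports Defs "HOL-Complex_Analysis.Conformal_Mappings"
begin

text \<open>
  The data \<open>(a, b, l)\<close> and the eigenvalues are compared through the coefficients of the
  characteristic polynomial \<open>f\<close> of \<open>J + i l I\<^sub>1\<^sub>1\<close>: each of the maps from data to
  coefficients and from roots to coefficients is built up one dimension at a time, so that
  Fubini's theorem reduces both Jacobians to transformations of a single real or complex variable.

  \<^bold>\<open>Data to coefficients.\<close> Put \<open>\<zeta>\<^sub>k = b\<^sub>n\<^sub>-\<^sub>k + i l\<^sub>k\<close> for \<open>k < n\<close>, where \<open>l\<^sub>k = a\<^sub>n\<^sub>-\<^sub>k\<^sub>-\<^sub>1\<^sup>2\<close> for
  \<open>k < n - 1\<close> and the last \<open>l\<^sub>k\<close> is \<open>l\<close>. Removing the first row and column of the matrix gives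
  \<open>f\<^sub>n\<^sub>+\<^sub>1 = (x - \<zeta>\<^sub>n) Re f\<^sub>n + Im f\<^sub>n\<close>, with real and imaginary parts taken coefficientwise; so a new
  dimension enters as if the previous matrix carried the perturbation \<open>i a\<^sup>2\<close>
  (\<open>char_poly_perturbed_jacobi\<close>). For fixed \<open>\<zeta>\<^sub>n\<close> this recursion is a triangular affine map of the
  coefficients with determinant \<open>(Im \<zeta>\<^sub>n)\<^sup>n\<close>, and the top coefficient of the result is a real
  translate of \<open>- \<zeta>\<^sub>n\<close>.
  A Hermite--Biehler argument (\<open>roots_upper_step_iff\<close>) shows that \<open>f\<^sub>n\<^sub>+\<^sub>1\<close> has all its roots in the open
  upper half-plane iff \<open>Im \<zeta>\<^sub>n > 0\<close> and \<open>f\<^sub>n\<close> has. Hence the parameters in the upper half-plane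
  correspond to exactly the polynomials with roots there, with Jacobian \<open>\<Prod> (Im \<zeta>\<^sub>k)\<^sup>k\<close>
  (\<open>param_poly_change_of_variables\<close>).

  \<^bold>\<open>Roots to coefficients.\<close> Splitting off one root, \<open>f = (x - w) g\<close>, is a unipotent map of the
  coefficients of \<open>g\<close> for fixed \<open>w\<close>; the constant term of \<open>f\<close> is then a polynomial in \<open>w\<close> with
  derivative \<open>\<plusminus>g(w)\<close>, and the area formula for complex polynomials replaces \<open>dw\<close> by that constant
  term. This yields the factor \<open>\<Prod> |z\<^sub>j - z\<^sub>k|\<^sup>2\<close> (\<open>vieta_change_of_variables\<close>).

  \<^bold>\<open>Matching the densities.\<close> The parameters \<open>\<zeta>\<^sub>k\<close> are independent, with normal real parts and with
  gamma distributed imaginary parts for \<open>k < n - 1\<close> (\<open>jacobi_param_law\<close>). Three invariants of the recursion,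
  \<open>\<Sum> Im z\<^sub>j = l\<close>, \<open>\<Prod>\<^sub>j\<^sub>,\<^sub>k |z\<^sub>j - cnj z\<^sub>k| = 2\<^sup>n \<Prod> l\<^sub>k\<^sup>k\<^sup>+\<^sup>1\<close> and the value of
  \<open>\<Sum> (Re z\<^sub>j)\<^sup>2 / 2 + \<Sum>\<^sub>j\<^sub><\<^sub>k Im z\<^sub>j Im z\<^sub>k\<close>, turn the product density of the \<open>\<zeta>\<^sub>k\<close> into the claimed
  one (\<open>eigenvalue_weight_eq\<close>). Averaging over all orders of the roots accounts for the factor \<open>n!\<close>.
\<close>

section \<open>The area formula for complex polynomials\<close>

lemma lborel_complex_eq_distr:
  "(lborel :: complex measure) = distr (lborel \<Otimes>\<^sub>M lborel) borel (\<lambda>(x, y). Complex x y)"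
proof (rule lborel_eqI)
  have m[measurable]: "(\<lambda>(x, y). Complex x y) \<in> borel_measurable (lborel \<Otimes>\<^sub>M lborel)"
    unfolding Complex_eq by measurable
  fix l u :: complex
  assume le: "\<And>b. b \<in> Basis \<Longrightarrow> l \<bullet> b \<le> u \<bullet> b"
  have "Re l \<le> Re u" "Im l \<le> Im u"
    using le[of 1] le[of \<i>] by (auto simp: Basis_complex_def)
  moreover have "(\<lambda>(x, y). Complex x y) -` box l u \<inter> space (lborel \<Otimes>\<^sub>M lborel)
     = {Re l <..< Re u} \<times> {Im l <..< Im u}"
    by (auto simp: box_def Basis_complex_def space_pair_measure)
  ultimately show "emeasure (distr (lborel \<Otimes>\<^sub>M lborel) borel (\<lambda>(x, y). Complex x y)) (box l u)
      = ennreal (\<Prod>b\<in>Basis. (u - l) \<bullet> b)"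
    by (simp add: emeasure_distr lborel.emeasure_pair_measure_Times Basis_complex_def ennreal_mult)
qed simp

lemma nn_integral_lborel_complex:
  fixes f :: "complex \<Rightarrow> ennreal"
  assumes [measurable]: "f \<in> borel_measurable borel"
  shows "(\<integral>\<^sup>+z. f z \<partial>lborel) = (\<integral>\<^sup>+x. \<integral>\<^sup>+y. f (Complex x y) \<partial>lborel \<partial>lborel)"
proof -
  have m[measurable]: "(\<lambda>(x, y). Complex x y) \<in> borel_measurable (lborel \<Otimes>\<^sub>M lborel)"
    unfolding Complex_eq by measurable
  have [measurable]: "(\<lambda>(x, y). f (Complex x y)) \<in> borel_measurable (lborel \<Otimes>\<^sub>M lborel)"
    unfolding Complex_eq by measurable
  show ?thesis
    by (subst lborel_complex_eq_distr, subst nn_integral_distr)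
       (auto simp: split_beta' lborel.nn_integral_fst[symmetric])
qed

abbreviation complex_of_vec2 :: "real^2 \<Rightarrow> complex" where "complex_of_vec2 v \<equiv> Complex (v $ 1) (v $ 2)"
abbreviation vec2_of_complex :: "complex \<Rightarrow> real^2" where "vec2_of_complex z \<equiv> vector [Re z, Im z]"

lemma complex_of_vec2_measurable [measurable]: "complex_of_vec2 \<in> borel_measurable borel"
  unfolding Complex_eq by measurable

lemma lborel_complex_eq_distr2:
  "(lborel :: complex measure) = distr (lborel :: (real^2) measure) borel complex_of_vec2"
proof (rule lborel_eqI)
  fix l u :: complex
  assume le: "\<And>b. b \<in> Basis \<Longrightarrow> l \<bullet> b \<le> u \<bullet> b"
  have *: "Re l \<le> Re u" "Im l \<le> Im u"
    using le[of 1] le[of \<i>] by (auto simp: Basis_complex_def)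
  have "complex_of_vec2 -` box l u \<inter> space lborel = box (vec2_of_complex l) (vec2_of_complex u)"
    by (auto simp: box_def Basis_complex_def Basis_vec_def inner_axis forall_2)
  moreover have "emeasure lborel (box (vec2_of_complex l) (vec2_of_complex u)) = ennreal ((Re u - Re l) * (Im u - Im l))"
  proof -
    have B: "(Basis :: (real^2) set) = {axis 1 1, axis 2 1}"
      by (auto simp: Basis_vec_def UNIV_2)
    have "axis 1 (1::real) \<noteq> (axis 2 1 :: real^2)" by (simp add: axis_eq_axis)
    then show ?thesis using *
      by (subst emeasure_lborel_box) (auto simp: B inner_axis)
  qed
  ultimately show "emeasure (distr lborel borel complex_of_vec2) (box l u) = ennreal (\<Prod>b\<in>Basis. (u - l) \<bullet> b)"
    by (simp add: emeasure_distr Basis_complex_def)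
qed simp

text \<open>
  A complex derivative \<open>p'(w)\<close>, read as a real 2 by 2 matrix, has determinant \<open>|p'(w)|\<^sup>2\<close>; the claim
  is then the change of variables theorem in \<open>\<real>\<^sup>2\<close>. Boundedness of \<open>S\<close> makes the Jacobian integrable.
\<close>

lemma emeasure_poly_image:
  fixes p :: "complex poly"
  assumes S[measurable]: "S \<in> sets borel" and "bounded S" and inj: "inj_on (poly p) S"
    and pS[measurable]: "poly p ` S \<in> sets borel"
  shows "emeasure lborel (poly p ` S)
    = (\<integral>\<^sup>+w. ennreal ((cmod (poly (pderiv p) w))\<^sup>2) * indicator S w \<partial>lborel)"
proof -
  define S2 where "S2 = complex_of_vec2 -` S"
  define f where "f v = vec2_of_complex (poly p (complex_of_vec2 v))" for v
  define f' where "f' v d = vec2_of_complex (poly (pderiv p) (complex_of_vec2 v) * complex_of_vec2 d)" for v d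
  have complex_of_vec2_inverse [simp]: "complex_of_vec2 (vec2_of_complex z) = z" for z by simp
  have vec2_of_complex_inverse [simp]: "vec2_of_complex (complex_of_vec2 v) = v" for v by (simp add: Finite_Cartesian_Product.vec_eq_iff forall_2)
  have meas_p[measurable]: "poly q \<in> borel_measurable borel" for q :: "complex poly"
    by (intro borel_measurable_continuous_onI continuous_intros)
  have S2[measurable]: "S2 \<in> sets borel"
    unfolding S2_def using measurable_sets[OF complex_of_vec2_measurable S] by simp
  have bl: "bounded_linear complex_of_vec2"
    by (rule linear_conv_bounded_linear[THEN iffD1]) (auto simp: linear_iff complex_eq_iff)
  have bl2: "bounded_linear vec2_of_complex"
    by (rule linear_conv_bounded_linear[THEN iffD1]) (auto simp: linear_iff Finite_Cartesian_Product.vec_eq_iff forall_2)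
  have der: "(f has_derivative f' v) (at v within S2)" for v
    unfolding f_def[abs_def] f'_def[abs_def]
    by (intro bounded_linear.has_derivative[OF bl2]
        has_derivative_compose[OF bounded_linear.has_derivative[OF bl has_derivative_ident], of "poly p" "\<lambda>h. poly (pderiv p) (complex_of_vec2 v) * h"])
       (use poly_DERIV[of p "complex_of_vec2 v"] in \<open>auto simp: has_field_derivative_def\<close>)
  have inj2: "inj_on f S2"
  proof (rule inj_onI)
    fix x y assume xy: "x \<in> S2" "y \<in> S2" "f x = f y"
    then have "poly p (complex_of_vec2 x) = poly p (complex_of_vec2 y)" unfolding f_def by (metis complex_of_vec2_inverse)
    then have "complex_of_vec2 x = complex_of_vec2 y" using inj xy by (auto simp: S2_def inj_on_def)
    then show "x = y" by (metis vec2_of_complex_inverse)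
  qed
  have det: "\<bar>Determinants.det (matrix (f' v))\<bar> = (cmod (poly (pderiv p) (complex_of_vec2 v)))\<^sup>2" for v
    by (simp add: det_2 matrix_def f'_def axis_def flip: power2_eq_square) (simp add: cmod_power2)
  obtain B where B: "\<And>w. w \<in> S \<Longrightarrow> cmod w \<le> B" using \<open>bounded S\<close> by (auto simp: bounded_iff)
  have "bounded (poly (pderiv p) ` cball 0 B)"
    by (intro compact_imp_bounded compact_continuous_image continuous_intros compact_cball)
  then obtain C where C: "\<And>w. w \<in> cball 0 B \<Longrightarrow> cmod (poly (pderiv p) w) \<le> C"
    unfolding bounded_iff by blast
  let ?g = "\<lambda>v. indicator S2 v * (cmod (poly (pderiv p) (complex_of_vec2 v)))\<^sup>2"
  have S2b: "emeasure lborel S2 < \<infinity>"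
  proof -
    have "bounded S2"
    proof -
      have "S2 \<subseteq> vec2_of_complex ` S"
      proof
        fix v assume "v \<in> S2"
        then have "complex_of_vec2 v \<in> S" unfolding S2_def by simp
        from imageI[OF this, of vec2_of_complex] show "v \<in> vec2_of_complex ` S" unfolding vec2_of_complex_inverse .
      qed
      moreover have "bounded (vec2_of_complex ` S)" using bounded_linear_image[OF \<open>bounded S\<close> bl2] .
      ultimately show ?thesis using bounded_subset by blast
    qed
    then show ?thesis by (metis emeasure_bounded_finite)
  qed
  have int: "integrable lborel ?g"
  proof (rule Bochner_Integration.integrable_bound)
    show "integrable lborel (\<lambda>v. indicator S2 v * C\<^sup>2 :: real)" using S2b by simp
    have "\<bar>indicator S2 x * (cmod (poly (pderiv p) (complex_of_vec2 x)))\<^sup>2\<bar> \<le> \<bar>indicator S2 x * C\<^sup>2\<bar>" for x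
      using C[of "complex_of_vec2 x"] B[of "complex_of_vec2 x"] by (auto simp: indicator_def S2_def power_mono)
    then show "AE x in lborel. norm (?g x) \<le> norm (indicator S2 x * C\<^sup>2 :: real)" by simp
  qed measurable
  have "(?g has_integral integral\<^sup>L lborel ?g) UNIV" by (rule has_integral_integral_lborel[OF int])
  moreover have g_if: "(\<lambda>v. if v \<in> S2 then (cmod (poly (pderiv p) (complex_of_vec2 v)))\<^sup>2 else 0) = ?g"
    by (auto simp: fun_eq_iff)
  ultimately have "((\<lambda>v. (cmod (poly (pderiv p) (complex_of_vec2 v)))\<^sup>2) has_integral integral\<^sup>L lborel ?g) S2"
    using has_integral_restrict_UNIV[of S2 "\<lambda>v. (cmod (poly (pderiv p) (complex_of_vec2 v)))\<^sup>2" "integral\<^sup>L lborel ?g"]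
    unfolding g_if by simp
  then have "((\<lambda>v. \<bar>Determinants.det (matrix (f' v))\<bar>) has_integral integral\<^sup>L lborel ?g) S2" by (simp add: det)
  with has_measure_differentiable_image[OF _ der inj2, of "integral\<^sup>L lborel ?g"]
  have m: "f ` S2 \<in> lmeasurable" "measure lebesgue (f ` S2) = integral\<^sup>L lborel ?g" by auto
  have fS2: "f ` S2 = complex_of_vec2 -` (poly p ` S)"
  proof (intro Set.set_eqI iffI)
    fix v assume "v \<in> f ` S2"
    then obtain u where "v = vec2_of_complex (poly p (complex_of_vec2 u))" "complex_of_vec2 u \<in> S" unfolding f_def S2_def by blast
    then show "v \<in> complex_of_vec2 -` (poly p ` S)" by simp
  next
    fix v assume "v \<in> complex_of_vec2 -` (poly p ` S)"
    then obtain w where w: "complex_of_vec2 v = poly p w" "w \<in> S" by blast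
    have "v = f (vec2_of_complex w)" unfolding f_def complex_of_vec2_inverse w(1)[symmetric] by (rule vec2_of_complex_inverse[symmetric])
    moreover have "vec2_of_complex w \<in> S2" using w unfolding S2_def by simp
    ultimately show "v \<in> f ` S2" by (rule image_eqI)
  qed
  have b: "f ` S2 \<in> sets borel" unfolding fS2 using measurable_sets[OF complex_of_vec2_measurable pS] by simp
  have "emeasure lborel (poly p ` S) = emeasure lborel (f ` S2)"
    unfolding fS2 by (subst lborel_complex_eq_distr2, subst emeasure_distr) auto
  also have "\<dots> = emeasure lebesgue (f ` S2)" using b by simp
  also have "\<dots> = ennreal (integral\<^sup>L lborel ?g)"
    by (subst emeasure_eq_ennreal_measure) (use m fmeasurableD2[OF m(1)] in auto)
  also have "\<dots> = (\<integral>\<^sup>+v. ennreal (?g v) \<partial>lborel)"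
    by (rule nn_integral_eq_integral[symmetric, OF int]) simp
  also have "\<dots> = (\<integral>\<^sup>+v. ennreal ((cmod (poly (pderiv p) (complex_of_vec2 v)))\<^sup>2) * indicator S (complex_of_vec2 v) \<partial>lborel)"
    by (intro nn_integral_cong) (auto simp: indicator_def S2_def)
  also have "\<dots> = (\<integral>\<^sup>+w. ennreal ((cmod (poly (pderiv p) w))\<^sup>2) * indicator S w \<partial>lborel)"
    by (subst lborel_complex_eq_distr2, subst nn_integral_distr) auto
  finally show ?thesis .
qed


text \<open>
  The measure identity for images says that \<open>p\<close> pushes \<open>|p'|\<^sup>2 dw\<close> on \<open>U\<close> forward to Lebesgue measure
  on \<open>p(U)\<close>. Invariance of domain makes \<open>p(U)\<close> open and the inverse branch continuous, hence measurable.
\<close>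

lemma poly_subst_inj:
  fixes p :: "complex poly" and \<psi> :: "complex \<Rightarrow> ennreal"
  assumes U: "open U" "bounded U" and inj: "inj_on (poly p) U"
    and [measurable]: "\<psi> \<in> borel_measurable borel"
  defines "g \<equiv> inv_into U (poly p)"
  shows "(\<lambda>c. \<psi> (g c) * indicator (poly p ` U) c) \<in> borel_measurable borel" (is ?m)
    and "(\<integral>\<^sup>+w. \<psi> w * ennreal ((cmod (poly (pderiv p) w))\<^sup>2) * indicator U w \<partial>lborel)
      = (\<integral>\<^sup>+c. \<psi> (g c) * indicator (poly p ` U) c \<partial>lborel)" (is ?i)
proof -
  have meas_p[measurable]: "poly q \<in> borel_measurable borel" for q :: "complex poly"
    by (intro borel_measurable_continuous_onI continuous_intros)
  have cont: "continuous_on U (poly p)" by (intro continuous_intros)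
  have opU: "open (poly p ` U)"
    using invariance_of_domain[OF cont U(1) inj] .
  have gp: "g (poly p w) = w" if "w \<in> U" for w
    using that inj by (simp add: g_def inv_into_f_f)
  have contg: "continuous_on (poly p ` U) g"
  proof -
    have "open (g -` V \<inter> poly p ` U)" if "open V" for V
    proof -
      have "g -` V \<inter> poly p ` U = poly p ` (V \<inter> U)" using gp by auto
      moreover have "open (poly p ` (V \<inter> U))"
        by (rule invariance_of_domain)
           (use that U inj in \<open>auto intro: continuous_intros inj_on_subset\<close>)
      ultimately show ?thesis by simp
    qed
    then show ?thesis by (subst continuous_on_open_vimage[OF opU]) (simp add: Int_commute)
  qed
  have [measurable]: "U \<in> sets borel" "poly p ` U \<in> sets borel" using U opU by auto
  have mg: "(\<lambda>c. if c \<in> poly p ` U then g c else 0) \<in> borel_measurable borel"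
    by (rule borel_measurable_continuous_on_if) (use contg in auto)
  have "(\<lambda>c. \<psi> (if c \<in> poly p ` U then g c else 0) * indicator (poly p ` U) c) \<in> borel_measurable borel"
    using mg by measurable
  also have "(\<lambda>c. \<psi> (if c \<in> poly p ` U then g c else 0) * indicator (poly p ` U) c)
    = (\<lambda>c. \<psi> (g c) * indicator (poly p ` U) c)" by (auto simp: indicator_def)
  finally show ?m .
  note [measurable] = this
  let ?D = "density lborel (\<lambda>w. ennreal ((cmod (poly (pderiv p) w))\<^sup>2) * indicator U w)"
  have eq: "distr ?D borel (poly p) = density lborel (indicator (poly p ` U))"
  proof (rule measure_eqI)
    fix A assume "A \<in> sets (distr ?D borel (poly p))"
    then have A[measurable]: "A \<in> sets borel" by simp
    have pA[measurable]: "poly p -` A \<in> sets borel" using measurable_sets[OF meas_p A] by simp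
    have img: "poly p ` (U \<inter> poly p -` A) = A \<inter> poly p ` U" by auto
    have [measurable]: "U \<inter> poly p -` A \<in> sets borel" by measurable
    have "emeasure (distr ?D borel (poly p)) A = emeasure ?D (poly p -` A)"
      by (subst emeasure_distr) auto
    also have "\<dots> = (\<integral>\<^sup>+w. ennreal ((cmod (poly (pderiv p) w))\<^sup>2) * indicator (U \<inter> poly p -` A) w \<partial>lborel)"
      by (subst emeasure_density) (auto intro!: nn_integral_cong split: split_indicator)
    also have "\<dots> = emeasure lborel (poly p ` (U \<inter> poly p -` A))"
      by (rule emeasure_poly_image[symmetric])
         (use U inj in \<open>auto simp: img intro: inj_on_subset bounded_subset\<close>)
    also have "\<dots> = emeasure (density lborel (indicator (poly p ` U))) A"
      unfolding img by (subst emeasure_density) (auto simp: Int_commute simp flip: indicator_inter_arith)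
    finally show "emeasure (distr ?D borel (poly p)) A = emeasure (density lborel (indicator (poly p ` U))) A" .
  qed simp
  have "(\<integral>\<^sup>+w. \<psi> w * ennreal ((cmod (poly (pderiv p) w))\<^sup>2) * indicator U w \<partial>lborel)
    = (\<integral>\<^sup>+w. \<psi> (g (poly p w)) * indicator (poly p ` U) (poly p w) \<partial>?D)"
    by (subst nn_integral_density) (auto intro!: nn_integral_cong simp: gp mult_ac split: split_indicator)
  also have "\<dots> = (\<integral>\<^sup>+c. \<psi> (g c) * indicator (poly p ` U) c \<partial>distr ?D borel (poly p))"
    by (subst nn_integral_distr) auto
  also have "\<dots> = (\<integral>\<^sup>+c. \<psi> (g c) * indicator (poly p ` U) c \<partial>lborel)"
    unfolding eq by (subst nn_integral_density) (auto intro!: nn_integral_cong split: split_indicator)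
  finally show ?i .
qed

text \<open>
  Away from the finitely many zeros of \<open>p'\<close> the map is locally injective. Countably many balls of
  injectivity cover the rest; made disjoint, they split the integral into pieces on which the
  substitution rule applies, and summing the pieces collects all preimages of each value.
\<close>

theorem area_formula_poly:
  fixes p :: "complex poly" and \<psi> :: "complex \<Rightarrow> ennreal"
  assumes p: "degree p \<noteq> 0" and [measurable]: "\<psi> \<in> borel_measurable borel"
  shows "(\<integral>\<^sup>+w. \<psi> w * ennreal ((cmod (poly (pderiv p) w))\<^sup>2) \<partial>lborel)
    = (\<integral>\<^sup>+c. (\<Sum>w\<in>{w. poly p w = c}. \<psi> w) \<partial>lborel)"
proof -
  define Z where "Z = {w. poly (pderiv p) w = 0}"
  define F where "F = {B. \<exists>w r. B = ball w r \<and> inj_on (poly p) B}"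
  have meas_p[measurable]: "poly q \<in> borel_measurable borel" for q :: "complex poly"
    by (intro borel_measurable_continuous_onI continuous_intros)
  have "pderiv p \<noteq> 0" using p by (simp add: pderiv_eq_0_iff)
  then have finZ: "finite Z" unfolding Z_def by (rule poly_roots_finite)
  have fin: "finite {w. poly p w = c}" for c
  proof -
    have "p - [:c:] \<noteq> 0" using p by auto
    then have "finite {w. poly (p - [:c:]) w = 0}" by (rule poly_roots_finite)
    then show ?thesis by simp
  qed
  have holp: "poly p holomorphic_on UNIV"
    unfolding holomorphic_on_def field_differentiable_def using poly_DERIV by blast
  have cover: "w \<in> \<Union>F" if "w \<notin> Z" for w
  proof -
    have "deriv (poly p) w \<noteq> 0" using that DERIV_imp_deriv[OF poly_DERIV[of p w]] by (simp add: Z_def)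
    then obtain r where "r > 0" "inj_on (poly p) (ball w r)"
      using has_complex_derivative_locally_injective[of "poly p" UNIV w] holp by auto
    then show ?thesis unfolding F_def by (auto intro!: exI[of _ "ball w r"])
  qed
  obtain F' where F': "F' \<subseteq> F" "countable F'" "\<Union>F' = \<Union>F"
    using Lindelof[of F] by (auto simp: F_def)
  obtain w0 where "w0 \<notin> Z" using finZ by (metis ex_new_if_finite infinite_UNIV_char_0)
  then have "F' \<noteq> {}" using cover[of w0] F'(3) by auto
  define U where "U = from_nat_into F'"
  have rangeU: "range U = F'" using F' \<open>F' \<noteq> {}\<close> unfolding U_def by simp
  then have "U i \<in> F" for i using F' by auto
  then have U: "open (U i)" "bounded (U i)" "inj_on (poly p) (U i)" for i
    unfolding F_def by (smt (verit) mem_Collect_eq open_ball bounded_ball)+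
  have [measurable]: "U i \<in> sets borel" for i using U(1) by auto
  define S where "S = disjointed U"
  have disj: "disjoint_family S" unfolding S_def by (rule disjoint_family_disjointed)
  have SU: "S i \<subseteq> U i" for i unfolding S_def by (rule disjointed_subset)
  have S_cover: "\<exists>i. w \<in> S i" if "w \<notin> Z" for w
  proof -
    have "w \<in> (\<Union>i. U i)" using cover[OF that] F' rangeU by auto
    also have "(\<Union>i. U i) = (\<Union>i. S i)" unfolding S_def by (rule UN_disjointed_eq[symmetric])
    finally show ?thesis by auto
  qed
  have Sm[measurable]: "S i \<in> sets borel" for i
    unfolding S_def disjointed_def using U(1) by auto
  define g where "g i = inv_into (U i) (poly p)" for i
  let ?\<psi> = "\<lambda>i w. \<psi> w * indicator (S i) w"
  \<comment> \<open>Exactly one of the disjoint pieces contains a given noncritical point.\<close>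
  have split: "(\<Sum>i. \<psi> w * indicator (S i) w) = \<psi> w" if w: "w \<notin> Z" for w
  proof -
    obtain i where "w \<in> S i" using S_cover[OF w] by auto
    then show ?thesis using suminf_cmult_indicator[OF disj, of w i "\<lambda>_. \<psi> w"] by simp
  qed
  have "(\<integral>\<^sup>+w. \<psi> w * ennreal ((cmod (poly (pderiv p) w))\<^sup>2) \<partial>lborel)
    = (\<integral>\<^sup>+w. (\<Sum>i. ?\<psi> i w * ennreal ((cmod (poly (pderiv p) w))\<^sup>2) * indicator (U i) w) \<partial>lborel)"
  proof (rule nn_integral_cong)
    fix w
    have "(\<Sum>i. ?\<psi> i w * ennreal ((cmod (poly (pderiv p) w))\<^sup>2) * indicator (U i) w)
      = (\<Sum>i. ?\<psi> i w * ennreal ((cmod (poly (pderiv p) w))\<^sup>2))"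
      using SU by (intro suminf_cong) (auto split: split_indicator)
    also have "\<dots> = (\<Sum>i. ?\<psi> i w) * ennreal ((cmod (poly (pderiv p) w))\<^sup>2)"
      by (rule ennreal_suminf_multc)
    also have "\<dots> = \<psi> w * ennreal ((cmod (poly (pderiv p) w))\<^sup>2)"
      using split[of w] by (cases "w \<in> Z") (auto simp: Z_def)
    finally show "\<psi> w * ennreal ((cmod (poly (pderiv p) w))\<^sup>2)
      = (\<Sum>i. ?\<psi> i w * ennreal ((cmod (poly (pderiv p) w))\<^sup>2) * indicator (U i) w)" ..
  qed
  also have "\<dots> = (\<Sum>i. \<integral>\<^sup>+w. ?\<psi> i w * ennreal ((cmod (poly (pderiv p) w))\<^sup>2) * indicator (U i) w \<partial>lborel)"
    by (rule nn_integral_suminf) measurable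
  also have "\<dots> = (\<Sum>i. \<integral>\<^sup>+c. ?\<psi> i (g i c) * indicator (poly p ` U i) c \<partial>lborel)"
    unfolding g_def by (intro suminf_cong poly_subst_inj(2)) (use U in measurable)
  also have "\<dots> = (\<integral>\<^sup>+c. (\<Sum>i. ?\<psi> i (g i c) * indicator (poly p ` U i) c) \<partial>lborel)"
    unfolding g_def by (intro nn_integral_suminf[symmetric], unfold measurable_lborel2, intro poly_subst_inj(1)) (use U in measurable)
  also have "\<dots> = (\<integral>\<^sup>+c. (\<Sum>w\<in>{w. poly p w = c}. \<psi> w) \<partial>lborel)"
  proof (rule nn_integral_cong_AE)
    have "AE c in lborel. c \<notin> poly p ` Z"
      by (rule AE_not_in, rule finite_imp_null_set_lborel) (use finZ in simp)
    then show "AE c in lborel. (\<Sum>i. ?\<psi> i (g i c) * indicator (poly p ` U i) c)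
        = (\<Sum>w\<in>{w. poly p w = c}. \<psi> w)"
    proof eventually_elim
      case (elim c)
      have *: "?\<psi> i (g i c) * indicator (poly p ` U i) c = (\<Sum>w\<in>{w. poly p w = c}. ?\<psi> i w)" for i
      proof (cases "c \<in> poly p ` U i")
        case True
        then obtain w where w: "w \<in> U i" "poly p w = c" by auto
        then have "g i c = w" unfolding g_def using U(3) by (auto simp: inv_into_f_f)
        have "(\<Sum>w\<in>{w. poly p w = c}. ?\<psi> i w) = (\<Sum>w\<in>{w}. ?\<psi> i w)"
        proof (rule sum.mono_neutral_right[OF fin])
          show "\<forall>v\<in>{w. poly p w = c} - {w}. \<psi> v * indicator (S i) v = 0"
          proof
            fix v assume v: "v \<in> {w. poly p w = c} - {w}"
            then have "v \<notin> U i" using inj_onD[OF U(3), of v w] w by auto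
            then show "\<psi> v * indicator (S i) v = 0" using SU by (auto split: split_indicator)
          qed
        qed (use w in auto)
        then show ?thesis using True \<open>g i c = w\<close> by (cases "w \<in> S i") simp_all
      next
        case False
        then have "w \<notin> S i" if "poly p w = c" for w using that SU by blast
        then show ?thesis using False by simp
      qed
      have "(\<Sum>i. ?\<psi> i (g i c) * indicator (poly p ` U i) c) = (\<Sum>w\<in>{w. poly p w = c}. (\<Sum>i. ?\<psi> i w))"
        unfolding * by (rule suminf_sum) simp
      also have "\<dots> = (\<Sum>w\<in>{w. poly p w = c}. \<psi> w)"
        using elim by (intro sum.cong refl split) auto
      finally show ?case .
    qed
  qed
  finally show ?thesis .
qed

section \<open>Measurable dependence of the roots on the coefficients\<close>

definition root_list :: "complex poly \<Rightarrow> complex list" where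
  "root_list p = (THE zs. mset zs = proots p \<and> sorted_wrt lex_le zs)"

lemma eigenvalue_list_eq_root_list: "eigenvalue_list A = root_list (char_poly A)"
  by (simp add: eigenvalue_list_def root_list_def)

lemma root_list_eqI: "mset zs = proots p \<Longrightarrow> sorted_wrt lex_le zs \<Longrightarrow> root_list p = zs"
  unfolding root_list_def by (rule the_equality) (auto intro: lex_le_sorted_unique)

lemma root_list:
  shows mset_root_list: "mset (root_list p) = proots p"
    and sorted_root_list: "sorted_wrt lex_le (root_list p)"
  using lex_le_sorted_exists[of "proots p"] root_list_eqI[of _ p] by auto

lemma length_root_list: "length (root_list p) = degree p"
  by (metis mset_root_list size_mset size_proots_complex)

lemma set_root_list: "p \<noteq> 0 \<Longrightarrow> set (root_list p) = {z. poly p z = 0}"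
  by (metis mset_root_list set_count_proots set_mset_mset)

text \<open>
  On a compact set a continuous function has a zero iff its values on a countable dense subset come
  arbitrarily close to 0, which is a countable condition.
\<close>

lemma exists_zero_compact_measurable:
  fixes g :: "'w \<Rightarrow> 'b::{metric_space, second_countable_topology} \<Rightarrow> 'c::real_normed_vector" and K :: "'b set"
  assumes K: "compact K" and m: "\<And>z. z \<in> K \<Longrightarrow> (\<lambda>\<omega>. norm (g \<omega> z)) \<in> borel_measurable M"
    and cont: "\<And>\<omega>. continuous_on K (g \<omega>)"
  shows "Measurable.pred M (\<lambda>\<omega>. \<exists>z\<in>K. g \<omega> z = 0)"
proof (cases "K = {}")
  case False
  obtain D where D: "countable D" "D \<subseteq> K" "K \<subseteq> closure D"
    using separable[of K] by blast
  have [measurable]: "(\<lambda>\<omega>. norm (g \<omega> z)) \<in> borel_measurable M" if "z \<in> D" for z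
    using m that D by auto
  have "(\<exists>z\<in>K. g \<omega> z = 0) \<longleftrightarrow> (\<forall>m::nat. \<exists>d\<in>D. norm (g \<omega> d) < inverse (Suc m))" for \<omega>
  proof
    assume "\<exists>z\<in>K. g \<omega> z = 0"
    then obtain z where z: "z \<in> K" "g \<omega> z = 0" by auto
    show "\<forall>m::nat. \<exists>d\<in>D. norm (g \<omega> d) < inverse (Suc m)"
    proof
      fix m :: nat
      have "0 < inverse (real (Suc m))" by simp
      then obtain \<delta> where \<delta>: "\<delta> > 0" "\<And>x. x \<in> K \<Longrightarrow> dist x z < \<delta> \<Longrightarrow> dist (g \<omega> x) (g \<omega> z) < inverse (Suc m)"
        using cont[of \<omega>] z(1) unfolding continuous_on_iff by metis
      obtain d where "d \<in> D" "dist d z < \<delta>"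
        using D(3) z(1) \<delta>(1) by (meson closure_approachable subsetD)
      then show "\<exists>d\<in>D. norm (g \<omega> d) < inverse (Suc m)"
        using \<delta>(2)[of d] D(2) z(2) by (auto simp: dist_norm)
    qed
  next
    assume *: "\<forall>m::nat. \<exists>d\<in>D. norm (g \<omega> d) < inverse (Suc m)"
    have "continuous_on K (\<lambda>z. norm (g \<omega> z))" using cont by (intro continuous_intros)
    then obtain z where z: "z \<in> K" "\<And>y. y \<in> K \<Longrightarrow> norm (g \<omega> z) \<le> norm (g \<omega> y)"
      using continuous_attains_inf[OF K False] by blast
    have "norm (g \<omega> z) < inverse (Suc m)" for m
      using * z(2) D(2) by (meson le_less_trans subsetD)
    then have "norm (g \<omega> z) \<le> 0"
      by (meson not_le reals_Archimedean less_imp_not_less)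
    then show "\<exists>z\<in>K. g \<omega> z = 0" using z(1) by auto
  qed
  then show ?thesis using D(1)
    by (simp only:) measurable
qed simp

lemma exists_zero_Union_compact_measurable:
  fixes g :: "'w \<Rightarrow> 'b::{metric_space, second_countable_topology} \<Rightarrow> 'c::real_normed_vector"
  assumes K: "\<And>R::nat. compact (K R)" and C: "C = (\<Union>R. K R)"
    and m: "\<And>z. (\<lambda>\<omega>. norm (g \<omega> z)) \<in> borel_measurable M"
    and cont: "\<And>\<omega>. continuous_on UNIV (g \<omega>)"
  shows "Measurable.pred M (\<lambda>\<omega>. \<exists>z\<in>C. g \<omega> z = 0)"
proof -
  have [measurable]: "Measurable.pred M (\<lambda>\<omega>. \<exists>z\<in>K R. g \<omega> z = 0)" for R
    using assms by (intro exists_zero_compact_measurable) (auto intro: continuous_on_subset)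
  have "(\<lambda>\<omega>. \<exists>z\<in>C. g \<omega> z = 0) = (\<lambda>\<omega>. \<exists>R. \<exists>z\<in>K R. g \<omega> z = 0)" unfolding C by auto
  then show ?thesis by simp
qed

lemma poly_measurable_coeffs:
  fixes f :: "'w \<Rightarrow> complex poly"
  assumes [measurable]: "\<And>k. (\<lambda>\<omega>. coeff (f \<omega>) k) \<in> borel_measurable M" "z \<in> borel_measurable M"
    and deg: "\<And>\<omega>. degree (f \<omega>) \<le> n"
  shows "(\<lambda>\<omega>. poly (f \<omega>) (z \<omega>)) \<in> borel_measurable M"
proof -
  have "poly (f \<omega>) (z \<omega>) = (\<Sum>k\<le>n. coeff (f \<omega>) k * z \<omega> ^ k)" for \<omega>
    by (subst poly_altdef, rule sum.mono_neutral_left) (use deg[of \<omega>] in \<open>auto simp: coeff_eq_0\<close>)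
  then show ?thesis by simp
qed

definition lex_min_root :: "complex poly \<Rightarrow> complex" where
  "lex_min_root p = hd (root_list p)"

text \<open>
  The real part of the first root is at most \<open>t\<close> iff there is a root in the half-plane \<open>Re z \<le> t\<close>,
  and, once that real part is known, the imaginary part is at most \<open>t\<close> iff there is a root on a
  vertical half-line. Both are existence statements of the kind treated above.
\<close>

lemma lex_min_root_measurable:
  fixes f :: "'w \<Rightarrow> complex poly"
  assumes [measurable]: "\<And>k. (\<lambda>\<omega>. coeff (f \<omega>) k) \<in> borel_measurable M"
    and deg: "\<And>\<omega>. degree (f \<omega>) = Suc n"
  shows "(\<lambda>\<omega>. lex_min_root (f \<omega>)) \<in> borel_measurable M"
proof -
  define m where "m \<omega> = lex_min_root (f \<omega>)" for \<omega>
  have ne: "f \<omega> \<noteq> 0" for \<omega> using deg[of \<omega>] by auto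
  define ms where "ms \<omega> = tl (root_list (f \<omega>))" for \<omega>
  have ms: "root_list (f \<omega>) = m \<omega> # ms \<omega>" for \<omega>
    using length_root_list[of "f \<omega>"] deg[of \<omega>] unfolding m_def ms_def lex_min_root_def
    by (cases "root_list (f \<omega>)") auto
  have root: "poly (f \<omega>) (m \<omega>) = 0" for \<omega> using set_root_list[OF ne[of \<omega>]] ms[of \<omega>] by auto
  have min: "lex_le (m \<omega>) z" if "poly (f \<omega>) z = 0" for \<omega> z
  proof -
    have "z \<in> set (m \<omega> # ms \<omega>)" using set_root_list[OF ne[of \<omega>]] ms[of \<omega>] that by auto
    then show ?thesis using sorted_root_list[of "f \<omega>"] unfolding ms by (auto simp: lex_le_def)
  qed
  have [measurable]: "(\<lambda>\<omega>. poly (f \<omega>) (z \<omega>)) \<in> borel_measurable M" if "z \<in> borel_measurable M" for z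
    using that deg by (intro poly_measurable_coeffs[where n = "Suc n"]) auto
  have Re_m[measurable]: "(\<lambda>\<omega>. Re (m \<omega>)) \<in> borel_measurable M"
  proof (subst borel_measurable_iff_le, intro allI)
    fix t
    have "(\<lambda>\<omega>. Re (m \<omega>) \<le> t) = (\<lambda>\<omega>. \<exists>z\<in>{z. Re z \<le> t}. poly (f \<omega>) z = 0)"
    proof (intro ext iffI)
      fix \<omega> assume "Re (m \<omega>) \<le> t"
      then show "\<exists>z\<in>{z. Re z \<le> t}. poly (f \<omega>) z = 0" using root[of \<omega>] by auto
    next
      fix \<omega> assume "\<exists>z\<in>{z. Re z \<le> t}. poly (f \<omega>) z = 0"
      then obtain z where "Re z \<le> t" "lex_le (m \<omega>) z" using min by auto
      then show "Re (m \<omega>) \<le> t" by (auto simp: lex_le_def)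
    qed
    moreover have "Measurable.pred M (\<lambda>\<omega>. \<exists>z\<in>{z. Re z \<le> t}. poly (f \<omega>) z = 0)"
    proof (rule exists_zero_Union_compact_measurable[where K = "\<lambda>R. cball 0 (real R) \<inter> {z. Re z \<le> t}"])
      show "compact (cball 0 (real R) \<inter> {z. Re z \<le> t})" for R
        by (intro compact_Int_closed compact_cball closed_halfspace_Re_le)
      show "{z. Re z \<le> t} = (\<Union>R. cball 0 (real R) \<inter> {z. Re z \<le> t})"
        by (auto simp: real_arch_simple)
    qed (auto intro!: continuous_intros)
    ultimately have "Measurable.pred M (\<lambda>\<omega>. Re (m \<omega>) \<le> t)" by (simp only:)
    then show "{\<omega> \<in> space M. Re (m \<omega>) \<le> t} \<in> sets M" by (simp only: pred_def)
  qed
  have Im_m[measurable]: "(\<lambda>\<omega>. Im (m \<omega>)) \<in> borel_measurable M"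
  proof (subst borel_measurable_iff_le, intro allI)
    fix t
    have "(\<lambda>\<omega>. Im (m \<omega>) \<le> t) = (\<lambda>\<omega>. \<exists>y\<in>{..t}. poly (f \<omega>) (Complex (Re (m \<omega>)) y) = 0)"
    proof (intro ext iffI)
      fix \<omega> assume "Im (m \<omega>) \<le> t"
      then show "\<exists>y\<in>{..t}. poly (f \<omega>) (Complex (Re (m \<omega>)) y) = 0"
        using root[of \<omega>] by (intro bexI[of _ "Im (m \<omega>)"]) auto
    next
      fix \<omega> assume "\<exists>y\<in>{..t}. poly (f \<omega>) (Complex (Re (m \<omega>)) y) = 0"
      then show "Im (m \<omega>) \<le> t" using min[of \<omega>] by (fastforce simp: lex_le_def)
    qed
    moreover have "Measurable.pred M (\<lambda>\<omega>. \<exists>y\<in>{..t}. poly (f \<omega>) (Complex (Re (m \<omega>)) y) = 0)"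
    proof (rule exists_zero_Union_compact_measurable[where K = "\<lambda>R. {- real R..t}"])
      show "{..t} = (\<Union>R. {- real R..t})"
        by (auto simp: minus_le_iff real_arch_simple)
      show "(\<lambda>\<omega>. norm (poly (f \<omega>) (Complex (Re (m \<omega>)) z))) \<in> borel_measurable M" for z
        unfolding Complex_eq by measurable
      show "continuous_on UNIV (\<lambda>y. poly (f \<omega>) (Complex (Re (m \<omega>)) y))" for \<omega>
        unfolding Complex_eq by (intro continuous_intros)
    qed auto
    ultimately have "Measurable.pred M (\<lambda>\<omega>. Im (m \<omega>) \<le> t)" by (simp only:)
    then show "{\<omega> \<in> space M. Im (m \<omega>) \<le> t} \<in> sets M" by (simp only: pred_def)
  qed
  show ?thesis
    unfolding borel_measurable_complex_iff m_def[symmetric] by auto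
qed

lemma root_list_deflate:
  assumes "degree p = Suc n"
  defines "m \<equiv> lex_min_root p"
  defines "q \<equiv> p div [:-m, 1:]"
  shows "p = [:-m, 1:] * q" "root_list p = m # root_list q" "degree q = n" "lead_coeff q = lead_coeff p"
proof -
  have "p \<noteq> 0" using assms by auto
  obtain ms where ms: "root_list p = m # ms"
    by (metis length_root_list assms(1) length_Suc_conv list.sel(1) lex_min_root_def m_def)
  then have root: "poly p m = 0" using set_root_list[OF \<open>p \<noteq> 0\<close>] by auto
  then show pq: "p = [:-m, 1:] * q" unfolding q_def
    by (metis poly_eq_0_iff_dvd dvd_mult_div_cancel)
  then have "q \<noteq> 0" using \<open>p \<noteq> 0\<close> by auto
  have "add_mset m (proots q) = proots p"
    by (subst pq, subst proots_mult) (use \<open>q \<noteq> 0\<close> in auto)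
  also have "\<dots> = add_mset m (mset ms)" using mset_root_list[of p] ms by simp
  finally have "root_list q = ms"
    using sorted_root_list[of p] by (intro root_list_eqI) (auto simp: ms)
  with ms show "root_list p = m # root_list q" by simp
  show "degree q = n" using assms(1) \<open>q \<noteq> 0\<close> by (subst (asm) pq, subst (asm) degree_mult_eq) auto
  show "lead_coeff q = lead_coeff p" using lead_coeff_mult[of "[:-m, 1:]" q] by (simp only: pq[symmetric]) simp
qed

text \<open>
  Induction on the degree: split off the lexicographically first root; the coefficients of the
  quotient are computed from the top down by synthetic division and so remain measurable.
\<close>

lemma root_list_measurable:
  fixes f :: "'w \<Rightarrow> complex poly"
  assumes "\<And>k. (\<lambda>\<omega>. coeff (f \<omega>) k) \<in> borel_measurable M"
    and "\<And>\<omega>. degree (f \<omega>) = n" and "i < n"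
  shows "(\<lambda>\<omega>. root_list (f \<omega>) ! i) \<in> borel_measurable M"
  using assms
proof (induction n arbitrary: f i)
  case (Suc n)
  note [measurable] = Suc.prems(1)
  define m where "m \<omega> = lex_min_root (f \<omega>)" for \<omega>
  define q where "q \<omega> = f \<omega> div [:- m \<omega>, 1:]" for \<omega>
  have defl: "f \<omega> = [:- m \<omega>, 1:] * q \<omega>" "root_list (f \<omega>) = m \<omega> # root_list (q \<omega>)"
    "degree (q \<omega>) = n" for \<omega>
    unfolding m_def q_def by (rule root_list_deflate[OF Suc.prems(2)])+
  have [measurable]: "m \<in> borel_measurable M"
    using lex_min_root_measurable[OF Suc.prems(1,2)] by (simp add: m_def[abs_def])
  have rec: "coeff (q \<omega>) k = coeff (f \<omega>) (Suc k) + m \<omega> * coeff (q \<omega>) (Suc k)" for \<omega> k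
    using arg_cong[OF defl(1)[of \<omega>], of "\<lambda>p. coeff p (Suc k)"] by simp
  have q: "(\<lambda>\<omega>. coeff (q \<omega>) k) \<in> borel_measurable M" for k
  proof (cases "k \<le> Suc n")
    case True
    then show ?thesis
    proof (induction k rule: inc_induct)
      case base
      have "coeff (q \<omega>) (Suc n) = 0" for \<omega> using defl(3)[of \<omega>] by (simp add: coeff_eq_0)
      then show ?case by simp
    next
      case (step k)
      then show ?case by (subst rec) simp
    qed
  next
    case False
    then have "coeff (q \<omega>) k = 0" for \<omega> using defl(3)[of \<omega>] by (simp add: coeff_eq_0)
    then show ?thesis by simp
  qed
  show ?case
  proof (cases i)
    case 0
    then show ?thesis unfolding defl(2) by simp
  next
    case (Suc j)
    then show ?thesis unfolding defl(2) using Suc.IH[OF q defl(3), of j] Suc.prems(3) by simp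
  qed
qed simp

section \<open>Integration over coefficient vectors and triangular maps\<close>

abbreviation CC :: "nat \<Rightarrow> (nat \<Rightarrow> complex) measure" where
  "CC n \<equiv> \<Pi>\<^sub>M j\<in>{..<n}. lborel"

interpretation CC: product_sigma_finite "\<lambda>_::nat. lborel :: complex measure"
  by standard

lemma nn_integral_CC_Suc:
  assumes "f \<in> borel_measurable (CC (Suc n))"
  shows "(\<integral>\<^sup>+c. f c \<partial>CC (Suc n)) = (\<integral>\<^sup>+c. \<integral>\<^sup>+x. f (c(n := x)) \<partial>lborel \<partial>CC n)"
    and "(\<integral>\<^sup>+c. f c \<partial>CC (Suc n)) = (\<integral>\<^sup>+x. \<integral>\<^sup>+c. f (c(n := x)) \<partial>CC n \<partial>lborel)"
  using CC.product_nn_integral_insert[of "{..<n}" n f] CC.product_nn_integral_insert_rev[of "{..<n}" n f] assms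
  by (simp_all add: lessThan_Suc)

lemma CC_upd_measurable [measurable]:
  assumes "c \<in> M \<rightarrow>\<^sub>M CC n" "x \<in> borel_measurable M"
  shows "(\<lambda>\<omega>. (c \<omega>)(n := x \<omega>)) \<in> M \<rightarrow>\<^sub>M CC (Suc n)"
  using measurable_fun_upd[of "{..<Suc n}" "{..<n}" n c M "\<lambda>_. lborel" x] assms
  by (auto simp: lessThan_Suc)

definition prev_coeff :: "complex \<Rightarrow> (nat \<Rightarrow> complex) \<Rightarrow> nat \<Rightarrow> complex" where
  "prev_coeff p0 c k = (case k of 0 \<Rightarrow> p0 | Suc j \<Rightarrow> c j)"

lemma prev_coeff_simps [simp]: "prev_coeff p0 c 0 = p0" "prev_coeff p0 c (Suc k) = c k"
  by (simp_all add: prev_coeff_def)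

definition triangular_map :: "(complex \<Rightarrow> complex \<Rightarrow> complex) \<Rightarrow> complex \<Rightarrow> nat \<Rightarrow> (nat \<Rightarrow> complex) \<Rightarrow> nat \<Rightarrow> complex" where
  "triangular_map \<tau> p0 n c = (\<lambda>k\<in>{..<n}. \<tau> (prev_coeff p0 c k) (c k))"

lemma triangular_map_measurable [measurable]:
  assumes [measurable]: "(\<lambda>(p, x). \<tau> p x) \<in> borel_measurable (borel \<Otimes>\<^sub>M borel)"
  shows "triangular_map \<tau> p0 n \<in> CC n \<rightarrow>\<^sub>M CC n"
  unfolding triangular_map_def[abs_def]
proof (rule measurable_restrict)
  fix k assume k: "k \<in> {..<n}"
  have "(\<lambda>c. prev_coeff p0 c k) \<in> borel_measurable (CC n)"
    using k by (cases k) auto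
  with k have "(\<lambda>c. (prev_coeff p0 c k, c k)) \<in> CC n \<rightarrow>\<^sub>M borel \<Otimes>\<^sub>M borel" by measurable
  from measurable_compose[OF this assms] show "(\<lambda>c. \<tau> (prev_coeff p0 c k) (c k)) \<in> CC n \<rightarrow>\<^sub>M lborel" by simp
qed

lemma triangular_map_Suc: "triangular_map \<tau> p0 (Suc n) (c(n := x)) = (triangular_map \<tau> p0 n c)(n := \<tau> (prev_coeff p0 c n) x)"
proof
  fix k show "triangular_map \<tau> p0 (Suc n) (c(n := x)) k = ((triangular_map \<tau> p0 n c)(n := \<tau> (prev_coeff p0 c n) x)) k"
    by (cases k) (auto simp: triangular_map_def prev_coeff_def restrict_def less_Suc_eq split: nat.splits)
qed

text \<open>
  A map whose \<open>k\<close>-th output depends on the \<open>k\<close>-th input and its predecessor only, and which scales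
  Lebesgue measure in the \<open>k\<close>-th input by \<open>s\<close>, scales the product measure by \<open>s\<^sup>n\<close>: integrate the last
  variable first, for a fixed predecessor, then induct.
\<close>

lemma nn_integral_triangular:
  fixes s :: ennreal
  assumes \<tau>[measurable]: "(\<lambda>(p, x). \<tau> p x) \<in> borel_measurable (borel \<Otimes>\<^sub>M borel)"
    and scale: "\<And>p \<Psi>. \<Psi> \<in> borel_measurable borel \<Longrightarrow> s * (\<integral>\<^sup>+x. \<Psi> (\<tau> p x) \<partial>lborel) = (\<integral>\<^sup>+x. \<Psi> x \<partial>lborel)"
    and "\<Psi> \<in> borel_measurable (CC n)"
  shows "s ^ n * (\<integral>\<^sup>+c. \<Psi> (triangular_map \<tau> p0 n c) \<partial>CC n) = (\<integral>\<^sup>+c. \<Psi> c \<partial>CC n)"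
  using assms(3)
proof (induction n arbitrary: \<Psi>)
  case 0
  then show ?case by (simp add: CC.nn_integral_empty triangular_map_def restrict_def space_PiM_empty)
next
  case (Suc n)
  note [measurable] = Suc.prems
  have m1: "(\<lambda>c. \<integral>\<^sup>+x. \<Psi> (c(n := x)) \<partial>lborel) \<in> borel_measurable (CC n)" by measurable
  have "s ^ Suc n * (\<integral>\<^sup>+c. \<Psi> (triangular_map \<tau> p0 (Suc n) c) \<partial>CC (Suc n))
    = s ^ n * (s * (\<integral>\<^sup>+c. \<integral>\<^sup>+x. \<Psi> ((triangular_map \<tau> p0 n c)(n := \<tau> (prev_coeff p0 c n) x)) \<partial>lborel \<partial>CC n))"
    by (subst nn_integral_CC_Suc(1)) (auto simp: triangular_map_Suc mult_ac)
  also have "s * (\<integral>\<^sup>+c. \<integral>\<^sup>+x. \<Psi> ((triangular_map \<tau> p0 n c)(n := \<tau> (prev_coeff p0 c n) x)) \<partial>lborel \<partial>CC n)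
    = (\<integral>\<^sup>+c. s * (\<integral>\<^sup>+x. \<Psi> ((triangular_map \<tau> p0 n c)(n := \<tau> (prev_coeff p0 c n) x)) \<partial>lborel) \<partial>CC n)"
  proof (rule nn_integral_cmult[symmetric])
    have "(\<lambda>c. prev_coeff p0 c n) \<in> borel_measurable (CC n)" by (cases n) auto
    note [measurable] = this measurable_compose[OF _ \<tau>, unfolded split_beta']
    have "(\<lambda>(c, x). \<tau> (prev_coeff p0 c n) x) \<in> borel_measurable (CC n \<Otimes>\<^sub>M lborel)"
      using measurable_compose[of "\<lambda>(c, x). (prev_coeff p0 c n, x)" "CC n \<Otimes>\<^sub>M lborel" _ _ borel, OF _ \<tau>]
      by (simp add: split_beta')
    note [measurable] = this
    show "(\<lambda>c. \<integral>\<^sup>+x. \<Psi> ((triangular_map \<tau> p0 n c)(n := \<tau> (prev_coeff p0 c n) x)) \<partial>lborel) \<in> borel_measurable (CC n)"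
      by measurable
  qed
  also have "\<dots> = (\<integral>\<^sup>+c. (\<integral>\<^sup>+x. \<Psi> ((triangular_map \<tau> p0 n c)(n := x)) \<partial>lborel) \<partial>CC n)"
  proof (rule nn_integral_cong)
    fix c assume "c \<in> space (CC n)"
    then have "triangular_map \<tau> p0 n c \<in> space (CC n)" using triangular_map_measurable[OF \<tau>] by (rule measurable_space[rotated])
    then have [measurable]: "(\<lambda>x. (triangular_map \<tau> p0 n c)(n := x)) \<in> borel \<rightarrow>\<^sub>M CC (Suc n)"
      by measurable
    have "(\<lambda>x. \<Psi> ((triangular_map \<tau> p0 n c)(n := x))) \<in> borel_measurable borel" by measurable
    from scale[OF this] show "s * (\<integral>\<^sup>+x. \<Psi> ((triangular_map \<tau> p0 n c)(n := \<tau> (prev_coeff p0 c n) x)) \<partial>lborel)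
      = (\<integral>\<^sup>+x. \<Psi> ((triangular_map \<tau> p0 n c)(n := x)) \<partial>lborel)" .
  qed
  also have "s ^ n * \<dots> = (\<integral>\<^sup>+c. (\<integral>\<^sup>+x. \<Psi> (c(n := x)) \<partial>lborel) \<partial>CC n)"
    by (rule Suc.IH[OF m1])
  also have "\<dots> = (\<integral>\<^sup>+c. \<Psi> c \<partial>CC (Suc n))"
    by (rule nn_integral_CC_Suc(1)[symmetric]) simp
  finally show ?case .
qed

section \<open>Horner deflation and sums over root listings\<close>

text \<open>
  The monic polynomial with the entries of \<open>c\<close> as coefficients in descending order, so that appending
  an entry multiplies by \<open>x\<close> and adds a constant term.
\<close>

primrec desc_poly :: "nat \<Rightarrow> (nat \<Rightarrow> complex) \<Rightarrow> complex poly" where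
  "desc_poly 0 c = 1"
| "desc_poly (Suc n) c = pCons (c n) (desc_poly n c)"

lemma desc_poly_monic: "degree (desc_poly n c) = n \<and> lead_coeff (desc_poly n c) = 1"
  by (induction n) auto

lemma degree_desc_poly [simp]: "degree (desc_poly n c) = n"
  using desc_poly_monic by simp

lemma lead_coeff_desc_poly [simp]: "coeff (desc_poly n c) n = 1"
  using desc_poly_monic[of n c] by simp

lemma desc_poly_nonzero [simp]: "desc_poly n c \<noteq> 0"
  by (metis coeff_0 lead_coeff_desc_poly zero_neq_one)

lemma desc_poly_cong: "(\<And>k. k < n \<Longrightarrow> c k = d k) \<Longrightarrow> desc_poly n c = desc_poly n d"
  by (induction n) auto

lemma desc_poly_coeff_measurable:
  assumes "\<And>k. k < n \<Longrightarrow> (\<lambda>\<omega>. c \<omega> k) \<in> borel_measurable M"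
  shows "(\<lambda>\<omega>. coeff (desc_poly n (c \<omega>)) k) \<in> borel_measurable M"
  using assms
proof (induction n arbitrary: k)
  case (Suc n)
  then show ?case by (cases k) auto
qed simp

text \<open>
  The partial results of Horner's scheme for \<open>x\<^sup>n + d\<^sub>0 x\<^sup>n\<^sup>-\<^sup>1 + \<dots>\<close> at \<open>w\<close>: they are the coefficients of
  the quotient by \<open>x - w\<close>, and the last one is the remainder.
\<close>

primrec horner :: "complex \<Rightarrow> (nat \<Rightarrow> complex) \<Rightarrow> nat \<Rightarrow> complex" where
  "horner w d 0 = d 0 + w"
| "horner w d (Suc k) = d (Suc k) + w * horner w d k"

lemma horner_eq: "horner w d k = d k + w * prev_coeff 1 (horner w d) k"
  by (cases k) auto

text \<open>
  The coefficients of \<open>(x - w) g\<close>, apart from the constant term, depend triangularly on those of \<open>g\<close>;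
  Horner's scheme inverts this map.
\<close>

lemma horner_triangular_map:
  "k < n \<Longrightarrow> horner w (triangular_map (\<lambda>p x. x - w * p) 1 n c) k = c k"
  by (induction k) (auto simp: triangular_map_def)

lemma desc_poly_horner:
  "pCons 0 (desc_poly n d) = [:-w, 1:] * desc_poly n (horner w d) + [:w * prev_coeff 1 (horner w d) n:]"
proof (induction n)
  case (Suc n)
  have h: "[:w * prev_coeff 1 (horner w d) n:] + [:d n:] = [:horner w d n:]"
    using horner_eq[of w d n] by (simp add: add.commute)
  have "pCons 0 (desc_poly (Suc n) d) = [:0, 1:] * (pCons 0 (desc_poly n d) + [:d n:])" by simp
  also have "\<dots> = [:0, 1:] * ([:-w, 1:] * desc_poly n (horner w d) + [:horner w d n:])"
    unfolding Suc.IH add.assoc h ..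
  also have "\<dots> = [:-w, 1:] * desc_poly (Suc n) (horner w d) + [:w * prev_coeff 1 (horner w d) (Suc n):]"
    by (simp add: algebra_simps)
  finally show ?case .
qed (simp add: one_pCons)

lemma desc_poly_Suc_upd: "desc_poly (Suc n) (d(n := x)) = pCons 0 (desc_poly n d) + [:x:]"
  using desc_poly_cong[of n "d(n := x)" d] by simp

text \<open>
  The sum of \<open>\<phi>\<close> over all orders of the roots. A multiple root is counted with repetition, which keeps the
  sum a measurable function of the coefficients.
\<close>

definition root_sum :: "nat \<Rightarrow> ((nat \<Rightarrow> complex) \<Rightarrow> ennreal) \<Rightarrow> complex poly \<Rightarrow> ennreal" where
  "root_sum n \<phi> p = (\<Sum>\<pi> | \<pi> permutes {..<n}. \<phi> (\<lambda>j\<in>{..<n}. root_list p ! \<pi> j))"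

lemma root_listing_measurable:
  assumes "\<And>k. (\<lambda>\<omega>. coeff (f \<omega>) k) \<in> borel_measurable M"
    and "\<And>\<omega>. degree (f \<omega>) = n" and \<pi>: "\<pi> permutes {..<n}"
  shows "(\<lambda>\<omega>. \<lambda>j\<in>{..<n}. root_list (f \<omega>) ! \<pi> j) \<in> M \<rightarrow>\<^sub>M CC n"
proof (rule measurable_restrict)
  fix j assume "j \<in> {..<n}"
  then have "\<pi> j < n" using permutes_in_image[OF \<pi>, of j] by simp
  from root_list_measurable[OF assms(1,2) this]
  show "(\<lambda>\<omega>. root_list (f \<omega>) ! \<pi> j) \<in> M \<rightarrow>\<^sub>M lborel" by simp
qed

lemma root_sum_measurable:
  assumes "\<And>k. (\<lambda>\<omega>. coeff (f \<omega>) k) \<in> borel_measurable M"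
    and "\<And>\<omega>. degree (f \<omega>) = n" and [measurable]: "(\<lambda>(\<omega>, z). \<Phi> \<omega> z) \<in> borel_measurable (M \<Otimes>\<^sub>M CC n)"
  shows "(\<lambda>\<omega>. root_sum n (\<Phi> \<omega>) (f \<omega>)) \<in> borel_measurable M"
  unfolding root_sum_def
proof (rule borel_measurable_sum)
  fix \<pi> assume "\<pi> \<in> {\<pi>. \<pi> permutes {..<n}}"
  then have [measurable]: "(\<lambda>\<omega>. \<lambda>j\<in>{..<n}. root_list (f \<omega>) ! \<pi> j) \<in> M \<rightarrow>\<^sub>M CC n"
    using assms by (intro root_listing_measurable) auto
  have "(\<lambda>\<omega>. (\<omega>, \<lambda>j\<in>{..<n}. root_list (f \<omega>) ! \<pi> j)) \<in> M \<rightarrow>\<^sub>M M \<Otimes>\<^sub>M CC n" by measurable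
  from measurable_compose[OF this assms(3)]
  show "(\<lambda>\<omega>. \<Phi> \<omega> (\<lambda>j\<in>{..<n}. root_list (f \<omega>) ! \<pi> j)) \<in> borel_measurable M" by simp
qed

lemma sum_permutations_eq_sum_inj:
  assumes xs: "distinct xs" "length xs = n"
  shows "(\<Sum>\<pi> | \<pi> permutes {..<n}. \<phi> (\<lambda>j\<in>{..<n}. xs ! \<pi> j))
    = (\<Sum>z\<in>{z \<in> {..<n} \<rightarrow>\<^sub>E set xs. inj_on z {..<n}}. \<phi> z)"
proof (rule sum.reindex_bij_betw[where h = "\<lambda>\<pi>. \<lambda>j\<in>{..<n}. xs ! \<pi> j"])
  have nth: "bij_betw ((!) xs) {..<n} (set xs)" using xs by (intro bij_betw_nth) auto
  show "bij_betw (\<lambda>\<pi>. \<lambda>j\<in>{..<n}. xs ! \<pi> j) {\<pi>. \<pi> permutes {..<n}}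
      {z \<in> {..<n} \<rightarrow>\<^sub>E set xs. inj_on z {..<n}}"
    unfolding bij_betw_def
  proof (intro conjI inj_onI Set.set_eqI iffI)
    fix \<pi> \<sigma> assume p: "\<pi> \<in> {\<pi>. \<pi> permutes {..<n}}" "\<sigma> \<in> {\<pi>. \<pi> permutes {..<n}}"
      and eq: "(\<lambda>j\<in>{..<n}. xs ! \<pi> j) = (\<lambda>j\<in>{..<n}. xs ! \<sigma> j)"
    show "\<pi> = \<sigma>"
    proof
      fix j show "\<pi> j = \<sigma> j"
      proof (cases "j < n")
        case True
        then have "\<pi> j < n" "\<sigma> j < n" using p permutes_in_image[of _ "{..<n}" j] by auto
        moreover have "xs ! \<pi> j = xs ! \<sigma> j" using fun_cong[OF eq, of j] True by simp
        ultimately show ?thesis using xs by (simp add: nth_eq_iff_index_eq)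
      next
        case False
        then show ?thesis using p by (simp add: permutes_not_in)
      qed
    qed
  next
    fix z assume "z \<in> (\<lambda>\<pi>. \<lambda>j\<in>{..<n}. xs ! \<pi> j) ` {\<pi>. \<pi> permutes {..<n}}"
    then obtain \<pi> where \<pi>: "\<pi> permutes {..<n}" and z: "z = (\<lambda>j\<in>{..<n}. xs ! \<pi> j)" by auto
    have lt: "\<pi> j < n" if "j < n" for j using permutes_in_image[OF \<pi>, of j] that by simp
    have "inj_on z {..<n}"
    proof (rule inj_onI)
      fix i j assume ij: "i \<in> {..<n}" "j \<in> {..<n}" "z i = z j"
      then have "\<pi> i = \<pi> j" using lt xs by (simp add: z nth_eq_iff_index_eq)
      then show "i = j" using permutes_inj[OF \<pi>] by (auto dest: injD)
    qed
    then show "z \<in> {z \<in> {..<n} \<rightarrow>\<^sub>E set xs. inj_on z {..<n}}" using lt xs by (auto simp: z)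
  next
    fix z assume "z \<in> {z \<in> {..<n} \<rightarrow>\<^sub>E set xs. inj_on z {..<n}}"
    then have z: "z \<in> {..<n} \<rightarrow>\<^sub>E set xs" "inj_on z {..<n}" by auto
    define \<pi> where "\<pi> j = (if j < n then inv_into {..<n} ((!) xs) (z j) else j)" for j
    have zj: "z j \<in> (!) xs ` {..<n}" if "j < n" for j
      using z(1) that nth by (auto simp: bij_betw_def)
    have \<pi>: "\<pi> j < n" "xs ! \<pi> j = z j" if "j < n" for j
      using inv_into_into[OF zj[OF that]] f_inv_into_f[OF zj[OF that]] that by (auto simp: \<pi>_def)
    have "inj_on \<pi> {..<n}"
    proof (rule inj_onI)
      fix i j assume ij: "i \<in> {..<n}" "j \<in> {..<n}" "\<pi> i = \<pi> j"
      then have "z i = z j" using \<pi>(2) by (metis lessThan_iff)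
      then show "i = j" using z(2) ij by (auto dest: inj_onD)
    qed
    then have "bij_betw \<pi> {..<n} {..<n}"
      using \<pi>(1) by (intro bij_betw_imageI endo_inj_surj) auto
    then have "\<pi> permutes {..<n}"
      by (rule bij_imp_permutes) (simp add: \<pi>_def)
    moreover have "z = (\<lambda>j\<in>{..<n}. xs ! \<pi> j)"
    proof
      fix j show "z j = (\<lambda>j\<in>{..<n}. xs ! \<pi> j) j"
        using PiE_arb[OF z(1), of j] \<pi>(2)[of j] by (cases "j < n") simp_all
    qed
    ultimately show "z \<in> (\<lambda>\<pi>. \<lambda>j\<in>{..<n}. xs ! \<pi> j) ` {\<pi>. \<pi> permutes {..<n}}" by blast
  qed
qed

text \<open>
  Sort the injective functions on \<open>n + 1\<close> positions by their value at the last position.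
\<close>

lemma sum_inj_Suc:
  assumes "finite R"
  shows "(\<Sum>z\<in>{z \<in> {..<Suc n} \<rightarrow>\<^sub>E R. inj_on z {..<Suc n}}. \<phi> z)
    = (\<Sum>w\<in>R. \<Sum>z\<in>{z \<in> {..<n} \<rightarrow>\<^sub>E R - {w}. inj_on z {..<n}}. \<phi> (z(n := w)))"
proof -
  have fin: "finite {z \<in> {..<n} \<rightarrow>\<^sub>E R - {w}. inj_on z {..<n}}" for w
    using assms by (intro finite_subset[OF Collect_restrict] finite_PiE) auto
  have "(\<Sum>w\<in>R. \<Sum>z\<in>{z \<in> {..<n} \<rightarrow>\<^sub>E R - {w}. inj_on z {..<n}}. \<phi> (z(n := w)))
    = (\<Sum>(w, z)\<in>(SIGMA w:R. {z \<in> {..<n} \<rightarrow>\<^sub>E R - {w}. inj_on z {..<n}}). \<phi> (z(n := w)))"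
    using assms fin by (subst sum.Sigma) auto
  also have "\<dots> = (\<Sum>z\<in>{z \<in> {..<Suc n} \<rightarrow>\<^sub>E R. inj_on z {..<Suc n}}. \<phi> z)"
  proof (rule sum.reindex_bij_witness[where i = "\<lambda>z. (z n, z(n := undefined))" and j = "\<lambda>(w, z). z(n := w)"])
    fix a assume a: "a \<in> (SIGMA w:R. {z \<in> {..<n} \<rightarrow>\<^sub>E R - {w}. inj_on z {..<n}})"
    obtain w z where wz: "a = (w, z)" by fastforce
    with a have z: "w \<in> R" "z \<in> {..<n} \<rightarrow>\<^sub>E R - {w}" "inj_on z {..<n}" by auto
    then have "z n = undefined" by (auto simp: PiE_def extensional_def)
    then show "(\<lambda>z. (z n, z(n := undefined))) ((\<lambda>(w, z). z(n := w)) a) = a" by (auto simp: wz)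
    have "inj_on (z(n := w)) {..<Suc n}"
      using z by (auto simp: lessThan_Suc inj_on_def PiE_def Pi_def)
    moreover have "z(n := w) \<in> {..<Suc n} \<rightarrow>\<^sub>E R"
      using z by (auto simp: lessThan_Suc PiE_def Pi_def extensional_def)
    ultimately show "(\<lambda>(w, z). z(n := w)) a \<in> {z \<in> {..<Suc n} \<rightarrow>\<^sub>E R. inj_on z {..<Suc n}}"
      by (simp add: wz)
    show "\<phi> ((\<lambda>(w, z). z(n := w)) a) = (case a of (w, z) \<Rightarrow> \<phi> (z(n := w)))" by (simp add: wz)
  next
    fix z assume "z \<in> {z \<in> {..<Suc n} \<rightarrow>\<^sub>E R. inj_on z {..<Suc n}}"
    then have z: "z \<in> {..<Suc n} \<rightarrow>\<^sub>E R" "inj_on z {..<Suc n}" by auto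
    show "(\<lambda>(w, z). z(n := w)) (z n, z(n := undefined)) = z" by simp
    have "z n \<in> R" using z by auto
    moreover have "z x \<noteq> z n" if "x < n" for x
      using inj_onD[OF z(2), of x n] that by auto
    then have "z(n := undefined) \<in> {..<n} \<rightarrow>\<^sub>E R - {z n}"
      using z(1) by (auto simp: lessThan_Suc PiE_def Pi_def extensional_def)
    moreover have "inj_on (z(n := undefined)) {..<n}"
      using z(2) by (auto simp: inj_on_def)
    ultimately show "(z n, z(n := undefined)) \<in> (SIGMA w:R. {z \<in> {..<n} \<rightarrow>\<^sub>E R - {w}. inj_on z {..<n}})"
      by simp
  qed
  finally show ?thesis ..
qed

lemma distinct_root_list:
  "distinct (root_list p) \<longleftrightarrow> (\<forall>a. count (proots p) a \<le> 1)"
proof -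
  have "(count (mset xs) a = (if a \<in> set xs then 1 else 0)) \<longleftrightarrow> count (mset xs) a \<le> 1" for xs :: "complex list" and a
  proof (cases "a \<in> set xs")
    case True
    then have "count (mset xs) a > 0" by (metis count_greater_zero_iff set_mset_mset)
    then show ?thesis unfolding if_P[OF True] by linarith
  next
    case False
    then have "count (mset xs) a = 0" by (metis count_eq_zero_iff set_mset_mset)
    then show ?thesis unfolding if_not_P[OF False] by linarith
  qed
  then show ?thesis unfolding distinct_count_atmost_1 mset_root_list[symmetric] by simp
qed

text \<open>
  For a squarefree polynomial the listings of the roots are the injective functions into the set of
  roots, so they may be sorted by the last root; the others then list the roots of the quotient.
\<close>

lemma root_sum_Suc:
  assumes f: "degree f = Suc n" and sf: "rsquarefree f"
  shows "root_sum (Suc n) \<phi> f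
    = (\<Sum>w\<in>{w. poly f w = 0}. root_sum n (\<lambda>z. \<phi> (z(n := w))) (f div [:-w, 1:]))"
proof -
  have "f \<noteq> 0" using f by auto
  have dist: "distinct (root_list f)"
    unfolding distinct_root_list using sf \<open>f \<noteq> 0\<close>
    by (metis count_proots rsquarefree_def le0 order_refl)
  note set = set_root_list[OF \<open>f \<noteq> 0\<close>]
  have finR: "finite {w. poly f w = 0}" using \<open>f \<noteq> 0\<close> by (rule poly_roots_finite)
  have "root_sum (Suc n) \<phi> f
    = (\<Sum>z\<in>{z \<in> {..<Suc n} \<rightarrow>\<^sub>E {w. poly f w = 0}. inj_on z {..<Suc n}}. \<phi> z)"
    unfolding root_sum_def
    by (subst sum_permutations_eq_sum_inj) (simp_all add: dist length_root_list f set)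
  also have "\<dots> = (\<Sum>w\<in>{w. poly f w = 0}. \<Sum>z\<in>{z \<in> {..<n} \<rightarrow>\<^sub>E {v. poly f v = 0} - {w}. inj_on z {..<n}}. \<phi> (z(n := w)))"
    by (rule sum_inj_Suc[OF finR])
  also have "\<dots> = (\<Sum>w\<in>{w. poly f w = 0}. root_sum n (\<lambda>z. \<phi> (z(n := w))) (f div [:-w, 1:]))"
  proof (rule sum.cong[OF refl])
    fix w assume w: "w \<in> {w. poly f w = 0}"
    define q where "q = f div [:-w, 1:]"
    have fq: "f = [:-w, 1:] * q"
      using w unfolding q_def by (metis poly_eq_0_iff_dvd dvd_mult_div_cancel mem_Collect_eq)
    then have "q \<noteq> 0" using \<open>f \<noteq> 0\<close> by auto
    have degq: "degree q = n" using f \<open>q \<noteq> 0\<close> by (subst (asm) fq, subst (asm) degree_mult_eq) auto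
    have pf: "proots f = add_mset w (proots q)"
      by (subst fq, subst proots_mult) (use \<open>q \<noteq> 0\<close> in auto)
    have le1: "count (proots f) a \<le> 1" for a using dist distinct_root_list by blast
    have "count (proots q) a \<le> count (proots f) a" for a by (simp add: pf)
    then have "distinct (root_list q)"
      unfolding distinct_root_list using le1 order_trans by blast
    moreover have "poly q w \<noteq> 0"
    proof
      assume "poly q w = 0"
      then have "w \<in># proots q" using \<open>q \<noteq> 0\<close> by simp
      then have "count (proots f) w \<ge> 2" unfolding pf by simp
      with le1[of w] show False by simp
    qed
    then have "{v. poly f v = 0} - {w} = set (root_list q)"
      unfolding set_root_list[OF \<open>q \<noteq> 0\<close>] by (subst fq) auto
    ultimately show "(\<Sum>z\<in>{z \<in> {..<n} \<rightarrow>\<^sub>E {v. poly f v = 0} - {w}. inj_on z {..<n}}. \<phi> (z(n := w)))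
      = root_sum n (\<lambda>z. \<phi> (z(n := w))) (f div [:-w, 1:])"
      unfolding root_sum_def q_def[symmetric]
      by (subst sum_permutations_eq_sum_inj[of "root_list q" n "\<lambda>z. \<phi> (z(n := w))"])
         (simp_all add: length_root_list degq)
  qed
  finally show ?thesis .
qed

section \<open>Roots and coefficients as coordinates\<close>

lemma poly_eq_prod_root_list:
  assumes "degree p = n" "lead_coeff p = 1" and \<pi>: "\<pi> permutes {..<n}"
  shows "p = (\<Prod>j<n. [:- (root_list p ! \<pi> j), 1:])"
proof -
  have "p = (\<Prod>x\<in>#mset (root_list p). [:-x, 1:])"
    using complex_poly_decompose_multiset[of p] assms by (simp add: mset_root_list)
  also have "\<dots> = prod_list (map (\<lambda>x. [:-x, 1:]) (root_list p))"
    by (metis mset_map prod_mset_prod_list)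
  also have "\<dots> = (\<Prod>j<n. [:- (root_list p ! j), 1:])"
    using assms(1) by (simp add: prod.list_conv_set_nth length_root_list atLeast0LessThan)
  also have "\<dots> = (\<Prod>j<n. [:- (root_list p ! \<pi> j), 1:])"
    using prod.permute[OF \<pi>, of "\<lambda>j. [:- (root_list p ! j), 1:]"] by (simp add: o_def)
  finally show ?thesis .
qed

text \<open>
  The factor \<open>\<Prod>\<^sub>j |z\<^sub>j - w|\<^sup>2\<close> equals \<open>|p(w)|\<^sup>2\<close> for every listing \<open>z\<close> of the roots of \<open>p\<close>.
\<close>

lemma root_sum_mult_poly:
  assumes "degree p = n" "lead_coeff p = 1"
  shows "root_sum n (\<lambda>z. \<phi> z * ennreal (\<Prod>j<n. (cmod (z j - w))\<^sup>2)) p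
    = root_sum n \<phi> p * ennreal ((cmod (poly p w))\<^sup>2)"
  unfolding root_sum_def sum_distrib_right
proof (rule sum.cong[OF refl])
  fix \<pi> assume "\<pi> \<in> {\<pi>. \<pi> permutes {..<n}}"
  then have "poly p w = (\<Prod>j<n. w - root_list p ! \<pi> j)"
    by (subst poly_eq_prod_root_list[OF assms, of \<pi>]) (auto simp: poly_prod)
  then have "(cmod (poly p w))\<^sup>2 = (\<Prod>j<n. (cmod ((\<lambda>j\<in>{..<n}. root_list p ! \<pi> j) j - w))\<^sup>2)"
    by (simp add: prod_norm[symmetric] prod_power_distrib[symmetric] norm_minus_commute)
  then show "\<phi> (\<lambda>j\<in>{..<n}. root_list p ! \<pi> j) * ennreal (\<Prod>j<n. (cmod ((\<lambda>j\<in>{..<n}. root_list p ! \<pi> j) j - w))\<^sup>2)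
    = \<phi> (\<lambda>j\<in>{..<n}. root_list p ! \<pi> j) * ennreal ((cmod (poly p w))\<^sup>2)" by simp
qed

lemma distr_lborel_uminus_complex: "distr lborel borel (uminus :: complex \<Rightarrow> complex) = lborel"
  using lborel_affine[of "-1" "0::complex"] by (simp add: density_1)

lemma nn_integral_lborel_complex_affine:
  fixes t :: complex and f :: "complex \<Rightarrow> ennreal"
  assumes [measurable]: "f \<in> borel_measurable borel"
  shows "(\<integral>\<^sup>+x. f (- x) \<partial>lborel) = (\<integral>\<^sup>+x. f x \<partial>lborel)" "(\<integral>\<^sup>+x. f (t + x) \<partial>lborel) = (\<integral>\<^sup>+x. f x \<partial>lborel)"
proof -
  have "(\<integral>\<^sup>+x. f x \<partial>lborel) = (\<integral>\<^sup>+x. f x \<partial>distr lborel borel (uminus :: complex \<Rightarrow> complex))"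
    by (simp add: distr_lborel_uminus_complex)
  then show "(\<integral>\<^sup>+x. f (- x) \<partial>lborel) = (\<integral>\<^sup>+x. f x \<partial>lborel)" by (simp add: nn_integral_distr)
  have "lborel = distr lborel borel ((+) t)"
    using lborel_affine[of "1" t] by (simp add: density_1)
  then have "(\<integral>\<^sup>+x. f x \<partial>lborel) = (\<integral>\<^sup>+x. f x \<partial>distr lborel borel ((+) t))" by simp
  then show "(\<integral>\<^sup>+x. f (t + x) \<partial>lborel) = (\<integral>\<^sup>+x. f x \<partial>lborel)" by (simp add: nn_integral_distr)
qed

definition vandermonde_sq :: "nat \<Rightarrow> (nat \<Rightarrow> complex) \<Rightarrow> real" where
  "vandermonde_sq n z = (\<Prod>k<n. \<Prod>j<k. (cmod (z j - z k))\<^sup>2)"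

lemma vandermonde_sq_Suc:
  "vandermonde_sq (Suc n) (z(n := w)) = vandermonde_sq n z * (\<Prod>j<n. (cmod (z j - w))\<^sup>2)"
  by (simp add: vandermonde_sq_def)

lemma vandermonde_sq_nonneg: "vandermonde_sq n z \<ge> 0"
  unfolding vandermonde_sq_def by (intro prod_nonneg ballI) auto

lemma vandermonde_sq_measurable [measurable]: "vandermonde_sq n \<in> borel_measurable (CC n)"
proof -
  have "(\<lambda>z. z j) \<in> borel_measurable (CC n)" if "j < n" for j using that by simp
  then show ?thesis unfolding vandermonde_sq_def[abs_def]
    by (intro borel_measurable_prod borel_measurable_power borel_measurable_norm borel_measurable_diff) auto
qed

text \<open>
  Let \<open>f\<close> be the polynomial with coefficients \<open>d(n := x)\<close>, and let \<open>h\<close>, which is independent of \<open>x\<close>, be \<open>f\<close>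
  without its constant term \<open>x\<close>.
  The value \<open>w\<close> is a root of \<open>f\<close> iff \<open>f\<close> has constant term \<open>-h(w)\<close>, and \<open>h'(w)\<close> is the value at \<open>w\<close> of the
  quotient \<open>f / (x - w)\<close>. So the area formula for \<open>h\<close> trades the last root for the constant term.
  Only finitely many constant terms give a multiple root.
\<close>

lemma sum_roots_fibre:
  assumes \<phi>: "\<phi> \<in> borel_measurable (CC (Suc n))" and d: "d \<in> space (CC n)"
  shows "(\<integral>\<^sup>+w. root_sum n (\<lambda>z. \<phi> (z(n := w))) (desc_poly n (horner w d)) * ennreal ((cmod (poly (desc_poly n (horner w d)) w))\<^sup>2) \<partial>lborel)
    = (\<integral>\<^sup>+x. root_sum (Suc n) \<phi> (desc_poly (Suc n) (d(n := x))) \<partial>lborel)"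
proof -
  define h where "h = pCons 0 (desc_poly n d)"
  define \<psi> where "\<psi> w = root_sum n (\<lambda>z. \<phi> (z(n := w))) (desc_poly n (horner w d))" for w
  note [measurable] = \<phi>
  have degh: "degree h = Suc n" by (simp add: h_def)
  have horner_meas: "(\<lambda>w. horner w d k) \<in> borel_measurable borel" for k
    by (induction k) auto
  have [measurable]: "\<psi> \<in> borel_measurable borel"
    unfolding \<psi>_def[abs_def]
  proof (rule root_sum_measurable)
    show "(\<lambda>w. coeff (desc_poly n (horner w d)) k) \<in> borel_measurable borel" for k
      by (rule desc_poly_coeff_measurable) (rule horner_meas)
    show "(\<lambda>(w, z). \<phi> (z(n := w))) \<in> borel_measurable (borel \<Otimes>\<^sub>M CC n)" by measurable
  qed simp
  have hw: "h = [:-w, 1:] * desc_poly n (horner w d) + [:w * prev_coeff 1 (horner w d) n:]" for w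
    unfolding h_def by (rule desc_poly_horner)
  have deriv: "poly (pderiv h) w = poly (desc_poly n (horner w d)) w" for w
  proof -
    let ?q = "desc_poly n (horner w d)"
    have "pderiv h = [:-w, 1:] * pderiv ?q + ?q * pderiv [:-w, 1:] + pderiv [:w * prev_coeff 1 (horner w d) n:]"
      by (subst hw[of w]) (simp only: pderiv_add pderiv_mult)
    then show ?thesis by (simp add: pderiv_pCons)
  qed
  have quot: "desc_poly n (horner w d) = (h + [:x:]) div [:-w, 1:]" if "poly (h + [:x:]) w = 0" for w x
  proof -
    have e: "h + [:x:] = [:-w, 1:] * desc_poly n (horner w d) + [:w * prev_coeff 1 (horner w d) n + x:]"
      by (subst hw[of w]) (simp add: algebra_simps)
    have "w * prev_coeff 1 (horner w d) n + x = 0"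
      using arg_cong[OF e, of "\<lambda>p. poly p w"] that by simp
    then have "h + [:x:] = [:-w, 1:] * desc_poly n (horner w d)" using e by simp
    then show ?thesis by (metis nonzero_mult_div_cancel_left pCons_eq_0_iff one_neq_zero)
  qed
  \<comment> \<open>A multiple root \<open>a\<close> of \<open>h + x\<close> is a zero of \<open>h'\<close>, and \<open>x = - h(a)\<close>.\<close>
  have sq: "AE x in lborel. rsquarefree (h + [:x:])"
  proof -
    define Z where "Z = {w. poly (pderiv h) w = 0}"
    have "pderiv h \<noteq> 0" using degh by (simp add: pderiv_eq_0_iff)
    then have "finite Z" unfolding Z_def by (rule poly_roots_finite)
    then have "AE x in lborel. x \<notin> (\<lambda>w. - poly h w) ` Z"
      by (intro AE_not_in finite_imp_null_set_lborel) auto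
    then show ?thesis
    proof eventually_elim
      case (elim x)
      show ?case unfolding rsquarefree_roots
      proof safe
        fix a assume a: "poly (h + [:x:]) a = 0" "poly (pderiv (h + [:x:])) a = 0"
        then have "a \<in> Z" by (simp add: Z_def pderiv_add pderiv_pCons)
        moreover have "x = - poly h a" using a(1) by (simp add: eq_neg_iff_add_eq_0 add.commute)
        ultimately show False using elim by blast
      qed
    qed
  qed
  have "(\<integral>\<^sup>+w. \<psi> w * ennreal ((cmod (poly (desc_poly n (horner w d)) w))\<^sup>2) \<partial>lborel)
    = (\<integral>\<^sup>+w. \<psi> w * ennreal ((cmod (poly (pderiv h) w))\<^sup>2) \<partial>lborel)"
    by (simp add: deriv)
  also have "\<dots> = (\<integral>\<^sup>+u. (\<Sum>w\<in>{w. poly h w = u}. \<psi> w) \<partial>lborel)"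
    by (rule area_formula_poly) (simp_all add: degh)
  also have "\<dots> = (\<integral>\<^sup>+u. root_sum (Suc n) \<phi> (h + [:-u:]) \<partial>lborel)"
  proof (rule nn_integral_cong_AE)
    have "AE u in lborel. rsquarefree (h + [:-u:])"
    proof -
      have "AE x in distr lborel borel (uminus :: complex \<Rightarrow> complex). rsquarefree (h + [:x:])"
        unfolding distr_lborel_uminus_complex by (rule sq)
      then show ?thesis by (rule AE_distrD[rotated]) simp
    qed
    then show "AE u in lborel. (\<Sum>w\<in>{w. poly h w = u}. \<psi> w) = root_sum (Suc n) \<phi> (h + [:-u:])"
    proof eventually_elim
      case (elim u)
      have "degree (h + [:-u:]) = Suc n" by (subst degree_add_eq_left) (auto simp: degh)
      then have "root_sum (Suc n) \<phi> (h + [:-u:])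
        = (\<Sum>w\<in>{w. poly (h + [:-u:]) w = 0}. root_sum n (\<lambda>z. \<phi> (z(n := w))) ((h + [:-u:]) div [:-w, 1:]))"
        by (rule root_sum_Suc) (rule elim)
      also have "\<dots> = (\<Sum>w\<in>{w. poly h w = u}. \<psi> w)"
      proof (rule sum.cong)
        show "{w. poly (h + [:- u:]) w = 0} = {w. poly h w = u}" by simp
      next
        fix w assume "w \<in> {w. poly h w = u}"
        then have "poly (h + [:-u:]) w = 0" by simp
        from quot[OF this] show "root_sum n (\<lambda>z. \<phi> (z(n := w))) ((h + [:-u:]) div [:-w, 1:]) = \<psi> w"
          unfolding \<psi>_def by simp
      qed
      finally show ?case ..
    qed
  qed
  also have "\<dots> = (\<integral>\<^sup>+u. root_sum (Suc n) \<phi> (h + [:u:]) \<partial>lborel)"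
  proof (rule nn_integral_lborel_complex_affine(1))
    show "(\<lambda>u. root_sum (Suc n) \<phi> (h + [:u:])) \<in> borel_measurable borel"
    proof (rule root_sum_measurable)
      show "(\<lambda>u. coeff (h + [:u:]) k) \<in> borel_measurable borel" for k
        by (cases k) auto
      show "degree (h + [:u:]) = Suc n" for u by (subst degree_add_eq_left) (auto simp: degh)
    qed measurable
  qed
  finally show ?thesis unfolding \<psi>_def h_def desc_poly_Suc_upd .
qed

text \<open>
  Induction on the degree. With the last root \<open>w\<close> fixed, the induction hypothesis turns the other roots
  into the coefficients of \<open>g = \<Prod> (x - z\<^sub>j)\<close>; the map to the higher coefficients of \<open>(x - w) g\<close> is
  triangular with unit scaling, and the fibre integral in \<open>w\<close> then supplies the constant term.
\<close>

theorem vieta_change_of_variables: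
  assumes "\<phi> \<in> borel_measurable (CC n)"
  shows "(\<integral>\<^sup>+z. \<phi> z * ennreal (vandermonde_sq n z) \<partial>CC n) = (\<integral>\<^sup>+c. root_sum n \<phi> (desc_poly n c) \<partial>CC n)"
  using assms
proof (induction n arbitrary: \<phi>)
  case 0
  have "{\<pi>. \<pi> permutes ({..<0} :: nat set)} = {id}" by auto
  then show ?case by (simp add: CC.nn_integral_empty vandermonde_sq_def root_sum_def restrict_def space_PiM_empty)
next
  case (Suc n)
  note [measurable] = Suc.prems
  let ?q = "\<lambda>w d. desc_poly n (horner w d)"
  have comp: "(\<lambda>z. z j) \<in> borel_measurable (CC n)" if "j < n" for j using that by simp
  have prodm[measurable]: "(\<lambda>z. \<Prod>j<n. (cmod (z j - w))\<^sup>2) \<in> borel_measurable (CC n)" for w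
    using comp by (intro borel_measurable_prod borel_measurable_power borel_measurable_norm borel_measurable_diff) auto
  have "(\<integral>\<^sup>+z. \<phi> z * ennreal (vandermonde_sq (Suc n) z) \<partial>CC (Suc n))
    = (\<integral>\<^sup>+w. \<integral>\<^sup>+z. (\<phi> (z(n := w)) * ennreal (\<Prod>j<n. (cmod (z j - w))\<^sup>2)) * ennreal (vandermonde_sq n z) \<partial>CC n \<partial>lborel)"
    by (subst nn_integral_CC_Suc(2), measurable)
       (auto intro!: nn_integral_cong simp: vandermonde_sq_Suc ennreal_mult vandermonde_sq_nonneg prod_nonneg mult_ac)
  also have "\<dots> = (\<integral>\<^sup>+w. \<integral>\<^sup>+d. root_sum n (\<lambda>z. \<phi> (z(n := w))) (?q w d) * ennreal ((cmod (poly (?q w d) w))\<^sup>2) \<partial>CC n \<partial>lborel)"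
  proof (rule nn_integral_cong)
    fix w
    have m1[measurable]: "(\<lambda>z. \<phi> (z(n := w))) \<in> borel_measurable (CC n)" by measurable
    let ?\<Psi> = "\<lambda>c. root_sum n (\<lambda>z. \<phi> (z(n := w))) (?q w c) * ennreal ((cmod (poly (?q w c) w))\<^sup>2)"
    have hm: "(\<lambda>c. horner w c k) \<in> borel_measurable (CC n)" if "k < n" for k
      using that by (induction k) (auto intro!: borel_measurable_add borel_measurable_times comp)
    have qm: "(\<lambda>c. coeff (?q w c) k) \<in> borel_measurable (CC n)" for k
      using hm by (rule desc_poly_coeff_measurable)
    have "(\<lambda>c. poly (?q w c) w) \<in> borel_measurable (CC n)"
      by (rule poly_measurable_coeffs[where n = n]) (auto intro: qm)
    moreover have "(\<lambda>c. root_sum n (\<lambda>z. \<phi> (z(n := w))) (?q w c)) \<in> borel_measurable (CC n)"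
      by (rule root_sum_measurable) (auto intro: qm)
    ultimately have \<Psi>m: "?\<Psi> \<in> borel_measurable (CC n)" by measurable
    have "(\<integral>\<^sup>+z. (\<phi> (z(n := w)) * ennreal (\<Prod>j<n. (cmod (z j - w))\<^sup>2)) * ennreal (vandermonde_sq n z) \<partial>CC n)
      = (\<integral>\<^sup>+c. root_sum n (\<lambda>z. \<phi> (z(n := w)) * ennreal (\<Prod>j<n. (cmod (z j - w))\<^sup>2)) (desc_poly n c) \<partial>CC n)"
      by (rule Suc.IH) measurable
    also have "\<dots> = (\<integral>\<^sup>+c. ?\<Psi> (triangular_map (\<lambda>p x. x - w * p) 1 n c) \<partial>CC n)"
    proof (rule nn_integral_cong)
      fix c
      have "?q w (triangular_map (\<lambda>p x. x - w * p) 1 n c) = desc_poly n c"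
        by (rule desc_poly_cong) (rule horner_triangular_map)
      then show "root_sum n (\<lambda>z. \<phi> (z(n := w)) * ennreal (\<Prod>j<n. (cmod (z j - w))\<^sup>2)) (desc_poly n c)
        = ?\<Psi> (triangular_map (\<lambda>p x. x - w * p) 1 n c)"
        by (simp add: root_sum_mult_poly)
    qed
    also have "\<dots> = 1 ^ n * (\<integral>\<^sup>+c. ?\<Psi> (triangular_map (\<lambda>p x. x - w * p) 1 n c) \<partial>CC n)" by simp
    also have "\<dots> = (\<integral>\<^sup>+d. ?\<Psi> d \<partial>CC n)"
    proof (rule nn_integral_triangular[OF _ _ \<Psi>m])
      fix p :: complex and \<Psi> :: "complex \<Rightarrow> ennreal" assume "\<Psi> \<in> borel_measurable borel"
      from nn_integral_lborel_complex_affine(2)[OF this, of "- (w * p)"]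
      show "1 * (\<integral>\<^sup>+x. \<Psi> (x - w * p) \<partial>lborel) = (\<integral>\<^sup>+x. \<Psi> x \<partial>lborel)" by simp
    qed measurable
    finally show "(\<integral>\<^sup>+z. (\<phi> (z(n := w)) * ennreal (\<Prod>j<n. (cmod (z j - w))\<^sup>2)) * ennreal (vandermonde_sq n z) \<partial>CC n)
      = (\<integral>\<^sup>+d. ?\<Psi> d \<partial>CC n)" .
  qed
  also have "\<dots> = (\<integral>\<^sup>+d. \<integral>\<^sup>+w. root_sum n (\<lambda>z. \<phi> (z(n := w))) (?q w d) * ennreal ((cmod (poly (?q w d) w))\<^sup>2) \<partial>lborel \<partial>CC n)"
  proof (rule pair_sigma_finite.Fubini')
    show "pair_sigma_finite (CC n) (lborel :: complex measure)"
      unfolding pair_sigma_finite_def using CC.sigma_finite[of "{..<n}"] lborel.sigma_finite_measure_axioms by auto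
    have comp2: "(\<lambda>(d, w). d j) \<in> borel_measurable (CC n \<Otimes>\<^sub>M lborel)" if "j < n" for j
      using measurable_compose[OF measurable_fst measurable_component_singleton[of j "{..<n}" "\<lambda>_. lborel"]] that
      by (simp add: split_beta')
    have hm: "(\<lambda>(d, w). horner w d k) \<in> borel_measurable (CC n \<Otimes>\<^sub>M lborel)" if "k < n" for k
      using that
    proof (induction k)
      case 0
      show ?case using comp2[OF 0] unfolding split_beta' horner.simps by measurable
    next
      case (Suc k)
      show ?case using comp2[OF Suc.prems] Suc.IH[OF Suc_lessD[OF Suc.prems]]
        unfolding split_beta' horner.simps by measurable
    qed
    have qm: "(\<lambda>(d, w). coeff (?q w d) k) \<in> borel_measurable (CC n \<Otimes>\<^sub>M lborel)" for k
      using hm unfolding split_beta' by (rule desc_poly_coeff_measurable)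
    have [measurable]: "(\<lambda>(d, w). poly (?q w d) w) \<in> borel_measurable (CC n \<Otimes>\<^sub>M lborel)"
      using qm unfolding split_beta' by (intro poly_measurable_coeffs[where n = n]) auto
    have [measurable]: "(\<lambda>(d, w). root_sum n (\<lambda>z. \<phi> (z(n := w))) (?q w d)) \<in> borel_measurable (CC n \<Otimes>\<^sub>M lborel)"
      using qm unfolding split_beta' by (intro root_sum_measurable) (auto simp: split_beta')
    show "(\<lambda>(d, w). root_sum n (\<lambda>z. \<phi> (z(n := w))) (?q w d) * ennreal ((cmod (poly (?q w d) w))\<^sup>2))
      \<in> borel_measurable (CC n \<Otimes>\<^sub>M lborel)"
      unfolding split_beta' by measurable
  qed
  also have "\<dots> = (\<integral>\<^sup>+d. \<integral>\<^sup>+x. root_sum (Suc n) \<phi> (desc_poly (Suc n) (d(n := x))) \<partial>lborel \<partial>CC n)"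
    by (intro nn_integral_cong sum_roots_fibre) simp_all
  also have "\<dots> = (\<integral>\<^sup>+c. root_sum (Suc n) \<phi> (desc_poly (Suc n) c) \<partial>CC (Suc n))"
  proof (rule nn_integral_CC_Suc(1)[symmetric])
    show "(\<lambda>c. root_sum (Suc n) \<phi> (desc_poly (Suc n) c)) \<in> borel_measurable (CC (Suc n))"
      by (intro root_sum_measurable desc_poly_coeff_measurable) auto
  qed
  finally show ?case .
qed

section \<open>A Hermite--Biehler step\<close>

definition re_poly :: "complex poly \<Rightarrow> complex poly" where
  "re_poly = map_poly (\<lambda>x. of_real (Re x))"
definition im_poly :: "complex poly \<Rightarrow> complex poly" where
  "im_poly = map_poly (\<lambda>x. of_real (Im x))"

lemma coeff_re_poly [simp]: "coeff (re_poly g) k = of_real (Re (coeff g k))"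
  by (simp add: re_poly_def coeff_map_poly)
lemma coeff_im_poly [simp]: "coeff (im_poly g) k = of_real (Im (coeff g k))"
  by (simp add: im_poly_def coeff_map_poly)

lemma re_im_poly: "g = re_poly g + Polynomial.smult \<i> (im_poly g)"
  by (intro poly_eqI) (simp add: complex_eq)

text \<open>
  One step of the recursion for the characteristic polynomials: if \<open>g = Q + i T\<close> with \<open>Q\<close> and \<open>T\<close> real, the
  new polynomial is \<open>(x - \<zeta>) Q + T\<close>. Real polynomials are kept inside the complex ones.
\<close>

definition jacobi_step :: "complex \<Rightarrow> complex poly \<Rightarrow> complex poly" where
  "jacobi_step \<zeta> g = [:-\<zeta>, 1:] * re_poly g + im_poly g"

definition monic_deg :: "nat \<Rightarrow> complex poly \<Rightarrow> bool" where
  "monic_deg n p \<longleftrightarrow> degree p = n \<and> coeff p n = 1"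

lemma monic_degI: "coeff p n = 1 \<Longrightarrow> (\<And>k. k > n \<Longrightarrow> coeff p k = 0) \<Longrightarrow> monic_deg n p"
  unfolding monic_deg_def by (metis degree_le le_antisym le_degree zero_neq_one)

lemma monic_deg_coeff: "monic_deg n p \<Longrightarrow> coeff p n = 1" "monic_deg n p \<Longrightarrow> k > n \<Longrightarrow> coeff p k = 0"
  by (auto simp: monic_deg_def coeff_eq_0)

lemma monic_deg_nonzero: "monic_deg n p \<Longrightarrow> p \<noteq> 0"
  by (auto simp: monic_deg_def)

lemma monic_deg_desc_poly: "monic_deg n (desc_poly n c)"
  by (simp add: monic_deg_def)

lemma monic_deg_re_poly: "monic_deg n g \<Longrightarrow> monic_deg n (re_poly g)"
  by (rule monic_degI) (auto simp: monic_deg_coeff)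

lemma im_poly_top: "monic_deg n g \<Longrightarrow> k \<ge> n \<Longrightarrow> coeff (im_poly g) k = 0"
  by (cases "k = n") (auto simp: monic_deg_coeff)

lemma coeff_step:
  fixes \<zeta> :: complex
  shows "coeff (jacobi_step \<zeta> g) 0 = - \<zeta> * Re (coeff g 0) + Im (coeff g 0)"
  "coeff (jacobi_step \<zeta> g) (Suc k) = Re (coeff g k) - \<zeta> * Re (coeff g (Suc k)) + Im (coeff g (Suc k))"
  by (simp_all add: jacobi_step_def)

lemma monic_deg_step: "monic_deg n g \<Longrightarrow> monic_deg (Suc n) (jacobi_step \<zeta> g)"
proof (rule monic_degI)
  assume g: "monic_deg n g"
  show "coeff (jacobi_step \<zeta> g) (Suc n) = 1"
    unfolding coeff_step using g by (simp add: monic_deg_coeff)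
  fix k assume "k > Suc n"
  then obtain j where "k = Suc j" "j > n" by (cases k) auto
  then show "coeff (jacobi_step \<zeta> g) k = 0"
    using g by (simp add: coeff_step monic_deg_coeff)
qed

definition roots_upper :: "complex poly \<Rightarrow> bool" where
  "roots_upper p \<longleftrightarrow> (\<forall>z. poly p z = 0 \<longrightarrow> Im z > 0)"

abbreviation root_at :: "complex poly \<Rightarrow> nat \<Rightarrow> complex" where "root_at p j \<equiv> root_list p ! j"

lemma monic_eq_prod: "monic_deg n p \<Longrightarrow> p = (\<Prod>j<n. [:- root_at p j, 1:])"
  using poly_eq_prod_root_list[of p n id] by (simp add: monic_deg_def permutes_id)

lemma poly_monic: "monic_deg n p \<Longrightarrow> poly p w = (\<Prod>j<n. w - root_at p j)"
  by (subst monic_eq_prod[of n p]) (auto simp: poly_prod)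

lemma roots_upper_iff: "monic_deg n p \<Longrightarrow> roots_upper p \<longleftrightarrow> (\<forall>j<n. Im (root_at p j) > 0)"
  unfolding roots_upper_def by (auto simp: poly_monic)

text \<open>
  The first two elementary symmetric functions of the roots; the invariants of the recursion are expressed
  through them.
\<close>

lemma coeff_prod_linear:
  fixes z :: "nat \<Rightarrow> complex"
  shows coeff_prod_linear_1: "coeff (\<Prod>j<Suc n. [:- z j, 1:]) n = - (\<Sum>j<Suc n. z j)"
    and coeff_prod_linear_2: "coeff (\<Prod>j<Suc (Suc n). [:- z j, 1:]) n = (\<Sum>k<Suc (Suc n). \<Sum>j<k. z j * z k)"
proof -
  have prod_Suc: "(\<Prod>j<Suc n. [:- z j, 1:]) = Polynomial.smult (- z n) (\<Prod>j<n. [:- z j, 1:]) + pCons 0 (\<Prod>j<n. [:- z j, 1:])" for n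
    by (simp add: mult.commute)
  have m: "monic_deg n (\<Prod>j<n. [:- z j, 1:])" for n
  proof (induction n)
    case (Suc n)
    show ?case unfolding prod_Suc
      by (rule monic_degI) (use Suc in \<open>auto simp: monic_deg_coeff coeff_pCons split: nat.splits\<close>)
  qed (simp add: monic_deg_def)
  have 1: "coeff (\<Prod>j<Suc n. [:- z j, 1:]) n = - (\<Sum>j<Suc n. z j)" for n
  proof (induction n)
    case (Suc n)
    have "coeff (\<Prod>j<Suc (Suc n). [:- z j, 1:]) (Suc n) = - z (Suc n) * coeff (\<Prod>j<Suc n. [:- z j, 1:]) (Suc n) + coeff (\<Prod>j<Suc n. [:- z j, 1:]) n"
      by (subst prod_Suc) simp
    also have "\<dots> = - z (Suc n) - (\<Sum>j<Suc n. z j)" unfolding monic_deg_coeff(1)[OF m] Suc by simp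
    finally show ?case by simp
  qed simp
  then show "coeff (\<Prod>j<Suc n. [:- z j, 1:]) n = - (\<Sum>j<Suc n. z j)" .
  show "coeff (\<Prod>j<Suc (Suc n). [:- z j, 1:]) n = (\<Sum>k<Suc (Suc n). \<Sum>j<k. z j * z k)"
  proof (induction n)
    case (Suc n)
    have "coeff (\<Prod>j<Suc (Suc (Suc n)). [:- z j, 1:]) (Suc n)
      = - z (Suc (Suc n)) * coeff (\<Prod>j<Suc (Suc n). [:- z j, 1:]) (Suc n) + coeff (\<Prod>j<Suc (Suc n). [:- z j, 1:]) n"
      by (subst prod_Suc) simp
    also have "\<dots> = z (Suc (Suc n)) * (\<Sum>j<Suc (Suc n). z j) + (\<Sum>k<Suc (Suc n). \<Sum>j<k. z j * z k)"
      by (simp only: 1 Suc mult_minus_left mult_minus_right minus_minus)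
    also have "\<dots> = (\<Sum>k<Suc (Suc (Suc n)). \<Sum>j<k. z j * z k)"
      unfolding sum.lessThan_Suc[of "\<lambda>k. \<Sum>j<k. z j * z k" "Suc (Suc n)"]
      by (simp only: sum_distrib_left mult.commute[of "z (Suc (Suc n))"] add.commute)
    finally show ?case .
  qed simp
qed

lemma poly_re_im_cnj:
  "poly (re_poly g) (cnj z) = cnj (poly (re_poly g) z)" "poly (im_poly g) (cnj z) = cnj (poly (im_poly g) z)"
  by (simp_all add: poly_cnj_real)

lemma poly_g: "poly g z = poly (re_poly g) z + \<i> * poly (im_poly g) z"
  by (subst re_im_poly) simp

lemma norm_le_norm_cnj:
  assumes "Im r > 0" "Im z \<le> 0"
  shows "cmod (cnj z - r) \<le> cmod (z - r)" "Im z < 0 \<Longrightarrow> cmod (cnj z - r) < cmod (z - r)"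
proof -
  have "(cmod (z - r))\<^sup>2 - (cmod (cnj z - r))\<^sup>2 = - 4 * Im z * Im r"
    unfolding cmod_power2 by (simp add: power2_eq_square algebra_simps)
  moreover have "- 4 * Im z * Im r \<ge> 0" using assms by (simp add: mult_nonpos_nonneg)
  moreover have "Im z < 0 \<Longrightarrow> - 4 * Im z * Im r > 0" using assms by (simp add: mult_neg_pos)
  ultimately have "(cmod (cnj z - r))\<^sup>2 \<le> (cmod (z - r))\<^sup>2"
    "Im z < 0 \<Longrightarrow> (cmod (cnj z - r))\<^sup>2 < (cmod (z - r))\<^sup>2" by linarith+
  then show "cmod (cnj z - r) \<le> cmod (z - r)" "Im z < 0 \<Longrightarrow> cmod (cnj z - r) < cmod (z - r)"
    by (auto intro: power2_le_imp_le power2_less_imp_less)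
qed

lemma roots_upper_norm_cnj:
  assumes p: "monic_deg n p" "roots_upper p" and z: "Im z \<le> 0"
  shows "cmod (poly p (cnj z)) \<le> cmod (poly p z)"
    and "n > 0 \<Longrightarrow> Im z < 0 \<Longrightarrow> cmod (poly p (cnj z)) < cmod (poly p z)"
proof -
  have up: "Im (root_at p j) > 0" if "j < n" for j using p that by (simp add: roots_upper_iff)
  show "cmod (poly p (cnj z)) \<le> cmod (poly p z)"
    unfolding poly_monic[OF p(1)] prod_norm[symmetric]
    by (intro prod_mono conjI norm_le_norm_cnj(1)) (use up z in auto)
  assume n: "n > 0" and zn: "Im z < 0"
  show "cmod (poly p (cnj z)) < cmod (poly p z)"
    unfolding poly_monic[OF p(1)] prod_norm[symmetric]
  proof (rule prod_mono_strict[of 0])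
    have lt: "cmod (cnj z - root_at p j) < cmod (z - root_at p j)" if "j < n" for j
      using norm_le_norm_cnj(2)[OF up z zn] that by auto
    show "cmod (cnj z - root_at p 0) < cmod (z - root_at p 0)" using lt n by simp
    show "0 \<le> cmod (cnj z - root_at p j) \<and> cmod (cnj z - root_at p j) \<le> cmod (z - root_at p j)" if "j \<in> {..<n}" for j
      using lt[of j] that by simp
    show "0 < cmod (z - root_at p j)" if "j \<in> {..<n}" for j
      using lt[of j] that norm_ge_zero le_less_trans by blast
  qed (use n in auto)
qed

text \<open>
  At a root \<open>z\<close> of the new polynomial, \<open>T = (\<zeta> - z) Q\<close>. If \<open>Im z \<le> 0\<close>, then \<open>|g(cnj z)| \<le> |g(z)|\<close> says
  \<open>Im (Q cnj T) \<ge> 0\<close>, which together with \<open>Im z < Im \<zeta>\<close> forces \<open>Q = T = 0\<close>, so that \<open>z\<close> is a root of \<open>g\<close>.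
\<close>

lemma roots_upper_step_if:
  assumes g: "monic_deg n g" "roots_upper g" and \<zeta>: "Im \<zeta> > 0"
  shows "roots_upper (jacobi_step \<zeta> g)"
  unfolding roots_upper_def
proof (intro allI impI, rule ccontr)
  fix z assume fz: "poly (jacobi_step \<zeta> g) z = 0" and "\<not> Im z > 0"
  then have z: "Im z \<le> 0" by simp
  define Q T where "Q = poly (re_poly g) z" and "T = poly (im_poly g) z"
  have T: "T = (\<zeta> - z) * Q" using fz unfolding jacobi_step_def Q_def T_def
    by (simp add: algebra_simps)
  have "cmod (cnj Q + \<i> * cnj T) \<le> cmod (Q + \<i> * T)"
    using roots_upper_norm_cnj(1)[OF g z] unfolding poly_g[of g z] poly_g[of g "cnj z"] poly_re_im_cnj Q_def T_def .
  then have "(cmod (cnj Q + \<i> * cnj T))\<^sup>2 \<le> (cmod (Q + \<i> * T))\<^sup>2" by (rule power_mono) simp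
  then have "0 \<le> Im Q * Re T - Re Q * Im T"
    unfolding cmod_power2 by (simp add: power2_eq_square algebra_simps)
  also have "\<dots> = (Im z - Im \<zeta>) * ((Re Q)\<^sup>2 + (Im Q)\<^sup>2)"
    unfolding T by (simp add: power2_eq_square algebra_simps)
  finally have "(Re Q)\<^sup>2 + (Im Q)\<^sup>2 \<le> 0" using z \<zeta> by (simp add: zero_le_mult_iff)
  then have "Q = 0" by (simp add: sum_power2_le_zero_iff complex_eq_iff)
  then have "poly g z = 0" using T unfolding poly_g[of g z] Q_def[symmetric] T_def[symmetric] by simp
  then show False using g z by (auto simp: roots_upper_def)
qed

text \<open>
  The logarithmic derivative \<open>\<Sum> 1 / (x - z\<^sub>j)\<close> has positive imaginary part at real points.
\<close>

lemma roots_upper_deriv: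
  assumes p: "monic_deg n p" "roots_upper p" and n: "n > 0" and x: "Im x = 0"
  shows "Im (poly (pderiv p) x * cnj (poly p x)) > 0"
proof -
  have up: "Im (root_at p j) > 0" if "j < n" for j using p that by (simp add: roots_upper_iff)
  have "pderiv p = (\<Sum>s<n. \<Prod>j\<in>{..<n} - {s}. [:- root_at p j, 1:])"
    by (subst monic_eq_prod[OF p(1)]) (simp add: pderiv_prod pderiv_pCons)
  then have "poly (pderiv p) x = (\<Sum>s<n. \<Prod>j\<in>{..<n} - {s}. (x - root_at p j))"
    by (simp add: poly_sum poly_prod)
  then have "poly (pderiv p) x * cnj (poly p x)
    = (\<Sum>s<n. (\<Prod>j\<in>{..<n} - {s}. (x - root_at p j)) * cnj (\<Prod>j<n. x - root_at p j))"
    by (simp add: sum_distrib_right poly_monic[OF p(1)])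
  also have "\<dots> = (\<Sum>s<n. of_real ((cmod (\<Prod>j\<in>{..<n} - {s}. (x - root_at p j)))\<^sup>2) * cnj (x - root_at p s))"
  proof (rule sum.cong[OF refl])
    fix s assume "s \<in> {..<n}"
    then have "(\<Prod>j<n. x - root_at p j) = (x - root_at p s) * (\<Prod>j\<in>{..<n} - {s}. (x - root_at p j))"
      by (subst prod.remove[of _ s]) auto
    then show "(\<Prod>j\<in>{..<n} - {s}. (x - root_at p j)) * cnj (\<Prod>j<n. x - root_at p j)
      = of_real ((cmod (\<Prod>j\<in>{..<n} - {s}. (x - root_at p j)))\<^sup>2) * cnj (x - root_at p s)"
      by (simp only: complex_norm_square complex_cnj_mult) (simp only: mult_ac)
  qed
  finally have eq: "Im (poly (pderiv p) x * cnj (poly p x))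
    = (\<Sum>s<n. (cmod (\<Prod>j\<in>{..<n} - {s}. (x - root_at p j)))\<^sup>2 * Im (root_at p s))"
    by (simp add: x del: of_real_power)
  show ?thesis unfolding eq
  proof (rule sum_pos)
    fix s assume "s \<in> {..<n}"
    have "x - root_at p j \<noteq> 0" if "j < n" for j using up[OF that] x by auto
    then have "(\<Prod>j\<in>{..<n} - {s}. (x - root_at p j)) \<noteq> 0" by (auto simp: prod_zero_iff)
    then show "0 < (cmod (\<Prod>j\<in>{..<n} - {s}. (x - root_at p j)))\<^sup>2 * Im (root_at p s)"
      using up[of s] \<open>s \<in> {..<n}\<close> by simp
  qed (use n in auto)
qed

text \<open>
  The partial fraction expansion of \<open>T / Q\<close>. After multiplication by \<open>Q\<close> both sides are polynomials of degree
  below \<open>n\<close> that agree at the \<open>n\<close> roots of \<open>Q\<close>.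
\<close>

lemma lagrange_simple_roots:
  fixes Q T :: "complex poly"
  assumes Q: "monic_deg n Q" and T: "\<And>k. k \<ge> n \<Longrightarrow> coeff T k = 0"
    and simple: "\<And>\<mu>. poly Q \<mu> = 0 \<Longrightarrow> poly (pderiv Q) \<mu> \<noteq> 0" and z: "poly Q z \<noteq> 0"
  shows "poly T z = poly Q z * (\<Sum>\<mu>\<in>{\<mu>. poly Q \<mu> = 0}. poly T \<mu> / poly (pderiv Q) \<mu> / (z - \<mu>))"
proof -
  define R where "R = {\<mu>. poly Q \<mu> = 0}"
  have "Q \<noteq> 0" using Q by (rule monic_deg_nonzero)
  have finR: "finite R" unfolding R_def using \<open>Q \<noteq> 0\<close> by (rule poly_roots_finite)
  have "rsquarefree Q" unfolding rsquarefree_roots using simple by blast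
  then have "distinct (root_list Q)"
    unfolding distinct_root_list using \<open>Q \<noteq> 0\<close> by (metis count_proots rsquarefree_def le0 order_refl)
  then have cardR: "card R = n"
    using distinct_card[of "root_list Q"] set_root_list[OF \<open>Q \<noteq> 0\<close>] Q
    by (simp add: R_def length_root_list monic_deg_def)
  define L where "L \<mu> = Q div [:-\<mu>, 1:]" for \<mu>
  have L: "Q = [:-\<mu>, 1:] * L \<mu>" if "\<mu> \<in> R" for \<mu>
    using that unfolding L_def R_def by (metis poly_eq_0_iff_dvd dvd_mult_div_cancel mem_Collect_eq)
  have L': "poly (L \<mu>) \<mu> = poly (pderiv Q) \<mu>" if "\<mu> \<in> R" for \<mu>
  proof -
    have "pderiv Q = [:-\<mu>, 1:] * pderiv (L \<mu>) + L \<mu> * pderiv [:-\<mu>, 1:]"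
      by (subst L[OF that]) (simp only: pderiv_mult)
    then show ?thesis by (simp add: pderiv_pCons)
  qed
  have degL: "degree (L \<mu>) < n" if "\<mu> \<in> R" for \<mu>
  proof -
    have "L \<mu> \<noteq> 0" using L[OF that] \<open>Q \<noteq> 0\<close> by auto
    have "n = degree Q" using Q by (simp add: monic_deg_def)
    also have "\<dots> = Suc (degree (L \<mu>))"
      using \<open>L \<mu> \<noteq> 0\<close> by (subst L[OF that], subst degree_mult_eq) auto
    finally show ?thesis by simp
  qed
  have L0: "poly (L \<mu>) \<nu> = 0" if "\<mu> \<in> R" "\<nu> \<in> R" "\<mu> \<noteq> \<nu>" for \<mu> \<nu>
  proof -
    have "0 = poly Q \<nu>" using that by (simp add: R_def)
    also have "\<dots> = (\<nu> - \<mu>) * poly (L \<mu>) \<nu>" by (subst L[OF that(1)]) (simp add: algebra_simps)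
    finally show ?thesis using that by simp
  qed
  define D where "D = T - (\<Sum>\<mu>\<in>R. Polynomial.smult (poly T \<mu> / poly (pderiv Q) \<mu>) (L \<mu>))"
  have "D = 0"
  proof (rule ccontr)
    assume "D \<noteq> 0"
    have "poly D \<nu> = 0" if "\<nu> \<in> R" for \<nu>
    proof -
      have "(\<Sum>\<mu>\<in>R. poly (Polynomial.smult (poly T \<mu> / poly (pderiv Q) \<mu>) (L \<mu>)) \<nu>) = (\<Sum>\<mu>\<in>{\<nu>}. poly (Polynomial.smult (poly T \<mu> / poly (pderiv Q) \<mu>) (L \<mu>)) \<nu>)"
        by (rule sum.mono_neutral_right[OF finR]) (use that L0 in auto)
      also have "\<dots> = poly T \<nu>" using L'[OF that] simple that by (simp add: R_def)
      finally show ?thesis by (simp add: D_def poly_sum)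
    qed
    then have "R \<subseteq> {x. poly D x = 0}" by auto
    then have "n \<le> card {x. poly D x = 0}"
      using card_mono[OF poly_roots_finite[OF \<open>D \<noteq> 0\<close>]] cardR by metis
    also have "\<dots> \<le> degree D" by (rule card_poly_roots_bound[OF \<open>D \<noteq> 0\<close>])
    finally have deg: "n \<le> degree D" .
    have "coeff (L \<mu>) (degree D) = 0" if "\<mu> \<in> R" for \<mu>
      using degL[OF that] deg by (simp add: coeff_eq_0)
    then have "(\<Sum>\<mu>\<in>R. coeff (Polynomial.smult (poly T \<mu> / poly (pderiv Q) \<mu>) (L \<mu>)) (degree D)) = 0"
      by (intro sum.neutral) auto
    then have "coeff D (degree D) = 0"
      using T[OF deg] by (subst D_def) (simp add: coeff_sum)
    with \<open>D \<noteq> 0\<close> show False by simp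
  qed
  then have "T = (\<Sum>\<mu>\<in>R. Polynomial.smult (poly T \<mu> / poly (pderiv Q) \<mu>) (L \<mu>))"
    unfolding D_def by simp
  from arg_cong[OF this, of "\<lambda>p. poly p z"]
  have "poly T z = (\<Sum>\<mu>\<in>R. poly T \<mu> / poly (pderiv Q) \<mu> * poly (L \<mu>) z)"
    by (simp add: poly_sum)
  also have "\<dots> = (\<Sum>\<mu>\<in>R. poly Q z * (poly T \<mu> / poly (pderiv Q) \<mu> / (z - \<mu>)))"
  proof (rule sum.cong[OF refl])
    fix \<mu> assume \<mu>: "\<mu> \<in> R"
    have "z - \<mu> \<noteq> 0" using z \<mu> by (auto simp: R_def)
    moreover have "poly Q z = (z - \<mu>) * poly (L \<mu>) z" by (subst L[OF \<mu>]) (simp add: algebra_simps)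
    ultimately show "poly T \<mu> / poly (pderiv Q) \<mu> * poly (L \<mu>) z = poly Q z * (poly T \<mu> / poly (pderiv Q) \<mu> / (z - \<mu>))"
      by simp
  qed
  finally show ?thesis by (simp add: R_def sum_distrib_left)
qed

text \<open>
  The converse, after Hermite and Biehler. Let \<open>f\<close> be the new polynomial. The strict inequality
  \<open>|f(cnj z)| < |f(z)|\<close> for \<open>Im z < 0\<close> shows that \<open>Q\<close> has real roots only, and the sign of \<open>Im (f' cnj f)\<close> on
  the real line shows that they are simple with \<open>T(\<mu>) Q'(\<mu>) < 0\<close>. So \<open>T / Q\<close> is a sum of terms
  \<open>c / (z - \<mu>)\<close> with \<open>c < 0\<close>, and \<open>T / Q = i\<close>, which holds at every root of \<open>g\<close>, is possible only if \<open>Im z > 0\<close>.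
\<close>

lemma roots_upper_step_only_if:
  assumes g: "monic_deg n g" and up: "roots_upper (jacobi_step \<zeta> g)"
  shows "Im \<zeta> > 0" "roots_upper g"
proof -
  let ?f = "jacobi_step \<zeta> g" and ?Q = "re_poly g" and ?T = "im_poly g"
  have f: "monic_deg (Suc n) ?f" by (rule monic_deg_step[OF g])
  have upj: "Im (root_at ?f j) > 0" if "j < Suc n" for j using roots_upper_iff[OF f] up that by simp
  have "coeff ?f n = - (\<Sum>j<Suc n. root_at ?f j)"
    using coeff_prod_linear_1[of "root_at ?f" n] monic_eq_prod[OF f] by metis
  moreover have "Im (coeff ?f n) = - Im \<zeta>"
    using g by (cases n) (simp_all add: coeff_step monic_deg_coeff)
  ultimately have "Im \<zeta> = (\<Sum>j<Suc n. Im (root_at ?f j))" by simp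
  also have "\<dots> > 0" using upj by (intro sum_pos) auto
  finally show \<zeta>: "Im \<zeta> > 0" .
  have Q: "monic_deg n ?Q" by (rule monic_deg_re_poly[OF g])
  have fv: "poly ?f x = (x - \<zeta>) * poly ?Q x + poly ?T x" for x
    by (simp add: jacobi_step_def algebra_simps)
  \<comment> \<open>At a root of \<open>Q\<close> the values of \<open>f\<close> at \<open>\<mu>\<close> and \<open>cnj \<mu>\<close> are conjugate, hence of equal modulus.\<close>
  have Qroot_le: "\<not> Im \<mu> < 0" if "poly ?Q \<mu> = 0" for \<mu>
  proof
    assume "Im \<mu> < 0"
    from roots_upper_norm_cnj(2)[OF f up _ _ this] this
    have "cmod (poly ?f (cnj \<mu>)) < cmod (poly ?f \<mu>)" by simp
    then show False using that by (simp add: fv poly_re_im_cnj)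
  qed
  have Qreal: "Im \<mu> = 0" if "poly ?Q \<mu> = 0" for \<mu>
    using Qroot_le[OF that] Qroot_le[of "cnj \<mu>"] that by (simp add: poly_re_im_cnj)
  have real: "poly ?T \<mu> \<in> \<real>" "poly (pderiv ?Q) \<mu> \<in> \<real>" "poly (pderiv ?T) \<mu> \<in> \<real>" if "Im \<mu> = 0" for \<mu>
  proof -
    have "\<mu> \<in> \<real>" using that by (simp add: complex_is_Real_iff)
    then show "poly ?T \<mu> \<in> \<real>" "poly (pderiv ?Q) \<mu> \<in> \<real>" "poly (pderiv ?T) \<mu> \<in> \<real>"
      unfolding poly_altdef by (auto intro!: sum_in_Reals Reals_mult Reals_power simp: coeff_pderiv)
  qed
  have key: "Re (poly ?T \<mu>) * Re (poly (pderiv ?Q) \<mu>) < 0" if \<mu>: "poly ?Q \<mu> = 0" for \<mu>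
  proof -
    note re = Qreal[OF \<mu>]
    have pf: "pderiv ?f = [:-\<zeta>, 1:] * pderiv ?Q + ?Q * pderiv [:-\<zeta>, 1:] + pderiv ?T"
      unfolding jacobi_step_def by (simp only: pderiv_add pderiv_mult)
    have d: "poly (pderiv ?f) \<mu> = (\<mu> - \<zeta>) * poly (pderiv ?Q) \<mu> + poly (pderiv ?T) \<mu>"
      using \<mu> by (subst pf) (simp add: pderiv_pCons algebra_simps)
    have "0 < Im (poly (pderiv ?f) \<mu> * cnj (poly ?f \<mu>))"
      by (rule roots_upper_deriv[OF f up _ re]) simp
    also have "\<dots> = - Im \<zeta> * (Re (poly ?T \<mu>) * Re (poly (pderiv ?Q) \<mu>))"
      unfolding d fv using \<mu> real[OF re] re by (simp add: complex_is_Real_iff algebra_simps)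
    finally show ?thesis using \<zeta> by (simp add: mult_less_0_iff zero_less_mult_iff)
  qed
  show "roots_upper g"
    unfolding roots_upper_def
  proof (intro allI impI)
    fix z assume "poly g z = 0"
    then have gz: "poly ?Q z + \<i> * poly ?T z = 0" by (simp add: poly_g[of g z])
    have Qz: "poly ?Q z \<noteq> 0" using key[of z] gz by auto
    let ?R = "{\<mu>. poly ?Q \<mu> = 0}"
    define c where "c \<mu> = Re (poly ?T \<mu>) / Re (poly (pderiv ?Q) \<mu>)" for \<mu>
    have c: "poly ?T \<mu> / poly (pderiv ?Q) \<mu> = of_real (c \<mu>)" "c \<mu> < 0" if "\<mu> \<in> ?R" for \<mu>
    proof -
      have \<mu>: "poly ?Q \<mu> = 0" using that by simp
      have "poly ?T \<mu> = of_real (Re (poly ?T \<mu>))" "poly (pderiv ?Q) \<mu> = of_real (Re (poly (pderiv ?Q) \<mu>))"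
        using real[OF Qreal[OF \<mu>]] by (auto simp: of_real_Re)
      then show "poly ?T \<mu> / poly (pderiv ?Q) \<mu> = of_real (c \<mu>)" unfolding c_def by (metis of_real_divide)
      show "c \<mu> < 0" using key[OF \<mu>] unfolding c_def by (auto simp: mult_less_0_iff divide_less_0_iff)
    qed
    have "poly ?T z = poly ?Q z * (\<Sum>\<mu>\<in>?R. poly ?T \<mu> / poly (pderiv ?Q) \<mu> / (z - \<mu>))"
      by (rule lagrange_simple_roots[OF Q im_poly_top[OF g] _ Qz]) (use key in force)+
    also have "(\<Sum>\<mu>\<in>?R. poly ?T \<mu> / poly (pderiv ?Q) \<mu> / (z - \<mu>)) = (\<Sum>\<mu>\<in>?R. of_real (c \<mu>) / (z - \<mu>))"
      using c(1) by (intro sum.cong) auto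
    finally have "poly ?Q z * (1 + \<i> * (\<Sum>\<mu>\<in>?R. of_real (c \<mu>) / (z - \<mu>))) = 0"
      using gz by (simp add: algebra_simps)
    then have S: "1 + \<i> * (\<Sum>\<mu>\<in>?R. of_real (c \<mu>) / (z - \<mu>)) = 0" using Qz by simp
    have "1 + \<i> * s = 0 \<Longrightarrow> Im s = 1" for s by (simp add: complex_eq_iff)
    from this[OF S] have "1 = (\<Sum>\<mu>\<in>?R. Im (of_real (c \<mu>) / (z - \<mu>)))" by simp
    also have "\<dots> = (\<Sum>\<mu>\<in>?R. Im z * (- c \<mu> / (cmod (z - \<mu>))\<^sup>2))"
      using Qreal by (intro sum.cong refl) (auto simp: Im_divide cmod_power2)
    also have "\<dots> = Im z * (\<Sum>\<mu>\<in>?R. - c \<mu> / (cmod (z - \<mu>))\<^sup>2)" by (simp add: sum_distrib_left)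
    finally have 1: "Im z * (\<Sum>\<mu>\<in>?R. - c \<mu> / (cmod (z - \<mu>))\<^sup>2) = 1" by simp
    have "(\<Sum>\<mu>\<in>?R. - c \<mu> / (cmod (z - \<mu>))\<^sup>2) \<ge> 0"
      using c(2) by (intro sum_nonneg divide_nonneg_nonneg) (auto intro: less_imp_le)
    then have "\<not> Im z \<le> 0" using 1 mult_nonpos_nonneg by fastforce
    then show "Im z > 0" by simp
  qed
qed

theorem roots_upper_step_iff: "monic_deg n g \<Longrightarrow> roots_upper (jacobi_step \<zeta> g) \<longleftrightarrow> Im \<zeta> > 0 \<and> roots_upper g"
  using roots_upper_step_if roots_upper_step_only_if by blast

section \<open>Jacobi parameters and coefficients as coordinates\<close>

primrec param_poly :: "nat \<Rightarrow> (nat \<Rightarrow> complex) \<Rightarrow> complex poly" where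
  "param_poly 0 \<zeta> = 1"
| "param_poly (Suc n) \<zeta> = jacobi_step (\<zeta> n) (param_poly n \<zeta>)"

lemma monic_deg_param_poly: "monic_deg n (param_poly n \<zeta>)"
  by (induction n) (auto intro: monic_deg_step simp: monic_deg_def[of 0])

lemma param_poly_cong: "(\<And>k. k < n \<Longrightarrow> \<zeta> k = \<xi> k) \<Longrightarrow> param_poly n \<zeta> = param_poly n \<xi>"
  by (induction n) auto

lemma roots_upper_param_poly: "roots_upper (param_poly n \<zeta>) \<longleftrightarrow> (\<forall>k<n. Im (\<zeta> k) > 0)"
proof (induction n)
  case (Suc n)
  then show ?case
    by (simp add: roots_upper_step_iff[OF monic_deg_param_poly] less_Suc_eq) auto
qed (simp add: roots_upper_def)

lemma coeff_step_measurable: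
  assumes "\<And>k. (\<lambda>\<omega>. coeff (g \<omega>) k) \<in> borel_measurable M" "\<zeta> \<in> borel_measurable M"
  shows "(\<lambda>\<omega>. coeff (jacobi_step (\<zeta> \<omega>) (g \<omega>)) k) \<in> borel_measurable M"
proof (cases k)
  case 0
  then show ?thesis using assms by (simp add: coeff_step)
next
  case (Suc j)
  note [measurable] = assms
  show ?thesis unfolding Suc coeff_step by measurable
qed

lemma param_poly_coeff_measurable:
  assumes "\<And>k. k < n \<Longrightarrow> (\<lambda>\<omega>. \<zeta> \<omega> k) \<in> borel_measurable M"
  shows "(\<lambda>\<omega>. coeff (param_poly n (\<zeta> \<omega>)) k) \<in> borel_measurable M"
  using assms
proof (induction n arbitrary: k)
  case (Suc n)
  then show ?case by (auto intro!: coeff_step_measurable)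
qed simp

lemma roots_upper_measurable:
  assumes "\<And>k. (\<lambda>\<omega>. coeff (f \<omega>) k) \<in> borel_measurable M" "\<And>\<omega>. monic_deg n (f \<omega>)"
  shows "Measurable.pred M (\<lambda>\<omega>. roots_upper (f \<omega>))"
proof -
  have [measurable]: "Measurable.pred M (\<lambda>\<omega>. Im (root_at (f \<omega>) j) > 0)" if "j \<in> {..<n}" for j
  proof -
    have [measurable]: "(\<lambda>\<omega>. root_at (f \<omega>) j) \<in> borel_measurable M"
      using assms that by (intro root_list_measurable) (auto simp: monic_deg_def)
    show ?thesis by measurable
  qed
  have "(\<lambda>\<omega>. roots_upper (f \<omega>)) = (\<lambda>\<omega>. \<forall>j\<in>{..<n}. Im (root_at (f \<omega>) j) > 0)"
    using roots_upper_iff[OF assms(2)] by auto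
  also have "Measurable.pred M \<dots>" by measurable
  finally show ?thesis .
qed

lemma roots_upper_coeff:
  assumes "monic_deg (Suc n) p" "roots_upper p"
  shows "Im (coeff p n) < 0"
proof -
  have "coeff p n = - (\<Sum>j<Suc n. root_at p j)"
    using coeff_prod_linear_1[of "root_at p" n] monic_eq_prod[OF assms(1)] by metis
  moreover have "0 < (\<Sum>j<Suc n. Im (root_at p j))"
    using roots_upper_iff[OF assms(1)] assms(2) by (intro sum_pos) auto
  ultimately show ?thesis by simp
qed

definition rev_coeffs :: "nat \<Rightarrow> (nat \<Rightarrow> complex) \<Rightarrow> nat \<Rightarrow> complex" where
  "rev_coeffs n c = (\<lambda>k\<in>{..<n}. c (n - Suc k))"

lemma rev_coeffs_measurable [measurable]: "rev_coeffs n \<in> CC n \<rightarrow>\<^sub>M CC n"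
  unfolding rev_coeffs_def[abs_def]
  by (rule measurable_restrict) (use measurable_component_singleton[of _ "{..<n}" "\<lambda>_. lborel"] in auto)

lemma distr_rev_coeffs: "distr (CC n) (CC n) (rev_coeffs n) = CC n"
proof (rule CC.PiM_eqI)
  fix A :: "nat \<Rightarrow> complex set" assume A: "\<And>i. i \<in> {..<n} \<Longrightarrow> A i \<in> sets lborel"
  have "rev_coeffs n -` (Pi\<^sub>E {..<n} A) \<inter> space (CC n) = (\<Pi>\<^sub>E i\<in>{..<n}. A (n - Suc i))" (is "?L = ?R")
  proof (intro equalityI subsetI)
    fix c assume c: "c \<in> ?L"
    have "c i \<in> A (n - Suc i)" if "i < n" for i
    proof -
      have "rev_coeffs n c \<in> Pi\<^sub>E {..<n} A" using c by simp
      from PiE_mem[OF this, of "n - Suc i"] that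
      have "rev_coeffs n c (n - Suc i) \<in> A (n - Suc i)" by simp
      then show ?thesis using that by (simp add: rev_coeffs_def)
    qed
    then show "c \<in> ?R" using c by (auto simp: space_PiM PiE_def)
  next
    fix c assume c: "c \<in> ?R"
    have "c (n - Suc i) \<in> A i" if "i < n" for i
      using PiE_mem[OF c, of "n - Suc i"] that by simp
    then show "c \<in> ?L" using c by (auto simp: space_PiM rev_coeffs_def PiE_def)
  qed
  then have "emeasure (distr (CC n) (CC n) (rev_coeffs n)) (Pi\<^sub>E {..<n} A) = emeasure (CC n) (\<Pi>\<^sub>E i\<in>{..<n}. A (n - Suc i))"
    using A by (subst emeasure_distr) (auto intro!: sets_PiM_I_finite)
  also have "\<dots> = (\<Prod>i<n. emeasure lborel (A (n - Suc i)))"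
    by (rule CC.emeasure_PiM) (use A in auto)
  also have "\<dots> = (\<Prod>i\<in>{..<n}. emeasure lborel (A i))"
    by (rule prod.nat_diff_reindex)
  finally show "emeasure (distr (CC n) (CC n) (rev_coeffs n)) (Pi\<^sub>E {..<n} A) = (\<Prod>i\<in>{..<n}. emeasure lborel (A i))" .
qed auto

text \<open>
  The coefficients in ascending order. The recursion step is triangular in this order, and the descending
  order serves for splitting off roots; the reversal preserves Lebesgue measure.
\<close>

definition asc_poly :: "nat \<Rightarrow> (nat \<Rightarrow> complex) \<Rightarrow> complex poly" where
  "asc_poly n c = desc_poly n (rev_coeffs n c)"

lemma coeff_desc_poly: "coeff (desc_poly n c) k = (if k < n then c (n - Suc k) else if k = n then 1 else 0)"
proof (induction n arbitrary: k)
  case 0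
  then show ?case by (cases k) auto
next
  case (Suc n)
  then show ?case by (cases k) (auto simp: Suc_diff_Suc)
qed

lemma coeff_asc_poly: "coeff (asc_poly n c) k = (if k < n then c k else if k = n then 1 else 0)"
  by (auto simp: asc_poly_def coeff_desc_poly rev_coeffs_def)

lemma monic_deg_asc_poly: "monic_deg n (asc_poly n c)"
  unfolding asc_poly_def by (rule monic_deg_desc_poly)

lemma asc_poly_coeff_measurable:
  assumes "\<And>k. k < n \<Longrightarrow> (\<lambda>\<omega>. c \<omega> k) \<in> borel_measurable M"
  shows "(\<lambda>\<omega>. coeff (asc_poly n (c \<omega>)) k) \<in> borel_measurable M"
  unfolding coeff_asc_poly using assms by (cases "k < n"; cases "k = n") auto

lemma asc_poly_eqI: "monic_deg n p \<Longrightarrow> (\<And>k. k < n \<Longrightarrow> c k = coeff p k) \<Longrightarrow> p = asc_poly n c"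
  by (rule poly_eqI) (auto simp: coeff_asc_poly monic_deg_coeff not_less le_less)

lemma nn_integral_asc_poly_eq_desc_poly:
  assumes "(\<lambda>c. \<Phi> (desc_poly n c)) \<in> borel_measurable (CC n)"
  shows "(\<integral>\<^sup>+c. \<Phi> (asc_poly n c) \<partial>CC n) = (\<integral>\<^sup>+c. \<Phi> (desc_poly n c) \<partial>CC n)"
  using nn_integral_distr[of "rev_coeffs n" "CC n" "CC n" "\<lambda>c. \<Phi> (desc_poly n c)"] assms
  by (simp add: distr_rev_coeffs asc_poly_def)

text \<open>
  The map \<open>x \<mapsto> -u / Im x - x\<close> negates \<open>Im x\<close> and acts on each horizontal line as a reflection followed
  by a translation.
\<close>

lemma nn_integral_half_plane_shear:
  fixes H :: "complex \<Rightarrow> ennreal" and u :: real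
  assumes [measurable]: "H \<in> borel_measurable borel"
  shows "(\<integral>\<^sup>+x. (if Im x > 0 then H (of_real (- u / Im x) - x) else 0) \<partial>lborel)
    = (\<integral>\<^sup>+y. (if Im y < 0 then H y else 0) \<partial>lborel)"
proof -
  have [measurable]: "(\<lambda>(a, b). Complex a b) \<in> borel_measurable (lborel \<Otimes>\<^sub>M lborel)"
    unfolding Complex_eq by measurable
  have [measurable]: "(\<lambda>(b, a). H (Complex (f b a) (g b))) \<in> borel_measurable (lborel \<Otimes>\<^sub>M lborel)"
    if [measurable]: "(\<lambda>(b, a). f b a) \<in> borel_measurable (lborel \<Otimes>\<^sub>M lborel)" "g \<in> borel_measurable lborel" for f g
    unfolding Complex_eq by measurable
  have [measurable]: "(\<lambda>a. H (Complex (f a) b)) \<in> borel_measurable lborel"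
    if [measurable]: "f \<in> borel_measurable lborel" for f b
    unfolding Complex_eq by measurable
  have "(\<integral>\<^sup>+x. (if Im x > 0 then H (of_real (- u / Im x) - x) else 0) \<partial>lborel)
    = (\<integral>\<^sup>+a. \<integral>\<^sup>+b. (if b > 0 then H (Complex (- u / b - a) (- b)) else 0) \<partial>lborel \<partial>lborel)"
    by (subst nn_integral_lborel_complex, measurable)
       (auto intro!: nn_integral_cong simp: complex_eq_iff arg_cong[where f = H])
  also have "\<dots> = (\<integral>\<^sup>+b. \<integral>\<^sup>+a. (if b > 0 then H (Complex (- u / b - a) (- b)) else 0) \<partial>lborel \<partial>lborel)"
    by (rule lborel_pair.Fubini') measurable
  also have "\<dots> = (\<integral>\<^sup>+b. \<integral>\<^sup>+a. (if b > 0 then H (Complex a (- b)) else 0) \<partial>lborel \<partial>lborel)"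
  proof (rule nn_integral_cong)
    fix b :: real
    show "(\<integral>\<^sup>+a. (if b > 0 then H (Complex (- u / b - a) (- b)) else 0) \<partial>lborel)
      = (\<integral>\<^sup>+a. (if b > 0 then H (Complex a (- b)) else 0) \<partial>lborel)"
      using nn_integral_real_affine[of "\<lambda>a. H (Complex a (- b))" "-1" "- u / b"] by (cases "b > 0") auto
  qed
  also have "\<dots> = (\<integral>\<^sup>+b. \<integral>\<^sup>+a. (if b < 0 then H (Complex a b) else 0) \<partial>lborel \<partial>lborel)"
    using nn_integral_real_affine[of "\<lambda>b. \<integral>\<^sup>+a. (if b < 0 then H (Complex a b) else 0) \<partial>lborel" "-1" 0]
    by (simp cong: if_cong)
  also have "\<dots> = (\<integral>\<^sup>+a. \<integral>\<^sup>+b. (if b < 0 then H (Complex a b) else 0) \<partial>lborel \<partial>lborel)"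
    by (rule lborel_pair.Fubini'[symmetric]) measurable
  also have "\<dots> = (\<integral>\<^sup>+y. (if Im y < 0 then H y else 0) \<partial>lborel)"
    by (subst nn_integral_lborel_complex) auto
  finally show ?thesis .
qed

text \<open>
  The real-linear map \<open>y \<mapsto> Im y - x Re y\<close> of the plane has determinant \<open>Im x\<close>, up to sign.
\<close>

lemma nn_integral_coeff_step:
  fixes x p :: complex and \<Psi> :: "complex \<Rightarrow> ennreal"
  assumes x: "Im x > 0" and [measurable]: "\<Psi> \<in> borel_measurable borel"
  shows "ennreal (Im x) * (\<integral>\<^sup>+y. \<Psi> (of_real (Re p) - x * of_real (Re y) + of_real (Im y)) \<partial>lborel) = (\<integral>\<^sup>+y. \<Psi> y \<partial>lborel)"
proof -
  have [measurable]: "(\<lambda>(a, b). \<Psi> (Complex (f a b) (g a b))) \<in> borel_measurable (lborel \<Otimes>\<^sub>M lborel)"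
    if [measurable]: "(\<lambda>(a, b). f a b) \<in> borel_measurable (lborel \<Otimes>\<^sub>M lborel)" "(\<lambda>(a, b). g a b) \<in> borel_measurable (lborel \<Otimes>\<^sub>M lborel)" for f g
    unfolding Complex_eq by measurable
  have [measurable]: "(\<lambda>a. \<Psi> (Complex (f a) b)) \<in> borel_measurable borel"
    if [measurable]: "f \<in> borel_measurable borel" for f b
    unfolding Complex_eq by measurable
  have "(\<integral>\<^sup>+y. \<Psi> (of_real (Re p) - x * of_real (Re y) + of_real (Im y)) \<partial>lborel)
    = (\<integral>\<^sup>+a. \<integral>\<^sup>+b. \<Psi> (Complex (Re p - Re x * a + b) (- Im x * a)) \<partial>lborel \<partial>lborel)"
    by (subst nn_integral_lborel_complex, measurable)
       (auto intro!: nn_integral_cong arg_cong[where f = \<Psi>] simp: complex_eq_iff)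
  also have "\<dots> = (\<integral>\<^sup>+a. \<integral>\<^sup>+b. \<Psi> (Complex b (- Im x * a)) \<partial>lborel \<partial>lborel)"
  proof (rule nn_integral_cong)
    fix a :: real
    show "(\<integral>\<^sup>+b. \<Psi> (Complex (Re p - Re x * a + b) (- Im x * a)) \<partial>lborel) = (\<integral>\<^sup>+b. \<Psi> (Complex b (- Im x * a)) \<partial>lborel)"
      using nn_integral_real_affine[of "\<lambda>b. \<Psi> (Complex b (- Im x * a))" 1 "Re p - Re x * a"] by simp
  qed
  finally have "ennreal (Im x) * (\<integral>\<^sup>+y. \<Psi> (of_real (Re p) - x * of_real (Re y) + of_real (Im y)) \<partial>lborel)
    = (\<integral>\<^sup>+a. \<integral>\<^sup>+b. \<Psi> (Complex b a) \<partial>lborel \<partial>lborel)"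
    using nn_integral_real_affine[of "\<lambda>a. \<integral>\<^sup>+b. \<Psi> (Complex b a) \<partial>lborel" "- Im x" 0] x by simp
  also have "\<dots> = (\<integral>\<^sup>+b. \<integral>\<^sup>+a. \<Psi> (Complex b a) \<partial>lborel \<partial>lborel)"
    by (rule lborel_pair.Fubini'[symmetric]) measurable
  also have "\<dots> = (\<integral>\<^sup>+y. \<Psi> y \<partial>lborel)"
    by (subst nn_integral_lborel_complex) auto
  finally show ?thesis .
qed

text \<open>
  Induction on the dimension. For a fixed last parameter \<open>x\<close>, all coefficients of the new polynomial except
  the top one arise from the old ones by a triangular map of scaling \<open>Im x\<close>. The top one is
  \<open>Re c\<^sub>n\<^sub>-\<^sub>1 - x\<close>, and \<open>Re c\<^sub>n\<^sub>-\<^sub>1\<close> can be recovered as \<open>- Im d\<^sub>n\<^sub>-\<^sub>1 / Im x\<close> from the new coefficients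
  \<open>d\<close>; so after exchanging the integrals \<open>x\<close> can be replaced by the top coefficient.
\<close>

theorem param_poly_change_of_variables:
  fixes \<Phi> :: "complex poly \<Rightarrow> ennreal"
  assumes "(\<lambda>c. \<Phi> (asc_poly n c)) \<in> borel_measurable (CC n)"
  shows "(\<integral>\<^sup>+\<zeta>. (if \<forall>k<n. Im (\<zeta> k) > 0 then \<Phi> (param_poly n \<zeta>) * ennreal (\<Prod>k<n. Im (\<zeta> k) ^ k) else 0) \<partial>CC n)
    = (\<integral>\<^sup>+c. (if roots_upper (asc_poly n c) then \<Phi> (asc_poly n c) else 0) \<partial>CC n)"
  using assms
proof (induction n arbitrary: \<Phi>)
  case 0
  then show ?case by (simp add: CC.nn_integral_empty space_PiM_empty asc_poly_def roots_upper_def)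
next
  case (Suc n)
  have comp[measurable]: "(\<lambda>c. c k) \<in> borel_measurable (CC m)" if "k < m" for k m
    using that by simp
  define G where "G p = (if roots_upper p then \<Phi> p else 0)" for p
  have upm: "Measurable.pred (CC (Suc n)) (\<lambda>c. roots_upper (asc_poly (Suc n) c))"
    by (rule roots_upper_measurable[OF asc_poly_coeff_measurable monic_deg_asc_poly]) simp
  have Gm[measurable]: "(\<lambda>c. G (asc_poly (Suc n) c)) \<in> borel_measurable (CC (Suc n))"
    unfolding G_def using Suc.prems upm by measurable
  define \<tau> where "\<tau> x p y = complex_of_real (Re p) - x * complex_of_real (Re y) + complex_of_real (Im y)" for x p y
  \<comment> \<open>The new coefficient vector: the top entry is recovered from the entry below it.\<close>
  define \<theta> where "\<theta> x d = d(n := of_real (- Im (prev_coeff 0 d n) / Im x) - x)" for x d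
  have step_asc_poly: "jacobi_step x (asc_poly n c) = asc_poly (Suc n) (\<theta> x (triangular_map (\<tau> x) 0 n c))" if x: "Im x > 0" for x c
  proof (rule asc_poly_eqI)
    show "monic_deg (Suc n) (jacobi_step x (asc_poly n c))" by (intro monic_deg_step monic_deg_asc_poly)
    fix k assume k: "k < Suc n"
    show "\<theta> x (triangular_map (\<tau> x) 0 n c) k = coeff (jacobi_step x (asc_poly n c)) k"
    proof (cases "k = n")
      case True
      then show ?thesis
        using x by (cases n) (simp_all add: \<theta>_def coeff_step coeff_asc_poly triangular_map_def \<tau>_def)
    next
      case False
      then have "k < n" using k by simp
      then show ?thesis
        by (cases k) (simp_all add: \<theta>_def coeff_step coeff_asc_poly triangular_map_def \<tau>_def)
    qed
  qed
  have prevm[measurable]: "(\<lambda>d. prev_coeff 0 d n) \<in> borel_measurable (CC n)" by (cases n) auto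
  have \<tau>m[measurable]: "(\<lambda>(p, y). \<tau> x p y) \<in> borel_measurable (borel \<Otimes>\<^sub>M borel)" for x
    unfolding \<tau>_def split_beta' by measurable
  have \<theta>m[measurable]: "\<theta> x \<in> CC n \<rightarrow>\<^sub>M CC (Suc n)" for x
    unfolding \<theta>_def[abs_def] by measurable
  have all_Suc: "(\<forall>k<Suc n. Im ((\<zeta>(n := x)) k) > 0) \<longleftrightarrow> Im x > 0 \<and> (\<forall>k<n. Im (\<zeta> k) > 0)" for \<zeta> x
    by (auto simp: less_Suc_eq)
  have param_poly_upd: "param_poly (Suc n) (\<zeta>(n := x)) = jacobi_step x (param_poly n \<zeta>)" for \<zeta> x
    using param_poly_cong[of n "\<zeta>(n := x)" \<zeta>] by simp
  have prodm: "(\<lambda>\<zeta>. \<Prod>k<m. Im (\<zeta> k) ^ k) \<in> borel_measurable (CC m)" for m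
    by (intro borel_measurable_prod borel_measurable_power measurable_compose[OF comp borel_measurable_Im]) auto
  have fm: "(\<lambda>\<zeta>. \<Phi> (param_poly (Suc n) \<zeta>)) \<in> borel_measurable (CC (Suc n))"
  proof -
    have eq: "param_poly (Suc n) \<zeta> = asc_poly (Suc n) (\<lambda>k\<in>{..<Suc n}. coeff (param_poly (Suc n) \<zeta>) k)" for \<zeta>
      by (rule asc_poly_eqI[OF monic_deg_param_poly]) simp
    have m: "(\<lambda>\<zeta>. \<lambda>k\<in>{..<Suc n}. coeff (param_poly (Suc n) \<zeta>) k) \<in> CC (Suc n) \<rightarrow>\<^sub>M CC (Suc n)"
      by (rule measurable_restrict) (simp del: param_poly.simps add: param_poly_coeff_measurable)
    show ?thesis by (subst eq) (rule measurable_compose[OF m Suc.prems])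
  qed
  have "(\<integral>\<^sup>+\<zeta>. (if \<forall>k<Suc n. Im (\<zeta> k) > 0 then \<Phi> (param_poly (Suc n) \<zeta>) * ennreal (\<Prod>k<Suc n. Im (\<zeta> k) ^ k) else 0) \<partial>CC (Suc n))
    = (\<integral>\<^sup>+x. \<integral>\<^sup>+\<zeta>. (if Im x > 0 then ennreal (Im x) ^ n else 0) *
        (if \<forall>k<n. Im (\<zeta> k) > 0 then \<Phi> (jacobi_step x (param_poly n \<zeta>)) * ennreal (\<Prod>k<n. Im (\<zeta> k) ^ k) else 0) \<partial>CC n \<partial>lborel)"
  proof (subst nn_integral_CC_Suc(2))
    have "Measurable.pred (CC (Suc n)) (\<lambda>\<zeta>. \<forall>k\<in>{..<Suc n}. Im (\<zeta> k) > 0)" by measurable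
    then have [measurable]: "Measurable.pred (CC (Suc n)) (\<lambda>\<zeta>. \<forall>k<Suc n. Im (\<zeta> k) > 0)" by (simp add: Ball_def)
    note [measurable] = fm prodm[of "Suc n"]
    show "(\<lambda>\<zeta>. if \<forall>k<Suc n. Im (\<zeta> k) > 0 then \<Phi> (param_poly (Suc n) \<zeta>) * ennreal (\<Prod>k<Suc n. Im (\<zeta> k) ^ k) else 0)
      \<in> borel_measurable (CC (Suc n))" by measurable
    have *: "(if \<forall>k<Suc n. Im ((\<zeta>(n := x)) k) > 0 then \<Phi> (param_poly (Suc n) (\<zeta>(n := x))) * ennreal (\<Prod>k<Suc n. Im ((\<zeta>(n := x)) k) ^ k) else 0)
      = (if Im x > 0 then ennreal (Im x) ^ n else 0) *
        (if \<forall>k<n. Im (\<zeta> k) > 0 then \<Phi> (jacobi_step x (param_poly n \<zeta>)) * ennreal (\<Prod>k<n. Im (\<zeta> k) ^ k) else 0)" for \<zeta> x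
    proof -
      have "(\<Prod>k<Suc n. Im ((\<zeta>(n := x)) k) ^ k) = (\<Prod>k<n. Im (\<zeta> k) ^ k) * Im x ^ n" by simp
      moreover have "ennreal ((\<Prod>k<n. Im (\<zeta> k) ^ k) * Im x ^ n) = ennreal (\<Prod>k<n. Im (\<zeta> k) ^ k) * ennreal (Im x) ^ n"
        if "Im x > 0" "\<forall>k<n. Im (\<zeta> k) > 0"
        using that by (subst ennreal_mult) (auto intro!: prod_nonneg zero_le_power simp: ennreal_power less_imp_le)
      ultimately show ?thesis unfolding all_Suc param_poly_upd
        by (auto simp: mult_ac)
    qed
    show "(\<integral>\<^sup>+x. \<integral>\<^sup>+\<zeta>. (if \<forall>k<Suc n. Im ((\<zeta>(n := x)) k) > 0 then \<Phi> (param_poly (Suc n) (\<zeta>(n := x))) * ennreal (\<Prod>k<Suc n. Im ((\<zeta>(n := x)) k) ^ k) else 0) \<partial>CC n \<partial>lborel)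
      = (\<integral>\<^sup>+x. \<integral>\<^sup>+\<zeta>. (if Im x > 0 then ennreal (Im x) ^ n else 0) *
        (if \<forall>k<n. Im (\<zeta> k) > 0 then \<Phi> (jacobi_step x (param_poly n \<zeta>)) * ennreal (\<Prod>k<n. Im (\<zeta> k) ^ k) else 0) \<partial>CC n \<partial>lborel)"
      unfolding * ..
  qed
  also have "\<dots> = (\<integral>\<^sup>+x. \<integral>\<^sup>+d. (if Im x > 0 then G (asc_poly (Suc n) (\<theta> x d)) else 0) \<partial>CC n \<partial>lborel)"
  proof (rule nn_integral_cong)
    fix x :: complex
    show "(\<integral>\<^sup>+\<zeta>. (if Im x > 0 then ennreal (Im x) ^ n else 0) *
        (if \<forall>k<n. Im (\<zeta> k) > 0 then \<Phi> (jacobi_step x (param_poly n \<zeta>)) * ennreal (\<Prod>k<n. Im (\<zeta> k) ^ k) else 0) \<partial>CC n)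
      = (\<integral>\<^sup>+d. (if Im x > 0 then G (asc_poly (Suc n) (\<theta> x d)) else 0) \<partial>CC n)"
    proof (cases "Im x > 0")
      case True
      have m1: "(\<lambda>c. \<Phi> (jacobi_step x (asc_poly n c))) \<in> borel_measurable (CC n)"
        unfolding step_asc_poly[OF True] using Suc.prems by measurable
      have m2: "(\<lambda>\<zeta>. if \<forall>k<n. Im (\<zeta> k) > 0 then \<Phi> (jacobi_step x (param_poly n \<zeta>)) * ennreal (\<Prod>k<n. Im (\<zeta> k) ^ k) else 0) \<in> borel_measurable (CC n)"
      proof -
        have "(\<lambda>\<zeta>. \<Phi> (param_poly (Suc n) (\<zeta>(n := x)))) \<in> borel_measurable (CC n)"
          by (rule measurable_compose[OF _ fm]) measurable
        then have [measurable]: "(\<lambda>\<zeta>. \<Phi> (jacobi_step x (param_poly n \<zeta>))) \<in> borel_measurable (CC n)" unfolding param_poly_upd .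
        have "Measurable.pred (CC n) (\<lambda>\<zeta>. \<forall>k\<in>{..<n}. Im (\<zeta> k) > 0)" by measurable
        then have [measurable]: "Measurable.pred (CC n) (\<lambda>\<zeta>. \<forall>k<n. Im (\<zeta> k) > 0)" by (simp add: Ball_def)
        note [measurable] = prodm[of n]
        show ?thesis by measurable
      qed
      have "(\<integral>\<^sup>+\<zeta>. (if Im x > 0 then ennreal (Im x) ^ n else 0) *
          (if \<forall>k<n. Im (\<zeta> k) > 0 then \<Phi> (jacobi_step x (param_poly n \<zeta>)) * ennreal (\<Prod>k<n. Im (\<zeta> k) ^ k) else 0) \<partial>CC n)
        = ennreal (Im x) ^ n * (\<integral>\<^sup>+\<zeta>. (if \<forall>k<n. Im (\<zeta> k) > 0 then \<Phi> (jacobi_step x (param_poly n \<zeta>)) * ennreal (\<Prod>k<n. Im (\<zeta> k) ^ k) else 0) \<partial>CC n)"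
        using True by (subst nn_integral_cmult[OF m2]) simp
      also have "\<dots> = ennreal (Im x) ^ n * (\<integral>\<^sup>+c. (if roots_upper (asc_poly n c) then \<Phi> (jacobi_step x (asc_poly n c)) else 0) \<partial>CC n)"
        by (subst Suc.IH[OF m1]) simp
      also have "\<dots> = ennreal (Im x) ^ n * (\<integral>\<^sup>+c. G (asc_poly (Suc n) (\<theta> x (triangular_map (\<tau> x) 0 n c))) \<partial>CC n)"
        unfolding step_asc_poly[OF True, symmetric] G_def roots_upper_step_iff[OF monic_deg_asc_poly] using True by simp
      also have "\<dots> = (\<integral>\<^sup>+d. G (asc_poly (Suc n) (\<theta> x d)) \<partial>CC n)"
      proof (rule nn_integral_triangular[where \<Psi> = "\<lambda>d. G (asc_poly (Suc n) (\<theta> x d))"])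
        show "ennreal (Im x) * (\<integral>\<^sup>+y. \<Psi> (\<tau> x p y) \<partial>lborel) = (\<integral>\<^sup>+y. \<Psi> y \<partial>lborel)"
          if "\<Psi> \<in> borel_measurable borel" for p \<Psi>
          unfolding \<tau>_def by (rule nn_integral_coeff_step[OF True that])
      qed measurable
      finally show ?thesis using True by simp
    qed simp
  qed
  also have "\<dots> = (\<integral>\<^sup>+d. \<integral>\<^sup>+x. (if Im x > 0 then G (asc_poly (Suc n) (\<theta> x d)) else 0) \<partial>lborel \<partial>CC n)"
  proof (rule pair_sigma_finite.Fubini')
    show "pair_sigma_finite (CC n) (lborel :: complex measure)"
      unfolding pair_sigma_finite_def using CC.sigma_finite[of "{..<n}"] lborel.sigma_finite_measure_axioms by auto
    have [measurable]: "(\<lambda>(d, x). \<theta> x d) \<in> CC n \<Otimes>\<^sub>M lborel \<rightarrow>\<^sub>M CC (Suc n)"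
      unfolding \<theta>_def split_beta' by measurable
    show "(\<lambda>(d, x). if Im x > 0 then G (asc_poly (Suc n) (\<theta> x d)) else 0) \<in> borel_measurable (CC n \<Otimes>\<^sub>M lborel)"
      by measurable
  qed
  also have "\<dots> = (\<integral>\<^sup>+d. \<integral>\<^sup>+y. G (asc_poly (Suc n) (d(n := y))) \<partial>lborel \<partial>CC n)"
  proof (rule nn_integral_cong)
    fix d assume "d \<in> space (CC n)"
    then have [measurable]: "(\<lambda>x. d(n := x)) \<in> borel \<rightarrow>\<^sub>M CC (Suc n)" by measurable
    have "(\<integral>\<^sup>+x. (if Im x > 0 then G (asc_poly (Suc n) (\<theta> x d)) else 0) \<partial>lborel)
      = (\<integral>\<^sup>+y. (if Im y < 0 then G (asc_poly (Suc n) (d(n := y))) else 0) \<partial>lborel)"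
      unfolding \<theta>_def
      by (rule nn_integral_half_plane_shear[where H = "\<lambda>y. G (asc_poly (Suc n) (d(n := y)))"]) measurable
    also have "\<dots> = (\<integral>\<^sup>+y. G (asc_poly (Suc n) (d(n := y))) \<partial>lborel)"
    proof (rule nn_integral_cong)
      fix y
      have "roots_upper (asc_poly (Suc n) (d(n := y))) \<Longrightarrow> Im y < 0"
        using roots_upper_coeff[OF monic_deg_asc_poly, of n "d(n := y)"] by (simp add: coeff_asc_poly)
      then show "(if Im y < 0 then G (asc_poly (Suc n) (d(n := y))) else 0) = G (asc_poly (Suc n) (d(n := y)))"
        by (auto simp: G_def)
    qed
    finally show "(\<integral>\<^sup>+x. (if Im x > 0 then G (asc_poly (Suc n) (\<theta> x d)) else 0) \<partial>lborel)
      = (\<integral>\<^sup>+y. G (asc_poly (Suc n) (d(n := y))) \<partial>lborel)" .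
  qed
  also have "\<dots> = (\<integral>\<^sup>+c. G (asc_poly (Suc n) c) \<partial>CC (Suc n))"
    by (rule nn_integral_CC_Suc(1)[symmetric]) measurable
  finally show ?case unfolding G_def .
qed

section \<open>The density in terms of the Jacobi parameters\<close>

definition conj_prod :: "nat \<Rightarrow> (nat \<Rightarrow> complex) \<Rightarrow> real" where
  "conj_prod n z = (\<Prod>j<n. \<Prod>k<n. cmod (z j - cnj (z k)))"

lemma conj_prod_eq:
  assumes "p = (\<Prod>j<n. [:- z j, 1:])"
  shows "conj_prod n z = (\<Prod>j<n. cmod (poly p (cnj (z j))))"
proof -
  have "cmod (z j - cnj (z k)) = cmod (cnj (z j) - z k)" for j k
    by (metis complex_cnj_cnj complex_cnj_diff complex_mod_cnj)
  then show ?thesis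
    unfolding conj_prod_def assms by (simp add: poly_prod prod_norm)
qed

text \<open>
  Both sides are \<open>\<Prod>\<^sub>j\<^sub>,\<^sub>i |r\<^sub>j - s\<^sub>i|\<close>, the modulus of the resultant.
\<close>

lemma resultant_symmetric:
  assumes "monic_deg n p" "monic_deg m q"
  shows "(\<Prod>j<n. cmod (poly q (root_at p j))) = (\<Prod>i<m. cmod (poly p (root_at q i)))"
proof -
  have "(\<Prod>j<n. cmod (poly q (root_at p j))) = (\<Prod>j<n. \<Prod>i<m. cmod (root_at p j - root_at q i))"
    unfolding poly_monic[OF assms(2)] by (simp add: prod_norm)
  also have "\<dots> = (\<Prod>i<m. \<Prod>j<n. cmod (root_at q i - root_at p j))"
    by (subst prod.swap) (simp add: norm_minus_commute)
  also have "\<dots> = (\<Prod>i<m. cmod (poly p (root_at q i)))"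
    unfolding poly_monic[OF assms(1)] by (simp add: prod_norm)
  finally show ?thesis .
qed

text \<open>
  Write \<open>f = (x - \<zeta>) Q + T\<close> and \<open>g = Q + i T\<close>. Conjugating the coefficients of \<open>f\<close> adds \<open>2 i Im \<zeta> Q\<close>, and those
  of \<open>g\<close> turn into \<open>2 Q - g\<close>. So both products are, up to explicit factors, resultants with \<open>Q\<close>, and at the
  roots of \<open>Q\<close> both \<open>f\<close> and \<open>g\<close> have the modulus of \<open>T\<close>.
\<close>

lemma conj_prod_step:
  assumes g: "monic_deg n g"
  shows "conj_prod (Suc n) (root_at (jacobi_step \<zeta> g)) = 2 * \<bar>Im \<zeta>\<bar> ^ Suc n * conj_prod n (root_at g)"
proof -
  let ?f = "jacobi_step \<zeta> g" and ?Q = "re_poly g" and ?T = "im_poly g"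
  have f: "monic_deg (Suc n) ?f" by (rule monic_deg_step[OF g])
  have Q: "monic_deg n ?Q" by (rule monic_deg_re_poly[OF g])
  have fv: "poly ?f x = (x - \<zeta>) * poly ?Q x + poly ?T x" for x
    by (simp add: jacobi_step_def algebra_simps)
  have roots: "poly p (root_at p j) = 0" if "monic_deg m p" "j < m" for p m j
    using that(2) by (auto simp: poly_monic[OF that(1)])
  have "conj_prod (Suc n) (root_at ?f) = (\<Prod>j<Suc n. cmod (poly ?f (cnj (root_at ?f j))))"
    by (rule conj_prod_eq[OF monic_eq_prod[OF f]])
  also have "\<dots> = (\<Prod>j<Suc n. 2 * \<bar>Im \<zeta>\<bar> * cmod (poly ?Q (root_at ?f j)))"
  proof (rule prod.cong[OF refl])
    fix j assume "j \<in> {..<Suc n}"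
    then have "poly ?f (root_at ?f j) = 0" using roots[OF f] by simp
    then have T: "poly ?T (root_at ?f j) = - (root_at ?f j - \<zeta>) * poly ?Q (root_at ?f j)"
      unfolding fv by (simp only: add_eq_0_iff mult_minus_left)
    have "poly ?f (cnj (root_at ?f j)) = cnj ((root_at ?f j - cnj \<zeta>) * poly ?Q (root_at ?f j) + poly ?T (root_at ?f j))"
      unfolding fv poly_re_im_cnj by simp
    also have "(root_at ?f j - cnj \<zeta>) * poly ?Q (root_at ?f j) + poly ?T (root_at ?f j) = (\<zeta> - cnj \<zeta>) * poly ?Q (root_at ?f j)"
      unfolding T by (simp add: algebra_simps)
    also have "cmod (cnj ((\<zeta> - cnj \<zeta>) * poly ?Q (root_at ?f j))) = 2 * \<bar>Im \<zeta>\<bar> * cmod (poly ?Q (root_at ?f j))"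
      by (simp add: norm_mult complex_diff_cnj del: complex_cnj_mult)
    finally show "cmod (poly ?f (cnj (root_at ?f j))) = 2 * \<bar>Im \<zeta>\<bar> * cmod (poly ?Q (root_at ?f j))" .
  qed
  also have "\<dots> = (2 * \<bar>Im \<zeta>\<bar>) ^ Suc n * (\<Prod>j<Suc n. cmod (poly ?Q (root_at ?f j)))"
    by (simp only: prod.distrib prod_constant card_lessThan power_mult_distrib)
  also have "(\<Prod>j<Suc n. cmod (poly ?Q (root_at ?f j))) = (\<Prod>i<n. cmod (poly ?f (root_at ?Q i)))"
    by (rule resultant_symmetric[OF f Q])
  also have "\<dots> = (\<Prod>i<n. cmod (poly ?T (root_at ?Q i)))"
    using roots[OF Q] by (intro prod.cong) (simp_all add: fv)
  finally have 1: "conj_prod (Suc n) (root_at ?f) = (2 * \<bar>Im \<zeta>\<bar>) ^ Suc n * (\<Prod>i<n. cmod (poly ?T (root_at ?Q i)))" .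
  have "conj_prod n (root_at g) = (\<Prod>j<n. cmod (poly g (cnj (root_at g j))))"
    by (rule conj_prod_eq[OF monic_eq_prod[OF g]])
  also have "\<dots> = (\<Prod>j<n. 2 * cmod (poly ?Q (root_at g j)))"
  proof (rule prod.cong[OF refl])
    fix j assume "j \<in> {..<n}"
    then have "poly g (root_at g j) = 0" using roots[OF g] by simp
    then have T: "\<i> * poly ?T (root_at g j) = - poly ?Q (root_at g j)"
      unfolding poly_g[of g "root_at g j"] by (simp add: eq_neg_iff_add_eq_0 add.commute)
    have "poly g (cnj (root_at g j)) = cnj (poly ?Q (root_at g j) - \<i> * poly ?T (root_at g j))"
      unfolding poly_g[of g "cnj (root_at g j)"] poly_re_im_cnj by simp
    also have "\<dots> = cnj (2 * poly ?Q (root_at g j))" unfolding T by simp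
    finally show "cmod (poly g (cnj (root_at g j))) = 2 * cmod (poly ?Q (root_at g j))" by (simp add: norm_mult)
  qed
  also have "\<dots> = 2 ^ n * (\<Prod>j<n. cmod (poly ?Q (root_at g j)))"
    by (simp only: prod.distrib prod_constant card_lessThan)
  also have "(\<Prod>j<n. cmod (poly ?Q (root_at g j))) = (\<Prod>i<n. cmod (poly g (root_at ?Q i)))"
    by (rule resultant_symmetric[OF g Q])
  also have "\<dots> = (\<Prod>i<n. cmod (poly ?T (root_at ?Q i)))"
  proof (rule prod.cong[OF refl])
    fix i assume "i \<in> {..<n}"
    then have "poly g (root_at ?Q i) = \<i> * poly ?T (root_at ?Q i)"
      using roots[OF Q] by (simp add: poly_g[of g "root_at ?Q i"])
    then show "cmod (poly g (root_at ?Q i)) = cmod (poly ?T (root_at ?Q i))" by (simp add: norm_mult)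
  qed
  finally show ?thesis unfolding 1 by (simp add: power_mult_distrib)
qed

lemma conj_prod_param_poly:
  assumes "\<forall>k<n. Im (\<zeta> k) > 0"
  shows "conj_prod n (root_at (param_poly n \<zeta>)) = 2 ^ n * (\<Prod>k<n. Im (\<zeta> k) ^ Suc k)"
  using assms
proof (induction n)
  case (Suc n)
  have "\<bar>Im (\<zeta> n)\<bar> = Im (\<zeta> n)" using Suc.prems[rule_format, of n] by simp
  then show ?case using Suc by (simp add: conj_prod_step[OF monic_deg_param_poly])
qed (simp add: conj_prod_def)

lemma coeff_step_Im: "monic_deg n g \<Longrightarrow> Im (coeff (jacobi_step \<zeta> g) n) = - Im \<zeta>"
  by (cases n) (simp_all add: coeff_step monic_deg_coeff)

lemma coeff_param_poly_Im: "Im (coeff (param_poly (Suc n) \<zeta>) n) = - Im (\<zeta> n)"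
  by (simp add: coeff_step_Im[OF monic_deg_param_poly])

lemma sum_Im_roots_param_poly:
  assumes "param_poly (Suc n) \<zeta> = (\<Prod>j<Suc n. [:- z j, 1:])"
  shows "(\<Sum>j<Suc n. Im (z j)) = Im (\<zeta> n)"
  using coeff_param_poly_Im[of n \<zeta>] unfolding assms coeff_prod_linear_1 by simp

text \<open>
  In terms of the elementary symmetric functions this is \<open>(Re e\<^sub>1)\<^sup>2 / 2 - Re e\<^sub>2\<close>, and for the
  characteristic polynomial of \<open>J + i l I\<^sub>1\<^sub>1\<close> it equals half the trace of \<open>J\<^sup>2\<close>.
\<close>

definition energy :: "nat \<Rightarrow> complex poly \<Rightarrow> real" where
  "energy n p = (case n of 0 \<Rightarrow> 0 | Suc m \<Rightarrow> (Re (coeff p m))\<^sup>2 / 2 - (case m of 0 \<Rightarrow> 0 | Suc j \<Rightarrow> Re (coeff p j)))"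

lemma energy_param_poly:
  "energy (Suc n) (param_poly (Suc n) \<zeta>) = (\<Sum>k<Suc n. (Re (\<zeta> k))\<^sup>2 / 2) + (\<Sum>k<n. Im (\<zeta> k))"
proof (induction n)
  case 0
  then show ?case by (simp add: energy_def coeff_step)
next
  case (Suc n)
  let ?g = "param_poly (Suc n) \<zeta>"
  have g: "monic_deg (Suc n) ?g" by (rule monic_deg_param_poly)
  have top: "coeff (jacobi_step (\<zeta> (Suc n)) ?g) (Suc n) = Re (coeff ?g n) - \<zeta> (Suc n)"
    unfolding coeff_step using monic_deg_coeff(1)[OF g] by simp
  have "energy (Suc (Suc n)) (param_poly (Suc (Suc n)) \<zeta>)
    = (Re (coeff ?g n) - Re (\<zeta> (Suc n)))\<^sup>2 / 2 - Re (coeff (jacobi_step (\<zeta> (Suc n)) ?g) n)"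
    by (simp add: energy_def top del: param_poly.simps) (simp add: top del: param_poly.simps add: param_poly.simps(2)[of "Suc n"])
  also have "Re (coeff (jacobi_step (\<zeta> (Suc n)) ?g) n)
    = (case n of 0 \<Rightarrow> 0 | Suc j \<Rightarrow> Re (coeff ?g j)) - Re (\<zeta> (Suc n)) * Re (coeff ?g n) + Im (coeff ?g n)"
    by (cases n) (simp_all add: coeff_step del: param_poly.simps)
  also have "Im (coeff ?g n) = - Im (\<zeta> n)" by (rule coeff_param_poly_Im)
  finally have "energy (Suc (Suc n)) (param_poly (Suc (Suc n)) \<zeta>) = energy (Suc n) ?g + (Re (\<zeta> (Suc n)))\<^sup>2 / 2 + Im (\<zeta> n)"
    by (simp add: energy_def power2_eq_square algebra_simps diff_divide_distrib add_divide_distrib del: param_poly.simps)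
  then show ?case unfolding Suc by simp
qed

lemma energy_roots:
  assumes "p = (\<Prod>j<Suc n. [:- z j, 1:])"
  shows "energy (Suc n) p = (\<Sum>j<Suc n. (Re (z j))\<^sup>2) / 2 + (\<Sum>k<Suc n. \<Sum>j<k. Im (z j) * Im (z k))"
proof -
  have sq: "(\<Sum>j<m. Re (z j))\<^sup>2 = (\<Sum>j<m. (Re (z j))\<^sup>2) + 2 * (\<Sum>k<m. \<Sum>j<k. Re (z j) * Re (z k))" for m
    by (induction m) (simp_all add: power2_sum sum_distrib_left sum_distrib_right mult_ac)
  have 1: "Re (coeff p n) = - (\<Sum>j<Suc n. Re (z j))"
    unfolding assms coeff_prod_linear_1 by simp
  have 2: "(case n of 0 \<Rightarrow> 0 | Suc j \<Rightarrow> Re (coeff p j)) = (\<Sum>k<Suc n. \<Sum>j<k. Re (z j) * Re (z k) - Im (z j) * Im (z k))"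
  proof (cases n)
    case (Suc m)
    then have "coeff p m = (\<Sum>k<Suc n. \<Sum>j<k. z j * z k)"
      unfolding assms by (simp only: coeff_prod_linear_2)
    then show ?thesis by (simp add: Suc)
  qed simp
  show ?thesis
    unfolding energy_def nat.case 1 2 power2_minus sq by (simp add: sum_subtractf field_simps)
qed

text \<open>
  By \<open>\<Gamma>(1 + x) = x \<Gamma>(x)\<close>, the products of gamma values collapse to the normalizing constants of the
  parameter densities times \<open>n!\<close>.
\<close>

lemma h_const_eq:
  assumes "\<beta> > 0"
  shows "h_const \<beta> (Suc n) = 2 powr (real (Suc n) * (\<beta> / 2 - 1)) * (2 * pi) powr (real (Suc n) / 2)
    * fact (Suc n) * (\<Prod>k<n. Gamma (\<beta> * real (Suc k) / 2))"
proof -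
  let ?G = "\<lambda>j::nat. Gamma (\<beta> * real j / 2)"
  have pos: "\<beta> * real j / 2 > 0" if "j > 0" for j using that assms by simp
  then have Gpos: "?G j > 0" if "j > 0" for j using that by (simp add: Gamma_real_pos)
  have g1: "Gamma (1 + \<beta> * real j / 2) = (\<beta> / 2) * real j * ?G j" if "j > 0" for j
  proof -
    have "\<beta> * real j / 2 \<notin> \<int>\<^sub>\<le>\<^sub>0" using pos[OF that] by (metis nonpos_Ints_nonpos not_le)
    from Gamma_plus1[OF this] show ?thesis by (simp add: add.commute)
  qed
  have "(\<Prod>j=1..Suc n. Gamma (1 + \<beta> * real j / 2) / Gamma (1 + \<beta> / 2))
    = (\<Prod>j=1..Suc n. real j * ?G j / ?G 1)"
  proof (rule prod.cong[OF refl])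
    fix j assume "j \<in> {1..Suc n}"
    then have "Gamma (1 + \<beta> * real j / 2) = (\<beta> / 2) * real j * ?G j" by (intro g1) auto
    moreover have "Gamma (1 + \<beta> / 2) = \<beta> / 2 * ?G 1" using g1[of 1] by simp
    ultimately have "Gamma (1 + \<beta> * real j / 2) / Gamma (1 + \<beta> / 2) = (\<beta> / 2) * real j * ?G j / (\<beta> / 2 * ?G 1)"
      by (simp only:)
    then show "Gamma (1 + \<beta> * real j / 2) / Gamma (1 + \<beta> / 2) = real j * ?G j / ?G 1"
      using assms by simp
  qed
  also have "\<dots> = (\<Prod>j=1..Suc n. real j) * (\<Prod>j=1..Suc n. ?G j) / ?G 1 ^ Suc n"
    by (simp add: prod.distrib prod_dividef)
  also have "(\<Prod>j=1..Suc n. real j) = fact (Suc n)" by (simp only: fact_prod of_nat_prod)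
  also have "(\<Prod>j=1..Suc n. ?G j) = (\<Prod>k<n. ?G (Suc k)) * ?G (Suc n)"
    by (simp only: One_nat_def prod.atLeast1_atMost_eq prod.lessThan_Suc)
  finally have key: "(\<Prod>j=1..Suc n. Gamma (1 + \<beta> * real j / 2) / Gamma (1 + \<beta> / 2))
    = fact (Suc n) * ((\<Prod>k<n. ?G (Suc k)) * ?G (Suc n)) / ?G 1 ^ Suc n" .
  have c: "c_const \<beta> (Suc n) = ?G 1 ^ Suc n / ?G (Suc n)" unfolding c_const_def by simp
  have cancel: "x * (A * B) / C * (C / B) = x * A" if "B > 0" "C > 0" for x A B C :: real
    using that by simp
  have "(\<Prod>j=1..Suc n. Gamma (1 + \<beta> * real j / 2) / Gamma (1 + \<beta> / 2)) * c_const \<beta> (Suc n)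
    = fact (Suc n) * (\<Prod>k<n. ?G (Suc k))"
    unfolding key c by (rule cancel) (use Gpos[of 1] Gpos[of "Suc n"] in \<open>auto simp del: power_Suc of_nat_Suc\<close>)
  then show ?thesis unfolding h_const_def g_const_def by (simp only: mult.assoc)
qed

text \<open>
  The density of the parameter with index \<open>k\<close>: all have a normal real part; the last one
  carries the perturbation \<open>l\<close>, the others the squares of the off-diagonal entries.
\<close>

definition param_density :: "real \<Rightarrow> nat \<Rightarrow> (real \<Rightarrow> real) \<Rightarrow> nat \<Rightarrow> complex \<Rightarrow> real" where
  "param_density \<beta> n F k \<zeta> = (if Im \<zeta> > 0 then std_normal_density (Re \<zeta>) *
     (if Suc k = n then F (Im \<zeta>)
      else Im \<zeta> powr (\<beta> * real (Suc k) / 2 - 1) * exp (- Im \<zeta>) / Gamma (\<beta> * real (Suc k) / 2)) else 0)"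

lemma prod_std_normal_density:
  "(\<Prod>k<n. std_normal_density (x k)) = exp (- (\<Sum>k<n. (x k)\<^sup>2 / 2)) / (2 * pi) powr (real n / 2)"
proof -
  have "(\<Prod>k<n. std_normal_density (x k)) = (\<Prod>k<n. exp (- ((x k)\<^sup>2 / 2))) / sqrt (2 * pi) ^ n"
    by (simp add: std_normal_density_def prod_dividef prod.distrib divide_simps)
  also have "sqrt (2 * pi) ^ n = (2 * pi) powr (real n / 2)"
    by (simp add: powr_half_sqrt[symmetric] powr_realpow[symmetric] powr_powr)
  also have "(\<Prod>k<n. exp (- ((x k)\<^sup>2 / 2))) = exp (- (\<Sum>k<n. (x k)\<^sup>2 / 2))"
    by (subst sum_negf[symmetric], subst exp_sum) auto
  finally show ?thesis .
qed

text \<open>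
  The eigenvalue density without its factor \<open>\<Prod> |z\<^sub>j - z\<^sub>k|\<^sup>2\<close>, which is the Jacobian of the map to the
  coefficients.
\<close>

definition eigenvalue_weight :: "real \<Rightarrow> nat \<Rightarrow> (real \<Rightarrow> real) \<Rightarrow> (nat \<Rightarrow> complex) \<Rightarrow> real" where
  "eigenvalue_weight \<beta> n F z =
     (if \<forall>j<n. 0 < Im (z j) then
        (let l = (\<Sum>j<n. Im (z j)) in
          1 / h_const \<beta> n
          * exp (- (1 / 2) * (\<Sum>j<n. (Re (z j))\<^sup>2) - (\<Sum>k<n. \<Sum>j<k. Im (z j) * Im (z k)))
          * (\<Prod>j<n. \<Prod>k<n. cmod (z j - cnj (z k)) powr (\<beta> / 2 - 1))
          * (F l / l powr (\<beta> * real n / 2 - 1)))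
      else 0)"

lemma eigenvalue_density_eq: "eigenvalue_density \<beta> n F z = eigenvalue_weight \<beta> n F z * vandermonde_sq n z"
proof (cases "\<forall>j<n. 0 < Im (z j)")
  case True
  show ?thesis
    unfolding eigenvalue_density_def eigenvalue_weight_def vandermonde_sq_def Let_def if_P[OF True]
    by (simp only: mult_ac)
next
  case False
  show ?thesis unfolding eigenvalue_density_def eigenvalue_weight_def if_not_P[OF False] by simp
qed

text \<open>
  The three invariants express the sum of the imaginary parts, the exponent and the product over all pairs
  in terms of the parameters; the powers of \<open>Im \<zeta>\<^sub>k\<close> add up by \<open>(k + 1) (\<beta>/2 - 1) + k = \<beta> (k + 1) / 2 - 1\<close>.
\<close>

lemma eigenvalue_weight_eq:
  assumes \<beta>: "\<beta> > 0" and z: "param_poly (Suc n) \<zeta> = (\<Prod>j<Suc n. [:- z j, 1:])"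
    and up: "\<forall>k<Suc n. Im (\<zeta> k) > 0"
    and cp: "conj_prod (Suc n) z = 2 ^ Suc n * (\<Prod>k<Suc n. Im (\<zeta> k) ^ Suc k)"
    and zup: "\<forall>j<Suc n. Im (z j) > 0"
  shows "eigenvalue_weight \<beta> (Suc n) F z * fact (Suc n) * (\<Prod>k<Suc n. Im (\<zeta> k) ^ k)
    = (\<Prod>k<Suc n. param_density \<beta> (Suc n) F k (\<zeta> k))"
proof -
  let ?l = "Im (\<zeta> n)" and ?h = "\<beta> / 2 - 1"
  let ?G = "\<Prod>k<n. Gamma (\<beta> * real (Suc k) / 2)"
  have lpos: "?l > 0" using up by simp
  have l: "(\<Sum>j<Suc n. Im (z j)) = ?l" by (rule sum_Im_roots_param_poly[OF z])
  have E: "- (1 / 2) * (\<Sum>j<Suc n. (Re (z j))\<^sup>2) - (\<Sum>k<Suc n. \<Sum>j<k. Im (z j) * Im (z k))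
    = - (\<Sum>k<Suc n. (Re (\<zeta> k))\<^sup>2 / 2) - (\<Sum>k<n. Im (\<zeta> k))"
    using energy_param_poly[of n \<zeta>] energy_roots[OF z] by simp
  have C: "(\<Prod>j<Suc n. \<Prod>k<Suc n. cmod (z j - cnj (z k)) powr ?h)
    = 2 powr (real (Suc n) * ?h) * (\<Prod>k<Suc n. Im (\<zeta> k) powr (real (Suc k) * ?h))"
  proof -
    have "(\<Prod>j<Suc n. \<Prod>k<Suc n. cmod (z j - cnj (z k)) powr ?h) = conj_prod (Suc n) z powr ?h"
      unfolding conj_prod_def by (simp only: prod_powr_distrib prod_nonneg norm_ge_zero)
    also have "\<dots> = 2 powr (real (Suc n) * ?h) * (\<Prod>k<Suc n. (Im (\<zeta> k) ^ Suc k) powr ?h)"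
    proof -
      have "(\<Prod>k<Suc n. Im (\<zeta> k) ^ Suc k) powr ?h = (\<Prod>k<Suc n. (Im (\<zeta> k) ^ Suc k) powr ?h)"
        by (rule prod_powr_distrib)
      moreover have "(2 ^ Suc n :: real) powr ?h = 2 powr (real (Suc n) * ?h)"
        by (subst powr_realpow[symmetric]) (simp_all only: powr_powr)
      moreover have "(\<Prod>k<Suc n. Im (\<zeta> k) ^ Suc k) \<ge> 0"
        using up by (intro prod_nonneg) (auto intro!: mult_nonneg_nonneg less_imp_le)
      ultimately show ?thesis unfolding cp by (simp only: powr_mult) 
    qed
    also have "(\<Prod>k<Suc n. (Im (\<zeta> k) ^ Suc k) powr ?h) = (\<Prod>k<Suc n. Im (\<zeta> k) powr (real (Suc k) * ?h))"
    proof (rule prod.cong[OF refl])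
      fix k assume "k \<in> {..<Suc n}"
      then have "Im (\<zeta> k) > 0" using up by simp
      then show "(Im (\<zeta> k) ^ Suc k) powr ?h = Im (\<zeta> k) powr (real (Suc k) * ?h)"
        by (subst powr_realpow[symmetric]) (simp_all only: powr_powr)
    qed
    finally show ?thesis .
  qed
  have P: "(\<Prod>k<Suc n. Im (\<zeta> k) powr (real (Suc k) * ?h)) * (\<Prod>k<Suc n. Im (\<zeta> k) ^ k)
    = (\<Prod>k<n. Im (\<zeta> k) powr (\<beta> * real (Suc k) / 2 - 1)) * ?l powr (\<beta> * real (Suc n) / 2 - 1)"
  proof -
    have "(\<Prod>k<Suc n. Im (\<zeta> k) powr (real (Suc k) * ?h)) * (\<Prod>k<Suc n. Im (\<zeta> k) ^ k)
      = (\<Prod>k<Suc n. Im (\<zeta> k) powr (\<beta> * real (Suc k) / 2 - 1))"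
      unfolding prod.distrib[symmetric]
    proof (rule prod.cong[OF refl])
      fix k assume "k \<in> {..<Suc n}"
      then have "Im (\<zeta> k) > 0" using up by simp
      then have "Im (\<zeta> k) powr (real (Suc k) * ?h) * Im (\<zeta> k) ^ k = Im (\<zeta> k) powr (real (Suc k) * ?h + real k)"
        by (simp add: powr_add powr_realpow)
      also have "real (Suc k) * ?h + real k = \<beta> * real (Suc k) / 2 - 1" by (simp add: field_simps)
      finally show "Im (\<zeta> k) powr (real (Suc k) * ?h) * Im (\<zeta> k) ^ k = Im (\<zeta> k) powr (\<beta> * real (Suc k) / 2 - 1)" .
    qed
    then show ?thesis by simp
  qed
  have D: "(\<Prod>k<Suc n. param_density \<beta> (Suc n) F k (\<zeta> k))
    = exp (- (\<Sum>k<Suc n. (Re (\<zeta> k))\<^sup>2 / 2)) / (2 * pi) powr (real (Suc n) / 2)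
      * ((\<Prod>k<n. Im (\<zeta> k) powr (\<beta> * real (Suc k) / 2 - 1)) * exp (- (\<Sum>k<n. Im (\<zeta> k))) / ?G * F ?l)"
  proof -
    have "(\<Prod>k<Suc n. param_density \<beta> (Suc n) F k (\<zeta> k))
      = (\<Prod>k<Suc n. std_normal_density (Re (\<zeta> k)) *
         (if k = n then F ?l else Im (\<zeta> k) powr (\<beta> * real (Suc k) / 2 - 1) * exp (- Im (\<zeta> k)) / Gamma (\<beta> * real (Suc k) / 2)))"
      using up by (intro prod.cong) (auto simp: param_density_def)
    also have "\<dots> = (\<Prod>k<Suc n. std_normal_density (Re (\<zeta> k))) *
       ((\<Prod>k<n. Im (\<zeta> k) powr (\<beta> * real (Suc k) / 2 - 1) * exp (- Im (\<zeta> k)) / Gamma (\<beta> * real (Suc k) / 2)) * F ?l)"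
      by (subst prod.distrib) (simp cong: prod.cong_simp)
    also have "(\<Prod>k<n. Im (\<zeta> k) powr (\<beta> * real (Suc k) / 2 - 1) * exp (- Im (\<zeta> k)) / Gamma (\<beta> * real (Suc k) / 2))
      = (\<Prod>k<n. Im (\<zeta> k) powr (\<beta> * real (Suc k) / 2 - 1)) * exp (- (\<Sum>k<n. Im (\<zeta> k))) / ?G"
      by (simp add: prod_dividef prod.distrib exp_sum sum_negf flip: sum_negf)
    finally show ?thesis unfolding prod_std_normal_density .
  qed
  have "?G > 0" using \<beta> by (intro prod_pos Gamma_real_pos) auto
  then have nzG: "?G \<noteq> 0" by linarith
  have nz: "(2::real) powr (real (Suc n) * ?h) \<noteq> 0" "(2 * pi) powr (real (Suc n) / 2) \<noteq> 0"
     "?l powr (\<beta> * real (Suc n) / 2 - 1) \<noteq> 0" "(fact (Suc n) :: real) \<noteq> 0"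
    using lpos by auto
  have ed: "eigenvalue_weight \<beta> (Suc n) F z = 1 / h_const \<beta> (Suc n)
     * exp (- (\<Sum>k<Suc n. (Re (\<zeta> k))\<^sup>2 / 2) - (\<Sum>k<n. Im (\<zeta> k)))
     * (2 powr (real (Suc n) * ?h) * (\<Prod>k<Suc n. Im (\<zeta> k) powr (real (Suc k) * ?h)))
     * (F ?l / ?l powr (\<beta> * real (Suc n) / 2 - 1))"
    unfolding eigenvalue_weight_def Let_def l E C using zup by simp
  have "eigenvalue_weight \<beta> (Suc n) F z * fact (Suc n) * (\<Prod>k<Suc n. Im (\<zeta> k) ^ k)
    = (fact (Suc n) * 2 powr (real (Suc n) * ?h) / h_const \<beta> (Suc n))
     * exp (- (\<Sum>k<Suc n. (Re (\<zeta> k))\<^sup>2 / 2) - (\<Sum>k<n. Im (\<zeta> k)))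
     * ((\<Prod>k<Suc n. Im (\<zeta> k) powr (real (Suc k) * ?h)) * (\<Prod>k<Suc n. Im (\<zeta> k) ^ k))
     * (F ?l / ?l powr (\<beta> * real (Suc n) / 2 - 1))"
    unfolding ed by (simp only: times_divide_eq_left times_divide_eq_right mult_1_left mult_ac)
  also have "\<dots> = (1 / ((2 * pi) powr (real (Suc n) / 2) * ?G))
     * exp (- (\<Sum>k<Suc n. (Re (\<zeta> k))\<^sup>2 / 2) - (\<Sum>k<n. Im (\<zeta> k)))
     * (\<Prod>k<n. Im (\<zeta> k) powr (\<beta> * real (Suc k) / 2 - 1)) * F ?l"
    unfolding P h_const_eq[OF \<beta>] using nz nzG by (simp add: field_simps del: fact_Suc of_nat_Suc prod.lessThan_Suc sum.lessThan_Suc)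
  also have "\<dots> = (\<Prod>k<Suc n. param_density \<beta> (Suc n) F k (\<zeta> k))"
    unfolding D exp_diff exp_minus using nz nzG
    by (simp add: field_simps del: fact_Suc of_nat_Suc prod.lessThan_Suc sum.lessThan_Suc)
  finally show ?thesis .
qed

section \<open>The characteristic polynomial of a perturbed Jacobi matrix\<close>

definition tridiag :: "nat \<Rightarrow> (nat \<Rightarrow> 'a) \<Rightarrow> (nat \<Rightarrow> 'a) \<Rightarrow> 'a::comm_ring_1 mat" where
  "tridiag n d u = mat n n (\<lambda>(i, j). if i = j then d i else if j = Suc i then u i else if i = Suc j then u j else 0)"

lemma tridiag_carrier [simp]: "tridiag n d u \<in> carrier_mat n n"
  by (simp add: tridiag_def)

lemma det_tridiag_1: "det (tridiag (Suc 0) d u) = d 0"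
  using det_single[of "tridiag (Suc 0) d u"] tridiag_carrier[of "Suc 0" d u] by (simp add: tridiag_def)

text \<open>
  Expansion along the first row, and then along the first column in the second minor.
\<close>

lemma det_tridiag_rec:
  "det (tridiag (Suc (Suc n)) d u) = d 0 * det (tridiag (Suc n) (\<lambda>i. d (Suc i)) (\<lambda>i. u (Suc i)))
     - (u 0)\<^sup>2 * det (tridiag n (\<lambda>i. d (Suc (Suc i))) (\<lambda>i. u (Suc (Suc i))))"
proof -
  let ?A = "tridiag (Suc (Suc n)) d u"
  let ?B = "mat_delete ?A 0 (Suc 0)"
  have A00: "mat_delete ?A 0 0 = tridiag (Suc n) (\<lambda>i. d (Suc i)) (\<lambda>i. u (Suc i))"
    by (rule eq_matI) (auto simp: mat_delete_def tridiag_def)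
  have B: "?B \<in> carrier_mat (Suc n) (Suc n)" by (simp add: mat_delete_def tridiag_def)
  have B00: "mat_delete ?B 0 0 = tridiag n (\<lambda>i. d (Suc (Suc i))) (\<lambda>i. u (Suc (Suc i)))"
    by (rule eq_matI) (auto simp: mat_delete_def tridiag_def)
  have "det ?B = (\<Sum>i<Suc n. ?B $$ (i, 0) * cofactor ?B i 0)"
    by (rule laplace_expansion_column[OF B]) simp
  also have "\<dots> = (\<Sum>i\<in>{0}. ?B $$ (i, 0) * cofactor ?B i 0)"
    by (rule sum.mono_neutral_right) (auto simp: mat_delete_def tridiag_def)
  also have "\<dots> = u 0 * det (tridiag n (\<lambda>i. d (Suc (Suc i))) (\<lambda>i. u (Suc (Suc i))))"
    by (simp add: cofactor_def B00) (simp add: mat_delete_def tridiag_def)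
  finally have detB: "det ?B = u 0 * det (tridiag n (\<lambda>i. d (Suc (Suc i))) (\<lambda>i. u (Suc (Suc i))))" .
  have "det ?A = (\<Sum>j<Suc (Suc n). ?A $$ (0, j) * cofactor ?A 0 j)"
    by (rule laplace_expansion_row[OF tridiag_carrier]) simp
  also have "\<dots> = (\<Sum>j\<in>{0, 1}. ?A $$ (0, j) * cofactor ?A 0 j)"
    by (rule sum.mono_neutral_right) (auto simp: tridiag_def)
  also have "\<dots> = d 0 * det (tridiag (Suc n) (\<lambda>i. d (Suc i)) (\<lambda>i. u (Suc i))) - u 0 * det ?B"
    using A00 by (simp add: cofactor_def) (simp add: tridiag_def)
  finally show ?thesis unfolding detB by (simp add: power2_eq_square mult.assoc)
qed

lemma det_tridiag_first:
  "det (tridiag (Suc n) (\<lambda>i. if i = 0 then d 0 + e else d i) u)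
    = det (tridiag (Suc n) d u) + e * det (tridiag n (\<lambda>i. d (Suc i)) (\<lambda>i. u (Suc i)))"
proof (cases n)
  case 0
  then show ?thesis by (simp add: det_tridiag_1)
next
  case (Suc m)
  show ?thesis unfolding Suc det_tridiag_rec by (simp add: algebra_simps)
qed

definition jacobi_poly :: "nat \<Rightarrow> (nat \<Rightarrow> real) \<Rightarrow> (nat \<Rightarrow> real) \<Rightarrow> complex poly" where
  "jacobi_poly n a b = det (tridiag n (\<lambda>i. [:- complex_of_real (b i), 1:]) (\<lambda>i. [:- complex_of_real (a i):]))"

lemma jacobi_poly_rec:
  "jacobi_poly (Suc (Suc n)) a b = [:- complex_of_real (b 0), 1:] * jacobi_poly (Suc n) (\<lambda>i. a (Suc i)) (\<lambda>i. b (Suc i))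
    - [:complex_of_real ((a 0)\<^sup>2):] * jacobi_poly n (\<lambda>i. a (Suc (Suc i))) (\<lambda>i. b (Suc (Suc i)))"
  unfolding jacobi_poly_def det_tridiag_rec by (simp add: power2_eq_square)

lemma jacobi_poly_real: "Im (coeff (jacobi_poly n a b) k) = 0"
proof (induction n arbitrary: a b k rule: induct_nat_012)
  case 0
  have "jacobi_poly 0 a b = 1" unfolding jacobi_poly_def by (rule det_dim_zero) simp
  then show ?case by (cases k) auto
next
  case 1
  have "jacobi_poly (Suc 0) a b = [:- complex_of_real (b 0), 1:]" unfolding jacobi_poly_def by (rule det_tridiag_1)
  then show ?case by (auto simp: coeff_pCons split: nat.splits)
next
  case (ge2 n)
  then show ?case unfolding jacobi_poly_rec by (cases k) auto
qed

text \<open>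
  The index \<open>k\<close> counts the dimension at which the parameter enters the recursion, so it runs against the
  order of the matrix entries.
\<close>

definition jacobi_param :: "nat \<Rightarrow> (nat \<Rightarrow> real) \<Rightarrow> (nat \<Rightarrow> real) \<Rightarrow> real \<Rightarrow> nat \<Rightarrow> complex" where
  "jacobi_param n a b l k = Complex (b (n - k)) (if Suc k = n then l else (a (n - Suc k))\<^sup>2)"

text \<open>
  Induction on the dimension. By the induction hypothesis, applied with the perturbation \<open>(a 0)\<^sup>2\<close>, the real and
  imaginary parts of the previous polynomial are the two real minors in the three-term recurrence.
\<close>

lemma det_tridiag_eq_param_poly:
  "det (tridiag (Suc n) (\<lambda>i. [:- complex_of_real (b i), 1:] + (if i = 0 then [:- \<i> * l:] else 0)) (\<lambda>i. [:- complex_of_real (a i):]))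
    = param_poly (Suc n) (\<lambda>k. Complex (b (n - k)) (if k = n then l else (a (n - Suc k))\<^sup>2))"
proof (induction n arbitrary: a b l)
  case 0
  show ?case by (rule poly_eqI) (simp add: det_tridiag_1 coeff_step complex_eq_iff coeff_pCons split: nat.splits)
next
  case (Suc n)
  let ?a = "\<lambda>i. a (Suc i)" and ?b = "\<lambda>i. b (Suc i)"
  let ?a2 = "\<lambda>i. a (Suc (Suc i))" and ?b2 = "\<lambda>i. b (Suc (Suc i))"
  let ?\<zeta> = "\<lambda>k. Complex (b (Suc n - k)) (if k = Suc n then l else (a (Suc n - Suc k))\<^sup>2)"
  define g where "g = param_poly (Suc n) ?\<zeta>"
  have "g = param_poly (Suc n) (\<lambda>k. Complex (?b (n - k)) (if k = n then (a 0)\<^sup>2 else (?a (n - Suc k))\<^sup>2))"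
    unfolding g_def by (rule param_poly_cong) (auto simp: Suc_diff_le less_Suc_eq Suc_diff_Suc)
  also have "\<dots> = det (tridiag (Suc n) (\<lambda>i. if i = 0 then [:- complex_of_real (?b 0), 1:] + [:- \<i> * (a 0)\<^sup>2:] else [:- complex_of_real (?b i), 1:]) (\<lambda>i. [:- complex_of_real (?a i):]))"
  proof -
    have "(\<lambda>i. [:- complex_of_real (?b i), 1:] + (if i = 0 then [:- \<i> * complex_of_real ((a 0)\<^sup>2):] else 0))
      = (\<lambda>i. if i = 0 then [:- complex_of_real (?b 0), 1:] + [:- \<i> * (a 0)\<^sup>2:] else [:- complex_of_real (?b i), 1:])"
      by (auto simp: fun_eq_iff)
    then show ?thesis using Suc.IH[of ?b "(a 0)\<^sup>2" ?a] by (simp only:)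
  qed
  also have "\<dots> = jacobi_poly (Suc n) ?a ?b + [:- \<i> * (a 0)\<^sup>2:] * jacobi_poly n ?a2 ?b2"
    unfolding jacobi_poly_def by (rule det_tridiag_first)
  finally have g: "g = jacobi_poly (Suc n) ?a ?b + [:- \<i> * (a 0)\<^sup>2:] * jacobi_poly n ?a2 ?b2" .
  have re: "re_poly g = jacobi_poly (Suc n) ?a ?b" and im: "im_poly g = [:- complex_of_real ((a 0)\<^sup>2):] * jacobi_poly n ?a2 ?b2"
    unfolding g by (auto intro!: poly_eqI simp: complex_eq_iff jacobi_poly_real)
  have "det (tridiag (Suc (Suc n)) (\<lambda>i. [:- complex_of_real (b i), 1:] + (if i = 0 then [:- \<i> * l:] else 0)) (\<lambda>i. [:- complex_of_real (a i):]))
    = [:- ?\<zeta> (Suc n), 1:] * jacobi_poly (Suc n) ?a ?b - [:complex_of_real ((a 0)\<^sup>2):] * jacobi_poly n ?a2 ?b2"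
    unfolding det_tridiag_rec jacobi_poly_def by (simp add: power2_eq_square Complex_eq algebra_simps)
  also have "\<dots> = jacobi_step (?\<zeta> (Suc n)) g" unfolding jacobi_step_def re im by simp
  finally show ?case unfolding g_def by (simp only: param_poly.simps)
qed

lemma char_poly_perturbed_jacobi:
  assumes "n > 0"
  shows "char_poly (map_mat complex_of_real (jacobi_matrix n a b) + (\<i> * complex_of_real l) \<cdot>\<^sub>m I11 n)
    = param_poly n (jacobi_param n a b l)"
proof -
  obtain m where n: "n = Suc m" using assms by (cases n) auto
  let ?A = "map_mat complex_of_real (jacobi_matrix n a b) + (\<i> * complex_of_real l) \<cdot>\<^sub>m I11 n"
  have "char_poly_matrix ?A = tridiag n (\<lambda>i. [:- complex_of_real (b (Suc i)), 1:] + (if i = 0 then [:- \<i> * l:] else 0)) (\<lambda>i. [:- complex_of_real (a (Suc i)):])"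
    by (rule eq_matI) (auto simp: char_poly_matrix_def jacobi_matrix_def I11_def tridiag_def one_pCons)
  then have "char_poly ?A = param_poly n (\<lambda>k. Complex (b (Suc (m - k))) (if k = m then l else (a (Suc (m - Suc k)))\<^sup>2))"
    unfolding char_poly_def n by (simp only: det_tridiag_eq_param_poly)
  also have "\<dots> = param_poly n (jacobi_param n a b l)"
    by (rule param_poly_cong) (auto simp: jacobi_param_def n Suc_diff_le less_Suc_eq Suc_diff_Suc)
  finally show ?thesis .
qed

section \<open>Changes of variable for the parameter densities\<close>

text \<open>
  The substitution rule for intervals, exhausted by \<open>[0, m]\<close>.
\<close>

lemma nn_integral_square_substitution:
  fixes f :: "real \<Rightarrow> ennreal"
  assumes [measurable]: "f \<in> borel_measurable borel"
  shows "(\<integral>\<^sup>+y. f (y\<^sup>2) * ennreal (2 * y) * indicator {0<..} y \<partial>lborel) = (\<integral>\<^sup>+t. f t * indicator {0<..} t \<partial>lborel)"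
proof -
  have sub: "(\<integral>\<^sup>+t. f t * indicator {0..(real (Suc m))\<^sup>2} t \<partial>lborel)
      = (\<integral>\<^sup>+y. f (y\<^sup>2) * ennreal (2 * y) * indicator {0..real (Suc m)} y \<partial>lborel)" for m
  proof -
    have "((\<lambda>y. y\<^sup>2) has_real_derivative 2 * x) (at x)" for x :: real
      by (auto intro!: derivative_eq_intros)
    moreover have "continuous_on {0..real (Suc m)} (\<lambda>y. 2 * y)" by (intro continuous_intros)
    ultimately show ?thesis
      using nn_integral_substitution_aux[of f 0 "real (Suc m)" "\<lambda>y. y\<^sup>2" "\<lambda>y. 2 * y"]
      by (simp del: of_nat_Suc)
  qed
  have lim: "(SUP m. (\<integral>\<^sup>+t. g t * indicator {0..h m} t \<partial>lborel)) = (\<integral>\<^sup>+t. g t * indicator {0<..} t \<partial>lborel)"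
    if [measurable]: "g \<in> borel_measurable borel" and h: "mono h" "\<And>t. \<exists>m. t \<le> h m" for g :: "real \<Rightarrow> ennreal" and h :: "nat \<Rightarrow> real"
  proof -
    have "(SUP m. (\<integral>\<^sup>+t. g t * indicator {0..h m} t \<partial>lborel)) = (\<integral>\<^sup>+t. (SUP m. g t * indicator {0..h m} t) \<partial>lborel)"
    proof (rule nn_integral_monotone_convergence_SUP[symmetric])
      show "incseq (\<lambda>m t. g t * indicator {0..h m} t)"
        using h(1) by (auto simp: incseq_def le_fun_def mono_def split: split_indicator intro: order_trans)
    qed measurable
    also have "\<dots> = (\<integral>\<^sup>+t. g t * indicator {0<..} t \<partial>lborel)"
    proof (rule nn_integral_cong_AE)
      have "AE t in lborel. t \<noteq> (0::real)" by (rule AE_lborel_singleton)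
      then show "AE t in lborel. (SUP m. g t * indicator {0..h m} t) = g t * indicator {0<..} t"
      proof eventually_elim
        case (elim t)
        show ?case
        proof (cases "t > 0")
          case True
          obtain m where m: "t \<le> h m" using h(2) by auto
          show ?thesis
          proof (rule antisym)
            show "(SUP m. g t * indicator {0..h m} t) \<le> g t * indicator {0<..} t"
              using True by (intro SUP_least) (auto split: split_indicator)
            have "g t * indicator {0<..} t \<le> g t * indicator {0..h m} t" using m True by simp
            also have "\<dots> \<le> (SUP m. g t * indicator {0..h m} t)" by (rule SUP_upper) simp
            finally show "g t * indicator {0<..} t \<le> (SUP m. g t * indicator {0..h m} t)" .
          qed
        next
          case False
          then show ?thesis using elim by simp
        qed
      qed
    qed
    finally show ?thesis .
  qed
  have ex1: "\<exists>m. t \<le> real (Suc m)" for t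
  proof -
    obtain m where "t \<le> real m" using real_arch_simple by blast
    then show ?thesis by (intro exI[of _ m]) simp
  qed
  have ex2: "\<exists>m. t \<le> (real (Suc m))\<^sup>2" for t
  proof -
    obtain m where m: "t \<le> real (Suc m)" using ex1 by blast
    have "real (Suc m) \<le> (real (Suc m))\<^sup>2" by (rule self_le_power) auto
    then show ?thesis using m by (meson order_trans)
  qed
  have "(\<integral>\<^sup>+y. f (y\<^sup>2) * ennreal (2 * y) * indicator {0<..} y \<partial>lborel)
    = (SUP m. (\<integral>\<^sup>+y. f (y\<^sup>2) * ennreal (2 * y) * indicator {0..real (Suc m)} y \<partial>lborel))"
    by (rule lim[symmetric]) (auto simp: mono_def ex1 simp del: of_nat_Suc)
  also have "\<dots> = (SUP m. (\<integral>\<^sup>+t. f t * indicator {0..(real (Suc m))\<^sup>2} t \<partial>lborel))"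
    unfolding sub ..
  also have "\<dots> = (\<integral>\<^sup>+t. f t * indicator {0<..} t \<partial>lborel)"
    by (rule lim) (auto simp: mono_def ex2 power_mono simp del: of_nat_Suc)
  finally show ?thesis .
qed

text \<open>
  The square of a variable with law \<open>\<chi>\<close>-tilde of parameter \<open>\<kappa>\<close> has the gamma distribution with shape \<open>\<kappa> / 2\<close>.
\<close>

lemma chi_tilde_square:
  fixes g :: "real \<Rightarrow> ennreal"
  assumes [measurable]: "g \<in> borel_measurable borel" and \<kappa>: "\<kappa> > 0"
  shows "(\<integral>\<^sup>+y. g (y\<^sup>2) * ennreal (chi_tilde_density \<kappa> y) \<partial>lborel)
    = (\<integral>\<^sup>+t. g t * ennreal (if t > 0 then t powr (\<kappa> / 2 - 1) * exp (- t) / Gamma (\<kappa> / 2) else 0) \<partial>lborel)"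
proof -
  let ?q = "\<lambda>t. ennreal (t powr (\<kappa> / 2 - 1) * exp (- t) / Gamma (\<kappa> / 2))"
  have G: "Gamma (\<kappa> / 2) > 0" using \<kappa> by (simp add: Gamma_real_pos)
  have "(\<integral>\<^sup>+y. g (y\<^sup>2) * ennreal (chi_tilde_density \<kappa> y) \<partial>lborel)
    = (\<integral>\<^sup>+y. (g (y\<^sup>2) * ?q (y\<^sup>2)) * ennreal (2 * y) * indicator {0<..} y \<partial>lborel)"
  proof (rule nn_integral_cong)
    fix y :: real
    show "g (y\<^sup>2) * ennreal (chi_tilde_density \<kappa> y) = g (y\<^sup>2) * ?q (y\<^sup>2) * ennreal (2 * y) * indicator {0<..} y"
    proof (cases "y > 0")
      case True
      have "chi_tilde_density \<kappa> y = (y\<^sup>2) powr (\<kappa> / 2 - 1) * exp (- y\<^sup>2) / Gamma (\<kappa> / 2) * (2 * y)"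
      proof -
        have "(y\<^sup>2) powr (\<kappa> / 2 - 1) * y = y powr (\<kappa> - 2) * y powr 1"
        proof -
          have "(y powr 2) powr (\<kappa> / 2 - 1) = y powr (2 * (\<kappa> / 2 - 1))" by (rule powr_powr)
          then show ?thesis using True by simp
        qed
        also have "\<dots> = y powr (\<kappa> - 1)" by (subst powr_add[symmetric]) simp
        finally show ?thesis using True by (simp add: chi_tilde_density_def field_simps)
      qed
      then show ?thesis using True G by (simp add: ennreal_mult[symmetric] mult.assoc)
    qed (simp add: chi_tilde_density_def)
  qed
  also have "\<dots> = (\<integral>\<^sup>+t. g t * ?q t * indicator {0<..} t \<partial>lborel)"
    by (rule nn_integral_square_substitution) measurable
  also have "\<dots> = (\<integral>\<^sup>+t. g t * ennreal (if t > 0 then t powr (\<kappa> / 2 - 1) * exp (- t) / Gamma (\<kappa> / 2) else 0) \<partial>lborel)"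
    by (intro nn_integral_cong) auto
  finally show ?thesis .
qed

text \<open>
  The variable \<open>h (Y)\<close> has density \<open>q\<close>; this is supplied as a substitution rule, since the imaginary part is
  either \<open>Y\<close> itself or its square.
\<close>

lemma (in prob_space) distr_complex_of_indep:
  fixes X Y :: "'a \<Rightarrow> real"
  assumes ind: "indep_var borel X borel Y"
    and X: "distributed M lborel X (\<lambda>x. ennreal (p x))" and Y: "distributed M lborel Y (\<lambda>y. q' y)"
    and h[measurable]: "h \<in> borel_measurable borel" and q[measurable]: "q \<in> borel_measurable borel"
    and sub: "\<And>g. g \<in> borel_measurable borel \<Longrightarrow> (\<integral>\<^sup>+y. g (h y) * q' y \<partial>lborel) = (\<integral>\<^sup>+t. g t * ennreal (q t) \<partial>lborel)"
    and p[measurable]: "p \<in> borel_measurable borel" and pos: "\<And>x. 0 \<le> p x" "\<And>t. 0 \<le> q t"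
  shows "distr M lborel (\<lambda>\<omega>. Complex (X \<omega>) (h (Y \<omega>))) = density lborel (\<lambda>z. ennreal (p (Re z) * q (Im z)))"
proof (rule measure_eqI)
  have [measurable]: "random_variable borel X" "random_variable borel Y"
    using distributed_measurable[OF X] distributed_measurable[OF Y] by auto
  have [measurable]: "q' \<in> borel_measurable borel" using distributed_borel_measurable[OF Y] by simp
  have ind': "indep_var lborel X lborel Y" using ind by (simp add: indep_var_eq)
  have J: "distributed M (lborel \<Otimes>\<^sub>M lborel) (\<lambda>x. (X x, Y x)) (\<lambda>(x, y). ennreal (p x) * q' y)"
    by (rule distributed_joint_indep[OF _ _ X Y ind']) (simp_all add: lborel.sigma_finite_measure_axioms)
  fix A assume "A \<in> sets (distr M lborel (\<lambda>\<omega>. Complex (X \<omega>) (h (Y \<omega>))))"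
  then have A[measurable]: "A \<in> sets borel" by simp
  have cm[measurable]: "(\<lambda>(x, y). Complex x (h y)) \<in> borel_measurable (lborel \<Otimes>\<^sub>M lborel)" "(\<lambda>\<omega>. Complex (X \<omega>) (h (Y \<omega>))) \<in> borel_measurable M"
    "\<And>x. (\<lambda>y. Complex x y) \<in> borel_measurable borel"
    unfolding Complex_eq by measurable
  have im[measurable]: "(\<lambda>(x, y). indicator A (Complex x (h y)) :: ennreal) \<in> borel_measurable (lborel \<Otimes>\<^sub>M lborel)"
    using measurable_compose[OF cm(1) borel_measurable_indicator[OF A]] by (simp add: split_beta')
  have "emeasure (distr M lborel (\<lambda>\<omega>. Complex (X \<omega>) (h (Y \<omega>)))) A = (\<integral>\<^sup>+\<omega>. indicator A (Complex (X \<omega>) (h (Y \<omega>))) \<partial>M)"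
    by (subst nn_integral_indicator[symmetric], simp, subst nn_integral_distr) auto
  also have "\<dots> = (\<integral>\<^sup>+(x, y). ennreal (p x) * q' y * indicator A (Complex x (h y)) \<partial>(lborel \<Otimes>\<^sub>M lborel))"
    using distributed_nn_integral[OF J im] by (simp add: split_beta')
  also have "\<dots> = (\<integral>\<^sup>+x. \<integral>\<^sup>+y. ennreal (p x) * q' y * indicator A (Complex x (h y)) \<partial>lborel \<partial>lborel)"
  proof -
    have "(\<lambda>(x, y). ennreal (p x) * q' y * indicator A (Complex x (h y))) \<in> borel_measurable (lborel \<Otimes>\<^sub>M lborel)"
      using im by (simp add: split_beta') measurable
    then show ?thesis by (subst lborel.nn_integral_fst[symmetric]) auto
  qed
  also have "\<dots> = (\<integral>\<^sup>+x. \<integral>\<^sup>+t. ennreal (p x) * ennreal (q t) * indicator A (Complex x t) \<partial>lborel \<partial>lborel)"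
  proof (rule nn_integral_cong)
    fix x :: real
    have [measurable]: "(\<lambda>y. indicator A (Complex x y) :: ennreal) \<in> borel_measurable borel"
      by (rule measurable_compose[OF cm(3) borel_measurable_indicator[OF A]])
    show "(\<integral>\<^sup>+y. ennreal (p x) * q' y * indicator A (Complex x (h y)) \<partial>lborel)
      = (\<integral>\<^sup>+t. ennreal (p x) * ennreal (q t) * indicator A (Complex x t) \<partial>lborel)"
      using sub[of "\<lambda>y. ennreal (p x) * indicator A (Complex x y)"] by (simp add: mult_ac)
  qed
  also have "\<dots> = (\<integral>\<^sup>+z. ennreal (p (Re z) * q (Im z)) * indicator A z \<partial>lborel)"
    by (subst nn_integral_lborel_complex) (auto intro!: nn_integral_cong simp: ennreal_mult pos)
  also have "\<dots> = emeasure (density lborel (\<lambda>z. ennreal (p (Re z) * q (Im z)))) A"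
    by (rule emeasure_density[symmetric]) auto
  finally show "emeasure (distr M lborel (\<lambda>\<omega>. Complex (X \<omega>) (h (Y \<omega>)))) A
    = emeasure (density lborel (\<lambda>z. ennreal (p (Re z) * q (Im z)))) A" .
qed simp

lemma PiM_density:
  fixes d :: "nat \<Rightarrow> complex \<Rightarrow> ennreal"
  assumes d[measurable]: "\<And>k. k < n \<Longrightarrow> d k \<in> borel_measurable borel"
    and sf: "\<And>k. k < n \<Longrightarrow> sigma_finite_measure (density lborel (d k))"
  shows "(\<Pi>\<^sub>M k\<in>{..<n}. density lborel (d k)) = density (CC n) (\<lambda>z. \<Prod>k<n. d k (z k))"
proof -
  define N where "N k = (if k < n then density lborel (d k) else (lborel :: complex measure))" for k
  have "sigma_finite_measure (N k)" for k
    using sf by (simp add: N_def lborel.sigma_finite_measure_axioms)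
  then interpret N: product_sigma_finite N by (rule product_sigma_finite.intro)
  have setsN: "sets (N k) = sets lborel" for k by (simp add: N_def)
  have "density (CC n) (\<lambda>z. \<Prod>k<n. d k (z k)) = Pi\<^sub>M {..<n} N"
  proof (rule N.PiM_eqI)
    show "sets (density (CC n) (\<lambda>z. \<Prod>k<n. d k (z k))) = sets (Pi\<^sub>M {..<n} N)"
      by (simp add: setsN cong: sets_PiM_cong)
    fix A assume "\<And>i. i \<in> {..<n} \<Longrightarrow> A i \<in> sets (N i)"
    then have A[measurable]: "\<And>i. i \<in> {..<n} \<Longrightarrow> A i \<in> sets borel" by (simp add: setsN)
    have m: "(\<lambda>z. d k (z k)) \<in> borel_measurable (CC n)" if "k < n" for k
    proof -
      have "d k \<in> borel_measurable lborel" using d[OF that] by simp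
      then show ?thesis
        using that by (intro measurable_compose[OF measurable_component_singleton[of k "{..<n}" "\<lambda>_. lborel"]]) auto
    qed
    have "emeasure (density (CC n) (\<lambda>z. \<Prod>k<n. d k (z k))) (Pi\<^sub>E {..<n} A)
      = (\<integral>\<^sup>+z. (\<Prod>k<n. d k (z k)) * indicator (Pi\<^sub>E {..<n} A) z \<partial>CC n)"
      by (rule emeasure_density) (auto intro!: borel_measurable_prod_ennreal m sets_PiM_I_finite A)
    also have "\<dots> = (\<integral>\<^sup>+z. (\<Prod>k<n. d k (z k) * indicator (A k) (z k)) \<partial>CC n)"
    proof (rule nn_integral_cong)
      fix z assume "z \<in> space (CC n)"
      then have "z \<in> extensional {..<n}" by (simp add: space_PiM PiE_def)
      then have "(indicator (Pi\<^sub>E {..<n} A) z :: ennreal) = (\<Prod>k<n. indicator (A k) (z k))"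
        by (auto simp: indicator_def PiE_def Pi_def prod_zero_iff)
      then show "(\<Prod>k<n. d k (z k)) * indicator (Pi\<^sub>E {..<n} A) z = (\<Prod>k<n. d k (z k) * indicator (A k) (z k))"
        by (simp add: prod.distrib)
    qed
    also have "\<dots> = (\<Prod>k<n. \<integral>\<^sup>+z. d k z * indicator (A k) z \<partial>lborel)"
      by (rule CC.product_nn_integral_prod[of "{..<n}" "\<lambda>k z. d k z * indicator (A k) z"]) (use d A in auto)
    also have "\<dots> = (\<Prod>k<n. emeasure (N k) (A k))"
      by (intro prod.cong refl) (use A in \<open>auto simp: N_def emeasure_density\<close>)
    finally show "emeasure (density (CC n) (\<lambda>z. \<Prod>k<n. d k (z k))) (Pi\<^sub>E {..<n} A) = (\<Prod>k<n. emeasure (N k) (A k))" .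
  qed auto
  also have "\<dots> = (\<Pi>\<^sub>M k\<in>{..<n}. density lborel (d k))"
    by (rule PiM_cong) (auto simp: N_def)
  finally show ?thesis ..
qed

section \<open>The joint law of the Jacobi parameters\<close>

text \<open>
  The family \<open>X\<close> is a function of \<open>V\<close>, and \<open>l\<close> is independent of \<open>V\<close>; so the probability of an intersection
  splits first into the part from \<open>X\<close> and the part from \<open>l\<close>. The value \<open>None\<close> is the index of \<open>l\<close>.
\<close>

lemma (in prob_space) indep_vars_adjoin_indep_rv:
  fixes X :: "'i \<Rightarrow> 'a \<Rightarrow> real" and V :: "'a \<Rightarrow> 'b" and l :: "'a \<Rightarrow> real"
  assumes X: "indep_vars (\<lambda>_. borel) X I" and I: "finite I" "I \<noteq> {}"
    and Vl: "indep_rv M S V borel l"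
    and XV: "\<And>i. i \<in> I \<Longrightarrow> \<exists>f\<in>borel_measurable S. \<forall>\<omega>\<in>space M. X i \<omega> = f (V \<omega>)"
  shows "indep_vars (\<lambda>_. borel) (\<lambda>i. case i of None \<Rightarrow> l | Some s \<Rightarrow> X s) (insert None (Some ` I))"
proof -
  let ?Y = "\<lambda>i. case i of None \<Rightarrow> l | Some s \<Rightarrow> X s"
  let ?E = "\<lambda>i. {?Y i -` A \<inter> space M | A. A \<in> sets (borel :: real measure)}"
  have V[measurable]: "V \<in> M \<rightarrow>\<^sub>M S" and l[measurable]: "l \<in> borel_measurable M"
    and ind: "indep_set (sets (vimage_algebra (space M) V S)) (sets (vimage_algebra (space M) l borel))"
    using Vl unfolding indep_rv_def by auto
  have Xm: "X i \<in> borel_measurable M" if "i \<in> I" for i using X that unfolding indep_vars_def2 by auto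
  have rv: "?Y i \<in> borel_measurable M" if "i \<in> insert None (Some ` I)" for i
    using that Xm by auto
  have X_in: "X i -` A \<inter> space M \<in> sets (vimage_algebra (space M) V S)" if i: "i \<in> I" and A: "A \<in> sets borel" for i A
  proof -
    obtain f where f: "f \<in> borel_measurable S" "\<forall>\<omega>\<in>space M. X i \<omega> = f (V \<omega>)" using XV[OF i] by blast
    have "V \<in> space M \<rightarrow> space S" using measurable_space[OF V] by auto
    have "X i -` A \<inter> space M = V -` (f -` A \<inter> space S) \<inter> space M"
      using f(2) measurable_space[OF V] by auto
    also have "\<dots> \<in> sets (vimage_algebra (space M) V S)"
      by (rule in_vimage_algebra) (rule measurable_sets[OF f(1) A])
    finally show ?thesis .
  qed
  have "indep_sets ?E (insert None (Some ` I))"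
  proof (subst indep_sets_finite)
    show "?E i \<subseteq> events" if "i \<in> insert None (Some ` I)" for i
      using rv[OF that] by (auto intro: measurable_sets)
    show "space M \<in> ?E i" for i by (auto intro!: exI[of _ UNIV])
    show "\<forall>A\<in>Pi (insert None (Some ` I)) ?E. prob (\<Inter>j\<in>insert None (Some ` I). A j) = (\<Prod>j\<in>insert None (Some ` I). prob (A j))"
    proof
      fix A assume A: "A \<in> Pi (insert None (Some ` I)) ?E"
      have A0: "A None \<in> sets (vimage_algebra (space M) l borel)"
        using Pi_mem[OF A, of None] by (auto intro: in_vimage_algebra)
      have AS: "A (Some i) \<in> {X i -` B \<inter> space M | B. B \<in> sets borel}" if "i \<in> I" for i
        using Pi_mem[OF A, of "Some i"] that by auto
      have "A (Some i) \<in> sets (vimage_algebra (space M) V S)" if "i \<in> I" for i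
        using AS[OF that] X_in[OF that] by auto
      then have AI: "(\<Inter>i\<in>I. A (Some i)) \<in> sets (vimage_algebra (space M) V S)"
        using I by (intro sets.finite_INT) auto
      have "(\<Inter>j\<in>insert None (Some ` I). A j) = (\<Inter>i\<in>I. A (Some i)) \<inter> A None" by auto
      then have "prob (\<Inter>j\<in>insert None (Some ` I). A j) = prob (\<Inter>i\<in>I. A (Some i)) * prob (A None)"
        using indep_setD[OF ind AI A0] by simp
      also have "prob (\<Inter>i\<in>I. A (Some i)) = (\<Prod>i\<in>I. prob (A (Some i)))"
        using X I AS unfolding indep_vars_def2 by (intro indep_setsD) auto
      also have "(\<Prod>i\<in>I. prob (A (Some i))) * prob (A None) = (\<Prod>j\<in>insert None (Some ` I). prob (A j))"
        using I by (subst prod.insert) (auto simp: prod.reindex mult.commute)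
      finally show "prob (\<Inter>j\<in>insert None (Some ` I). A j) = (\<Prod>j\<in>insert None (Some ` I). prob (A j))" .
    qed
  qed (use I in auto)
  then show ?thesis unfolding indep_vars_def2 using rv by auto
qed

lemma (in prob_space) indep_var_of_indep_vars:
  assumes X: "indep_vars M' X I" and ij: "i \<in> I" "j \<in> I" "i \<noteq> j"
  shows "indep_var (M' i) (X i) (M' j) (X j)"
proof -
  let ?E = "\<lambda>i. {X i -` A \<inter> space M | A. A \<in> sets (M' i)}"
  have ind: "indep_sets ?E I" and rv: "\<And>i. i \<in> I \<Longrightarrow> random_variable (M' i) (X i)"
    using X unfolding indep_vars_def2 by auto
  have "indep_set (?E i) (?E j)"
  proof (rule indep_setI)
    show "?E i \<subseteq> events" "?E j \<subseteq> events"
      using rv ij by (auto intro: measurable_sets)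
    fix A B assume AB: "A \<in> ?E i" "B \<in> ?E j"
    have "prob (\<Inter>k\<in>{i, j}. if k = i then A else B) = (\<Prod>k\<in>{i, j}. prob (if k = i then A else B))"
      by (rule indep_setsD[OF ind]) (use ij AB in auto)
    then show "prob (A \<inter> B) = prob A * prob B" using ij by (simp add: Int_commute)
  qed
  moreover have "case_bool (?E i) (?E j) = (\<lambda>k. {case_bool (X i) (X j) k -` A \<inter> space M | A. A \<in> sets (case_bool (M' i) (M' j) k)})"
    by (auto simp: fun_eq_iff split: bool.split)
  ultimately show ?thesis
    unfolding indep_var_def indep_vars_def2 indep_set_def using rv ij by (auto split: bool.split)
qed

lemma distributed_density_measurable:
  assumes "\<And>x. 0 < x \<Longrightarrow> 0 \<le> F x"
    and "distributed M lborel l (\<lambda>x. ennreal (if 0 < x then F x else (0::real)))"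
  shows "(\<lambda>x. if 0 < x then F x else 0) \<in> borel_measurable borel"
proof -
  have "(\<lambda>x. ennreal (if 0 < x then F x else 0)) \<in> borel_measurable borel"
    using distributed_borel_measurable[OF assms(2)] by simp
  then have "(\<lambda>x. enn2real (ennreal (if 0 < x then F x else 0))) \<in> borel_measurable borel" by measurable
  also have "(\<lambda>x. enn2real (ennreal (if 0 < x then F x else 0))) = (\<lambda>x. if 0 < x then F x else 0)"
    using assms(1) by (auto simp: fun_eq_iff)
  finally show ?thesis .
qed

text \<open>
  The entries \<open>a\<close> and \<open>b\<close> can be read off from \<open>J\<close>, so that they and \<open>l\<close> form one independent family. Each
  parameter uses two members of it, and different parameters use disjoint pairs.
\<close>

lemma jacobi_param_law:
  fixes J :: "'w \<Rightarrow> real mat"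
  assumes "prob_space M" and n: "0 < n" and \<beta>: "0 < \<beta>"
    and J: "gaussian_beta_ensemble M \<beta> n J"
    and F: "\<And>x. 0 < x \<Longrightarrow> 0 \<le> F x"
    and l: "distributed M lborel l (\<lambda>x. ennreal (if 0 < x then F x else 0))"
    and ind: "indep_rv M (\<Pi>\<^sub>M p\<in>{..<n} \<times> {..<n}. borel) (\<lambda>\<omega>. \<lambda>p\<in>{..<n} \<times> {..<n}. J \<omega> $$ p) borel l"
  obtains a b :: "nat \<Rightarrow> 'w \<Rightarrow> real"
  where "\<And>\<omega>. \<omega> \<in> space M \<Longrightarrow> J \<omega> = jacobi_matrix n (\<lambda>j. a j \<omega>) (\<lambda>j. b j \<omega>)"
    and "(\<lambda>\<omega>. \<lambda>k\<in>{..<n}. jacobi_param n (\<lambda>j. a j \<omega>) (\<lambda>j. b j \<omega>) (l \<omega>) k) \<in> M \<rightarrow>\<^sub>M CC n"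
    and "distr M (CC n) (\<lambda>\<omega>. \<lambda>k\<in>{..<n}. jacobi_param n (\<lambda>j. a j \<omega>) (\<lambda>j. b j \<omega>) (l \<omega>) k)
      = density (CC n) (\<lambda>z. \<Prod>k<n. ennreal (param_density \<beta> n F k (z k)))"
proof -
  interpret prob_space M by fact
  obtain a b :: "nat \<Rightarrow> 'w \<Rightarrow> real"
    where Jab: "\<And>\<omega>. \<omega> \<in> space M \<Longrightarrow> J \<omega> = jacobi_matrix n (\<lambda>j. a j \<omega>) (\<lambda>j. b j \<omega>)"
    and iv: "indep_vars (\<lambda>_. borel) (case_sum a b) ({1..<n} <+> {1..n})"
    and da: "\<And>j. j \<in> {1..<n} \<Longrightarrow> distributed M lborel (a j) (\<lambda>x. ennreal (chi_tilde_density (\<beta> * real (n - j)) x))"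
    and db: "\<And>j. j \<in> {1..n} \<Longrightarrow> distributed M lborel (b j) (\<lambda>x. ennreal (std_normal_density x))"
    using J unfolding gaussian_beta_ensemble_def by blast
  let ?I = "{1..<n} <+> {1..n}"
  let ?V = "\<lambda>\<omega>. \<lambda>p\<in>{..<n} \<times> {..<n}. J \<omega> $$ p"
  define Y where "Y i = (case i of None \<Rightarrow> l | Some s \<Rightarrow> case_sum a b s)" for i
  have Y: "indep_vars (\<lambda>_. borel) Y (insert None (Some ` ?I))"
    unfolding Y_def[abs_def]
  proof (rule indep_vars_adjoin_indep_rv[OF iv _ _ ind])
    show "finite ?I" by (intro finite_Plus) auto
    have "Inr 1 \<in> ?I" using n by (intro InrI) simp
    then show "?I \<noteq> {}" by blast
    fix s assume s: "s \<in> ?I"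
    have coord: "\<exists>f\<in>borel_measurable (\<Pi>\<^sub>M p\<in>{..<n} \<times> {..<n}. borel). \<forall>\<omega>\<in>space M. X \<omega> = f (?V \<omega>)"
      if p: "p \<in> {..<n} \<times> {..<n}" and X: "\<And>\<omega>. \<omega> \<in> space M \<Longrightarrow> X \<omega> = J \<omega> $$ p" for p and X :: "'w \<Rightarrow> real"
      by (intro bexI[of _ "\<lambda>v. v p"] ballI) (use p X in auto)
    show "\<exists>f\<in>borel_measurable (\<Pi>\<^sub>M p\<in>{..<n} \<times> {..<n}. borel). \<forall>\<omega>\<in>space M. case_sum a b s \<omega> = f (?V \<omega>)"
    proof (cases s)
      case (Inl j)
      then have "1 \<le> j" "j < n" using s by auto
      then show ?thesis unfolding Inl
        by (intro coord[of "(j - 1, j)"]) (auto simp: Jab jacobi_matrix_def)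
    next
      case (Inr j)
      then have "1 \<le> j" "j \<le> n" using s by auto
      then show ?thesis unfolding Inr
        by (intro coord[of "(j - 1, j - 1)"]) (auto simp: Jab jacobi_matrix_def)
    qed
  qed
  \<comment> \<open>The indices of the variables behind the imaginary and the real part of the parameter \<open>k\<close>.\<close>
  define R where "R k = (if Suc k = n then None else Some (Inl (n - Suc k)) :: (nat + nat) option)" for k
  define B where "B k = (Some (Inr (n - k)) :: (nat + nat) option)" for k
  define h where "h k = (if Suc k = n then (\<lambda>t. t) else (\<lambda>t. t\<^sup>2) :: real \<Rightarrow> real)" for k
  define Z where "Z k \<omega> = Complex (Y (B k) \<omega>) (h k (Y (R k) \<omega>))" for k \<omega>
  have Z: "Z k \<omega> = jacobi_param n (\<lambda>j. a j \<omega>) (\<lambda>j. b j \<omega>) (l \<omega>) k" for k \<omega>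
    by (simp add: Z_def jacobi_param_def Y_def B_def R_def h_def)
  have BR: "B k \<in> insert None (Some ` ?I)" "R k \<in> insert None (Some ` ?I)" "B k \<noteq> R k" if "k < n" for k
    using that by (auto simp: B_def R_def)
  have hm[measurable]: "h k \<in> borel_measurable borel" for k by (simp add: h_def)
  have "indep_vars (\<lambda>k. \<Pi>\<^sub>M i\<in>{B k, R k}. borel) (\<lambda>k \<omega>. \<lambda>i\<in>{B k, R k}. Y i \<omega>) {..<n}"
  proof (rule indep_vars_restrict[OF Y])
    show "{B k, R k} \<subseteq> insert None (Some ` ?I)" if "k \<in> {..<n}" for k using BR[of k] that by auto
    show "disjoint_family_on (\<lambda>k. {B k, R k}) {..<n}"
      by (auto simp: disjoint_family_on_def B_def R_def split: if_splits)
  qed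
  then have "indep_vars (\<lambda>_. lborel) (\<lambda>k. (\<lambda>v. Complex (v (B k)) (h k (v (R k)))) \<circ> (\<lambda>\<omega>. \<lambda>i\<in>{B k, R k}. Y i \<omega>)) {..<n}"
  proof (rule indep_vars_compose)
    fix k assume "k \<in> {..<n}"
    have [measurable]: "(\<lambda>v. v (B k)) \<in> borel_measurable (\<Pi>\<^sub>M i\<in>{B k, R k}. borel)" "(\<lambda>v. v (R k)) \<in> borel_measurable (\<Pi>\<^sub>M i\<in>{B k, R k}. borel)"
      by (auto intro!: measurable_component_singleton)
    show "(\<lambda>v. Complex (v (B k)) (h k (v (R k)))) \<in> (\<Pi>\<^sub>M i\<in>{B k, R k}. (borel :: real measure)) \<rightarrow>\<^sub>M lborel"
      unfolding Complex_eq by measurable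
  qed
  then have indZ: "indep_vars (\<lambda>_. lborel) Z {..<n}"
    by (rule indep_vars_cong[THEN iffD1, rotated 3]) (auto simp: Z_def fun_eq_iff)
  have Zm: "Z k \<in> M \<rightarrow>\<^sub>M lborel" if "k < n" for k
    using indZ that unfolding indep_vars_def2 by auto
  have F'm: "(\<lambda>t. if 0 < t then F t else 0) \<in> borel_measurable borel"
    by (rule distributed_density_measurable[OF F l])
  define q where "q k t = (if 0 < t then (if Suc k = n then F t
      else t powr (\<beta> * real (Suc k) / 2 - 1) * exp (- t) / Gamma (\<beta> * real (Suc k) / 2)) else 0)" for k and t :: real
  have pd: "param_density \<beta> n F k z = std_normal_density (Re z) * q k (Im z)" for k z
    by (simp add: param_density_def q_def)
  have qT: "q k = (\<lambda>t. if 0 < t then F t else 0)" if "Suc k = n" for k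
    using that by (auto simp: q_def fun_eq_iff)
  have qF: "q k = (\<lambda>t. if 0 < t then t powr (\<beta> * real (Suc k) / 2 - 1) * exp (- t) / Gamma (\<beta> * real (Suc k) / 2) else 0)"
    if "Suc k \<noteq> n" for k
    using that by (auto simp: q_def fun_eq_iff)
  have qm[measurable]: "q k \<in> borel_measurable borel" for k
    using F'm by (cases "Suc k = n") (simp_all add: qT qF)
  have q0: "0 \<le> q k t" for k t
    using F \<beta> by (auto simp: q_def intro!: divide_nonneg_nonneg mult_nonneg_nonneg less_imp_le[OF Gamma_real_pos])
  have distZ: "distr M lborel (Z k) = density lborel (\<lambda>z. ennreal (param_density \<beta> n F k z))" if k: "k < n" for k
    unfolding Z_def[abs_def] pd
  proof (rule distr_complex_of_indep[where p = std_normal_density and q = "q k" and h = "h k"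
        and X = "Y (B k)" and Y = "Y (R k)"
        and q' = "\<lambda>y. if Suc k = n then ennreal (if 0 < y then F y else 0) else ennreal (chi_tilde_density (\<beta> * real (Suc k)) y)"])
    show "indep_var borel (Y (B k)) borel (Y (R k))"
      by (rule indep_var_of_indep_vars[OF Y BR[OF k]])
    show "distributed M lborel (Y (B k)) (\<lambda>x. ennreal (std_normal_density x))"
      using db[of "n - k"] k by (simp add: Y_def B_def)
    show "distributed M lborel (Y (R k)) (\<lambda>y. if Suc k = n then ennreal (if 0 < y then F y else 0) else ennreal (chi_tilde_density (\<beta> * real (Suc k)) y))"
    proof (cases "Suc k = n")
      case False
      then have "n - Suc k \<in> {1..<n}" "n - (n - Suc k) = Suc k" using k by auto
      then show ?thesis using da[of "n - Suc k"] False by (simp add: Y_def R_def)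
    qed (use l in \<open>simp add: Y_def R_def\<close>)
    fix g :: "real \<Rightarrow> ennreal" assume g: "g \<in> borel_measurable borel"
    show "(\<integral>\<^sup>+y. g (h k y) * (if Suc k = n then ennreal (if 0 < y then F y else 0) else ennreal (chi_tilde_density (\<beta> * real (Suc k)) y)) \<partial>lborel)
      = (\<integral>\<^sup>+t. g t * ennreal (q k t) \<partial>lborel)"
    proof (cases "Suc k = n")
      case True
      then show ?thesis by (simp add: h_def qT)
    next
      case False
      then show ?thesis using chi_tilde_square[OF g, of "\<beta> * real (Suc k)"] \<beta> by (simp add: h_def qF del: of_nat_Suc)
    qed
  qed (use q0 in auto)
  have pdm: "(\<lambda>z. ennreal (param_density \<beta> n F k z)) \<in> borel_measurable borel" for k
    unfolding pd by measurable
  show thesis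
  proof
    show "\<And>\<omega>. \<omega> \<in> space M \<Longrightarrow> J \<omega> = jacobi_matrix n (\<lambda>j. a j \<omega>) (\<lambda>j. b j \<omega>)" by (rule Jab)
    show "(\<lambda>\<omega>. \<lambda>k\<in>{..<n}. jacobi_param n (\<lambda>j. a j \<omega>) (\<lambda>j. b j \<omega>) (l \<omega>) k) \<in> M \<rightarrow>\<^sub>M CC n"
      unfolding Z[symmetric] by (rule measurable_restrict) (use Zm in auto)
    have "distr M (CC n) (\<lambda>\<omega>. \<lambda>k\<in>{..<n}. Z k \<omega>) = (\<Pi>\<^sub>M k\<in>{..<n}. distr M lborel (Z k))"
      using indZ n Zm by (subst (asm) indep_vars_iff_distr_eq_PiM') auto
    also have "\<dots> = (\<Pi>\<^sub>M k\<in>{..<n}. density lborel (\<lambda>z. ennreal (param_density \<beta> n F k z)))"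
      by (rule PiM_cong) (simp_all add: distZ)
    also have "\<dots> = density (CC n) (\<lambda>z. \<Prod>k<n. ennreal (param_density \<beta> n F k (z k)))"
    proof (rule PiM_density[OF pdm])
      fix k assume "k < n"
      then have "prob_space (density lborel (\<lambda>z. ennreal (param_density \<beta> n F k z)))"
        using prob_space_distr[OF Zm] by (simp add: distZ[symmetric])
      then show "sigma_finite_measure (density lborel (\<lambda>z. ennreal (param_density \<beta> n F k z)))"
        by (rule prob_space_imp_sigma_finite)
    qed
    finally show "distr M (CC n) (\<lambda>\<omega>. \<lambda>k\<in>{..<n}. jacobi_param n (\<lambda>j. a j \<omega>) (\<lambda>j. b j \<omega>) (l \<omega>) k)
      = density (CC n) (\<lambda>z. \<Prod>k<n. ennreal (param_density \<beta> n F k (z k)))"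
      unfolding Z[symmetric] .
  qed
qed

section \<open>The law of the eigenvalues\<close>

lemma eigenvalue_weight_measurable:
  assumes n: "n > 0" and F: "(\<lambda>t. if 0 < t then F t else 0) \<in> borel_measurable borel"
  shows "eigenvalue_weight \<beta> n F \<in> borel_measurable (CC n)"
proof -
  have comp: "(\<lambda>z. z j) \<in> borel_measurable (CC n)" if "j < n" for j using that by simp
  have Re[measurable]: "(\<lambda>z. Re (z j)) \<in> borel_measurable (CC n)" and Im[measurable]: "(\<lambda>z. Im (z j)) \<in> borel_measurable (CC n)" if "j \<in> {..<n}" for j
    using comp[of j] that by auto
  have sumIm[measurable]: "(\<lambda>z. \<Sum>j<n. Im (z j)) \<in> borel_measurable (CC n)" by measurable
  have pairs[measurable]: "(\<lambda>z. \<Sum>k<n. \<Sum>j<k. Im (z j) * Im (z k)) \<in> borel_measurable (CC n)"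
    by (intro borel_measurable_sum borel_measurable_times Im) auto
  have cp[measurable]: "(\<lambda>z. \<Prod>j<n. \<Prod>k<n. cmod (z j - cnj (z k)) powr (\<beta> / 2 - 1)) \<in> borel_measurable (CC n)"
  proof (intro borel_measurable_prod)
    fix j k assume "j \<in> {..<n}" "k \<in> {..<n}"
    then have [measurable]: "(\<lambda>z. z j) \<in> borel_measurable (CC n)" "(\<lambda>z. z k) \<in> borel_measurable (CC n)" using comp by auto
    have [measurable]: "(\<lambda>z. cnj (z k)) \<in> borel_measurable (CC n)"
      by (rule measurable_compose[of "\<lambda>z. z k" _ borel]) (auto intro!: borel_measurable_continuous_onI continuous_intros)
    show "(\<lambda>z. cmod (z j - cnj (z k)) powr (\<beta> / 2 - 1)) \<in> borel_measurable (CC n)" by measurable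
  qed
  have "Measurable.pred (CC n) (\<lambda>z. \<forall>j\<in>{..<n}. 0 < Im (z j))" by measurable
  then have [measurable]: "Measurable.pred (CC n) (\<lambda>z. \<forall>j<n. 0 < Im (z j))" by (simp add: Ball_def)
  have Fm[measurable]: "(\<lambda>z. (\<lambda>t. if 0 < t then F t else 0) (\<Sum>j<n. Im (z j))) \<in> borel_measurable (CC n)"
    by (rule measurable_compose[OF sumIm F])
  let ?R = "\<lambda>z. if \<forall>j<n. 0 < Im (z j) then
          1 / h_const \<beta> n
          * exp (- (1 / 2) * (\<Sum>j<n. (Re (z j))\<^sup>2) - (\<Sum>k<n. \<Sum>j<k. Im (z j) * Im (z k)))
          * (\<Prod>j<n. \<Prod>k<n. cmod (z j - cnj (z k)) powr (\<beta> / 2 - 1))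
          * ((\<lambda>t. if 0 < t then F t else 0) (\<Sum>j<n. Im (z j)) / (\<Sum>j<n. Im (z j)) powr (\<beta> * real n / 2 - 1))
      else 0"
  have "eigenvalue_weight \<beta> n F = ?R"
  proof
    fix z
    have "(\<Sum>j<n. Im (z j)) > 0" if "\<forall>j<n. 0 < Im (z j)"
      using that n by (intro sum_pos) auto
    then show "eigenvalue_weight \<beta> n F z = ?R z"
      unfolding eigenvalue_weight_def Let_def by auto
  qed
  also have "\<dots> \<in> borel_measurable (CC n)"
    using Fm by measurable
  finally show ?thesis .
qed

lemma conj_prod_permute:
  assumes \<pi>: "\<pi> permutes {..<n}"
  shows "conj_prod n (\<lambda>j\<in>{..<n}. z (\<pi> j)) = conj_prod n z"
proof -
  have "conj_prod n (\<lambda>j\<in>{..<n}. z (\<pi> j)) = (\<Prod>j<n. \<Prod>k<n. cmod (z (\<pi> j) - cnj (z (\<pi> k))))"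
    by (simp add: conj_prod_def)
  also have "\<dots> = (\<Prod>j<n. \<Prod>k<n. cmod (z (\<pi> j) - cnj (z k)))"
    using prod.permute[OF \<pi>, of "\<lambda>k. cmod (z (\<pi> j) - cnj (z k))" for j] by (simp add: o_def)
  also have "\<dots> = conj_prod n z"
    using prod.permute[OF \<pi>, of "\<lambda>j. \<Prod>k<n. cmod (z j - cnj (z k))"] by (simp add: o_def conj_prod_def)
  finally show ?thesis .
qed

lemma monic_eq_prod_listing:
  assumes "monic_deg n p" "\<pi> permutes {..<n}"
  shows "p = (\<Prod>j<n. [:- (\<lambda>j\<in>{..<n}. root_at p (\<pi> j)) j, 1:])"
  using poly_eq_prod_root_list[of p n \<pi>] assms by (simp add: monic_deg_def)

lemma roots_upper_iff_listing:
  assumes "monic_deg n p" "p = (\<Prod>j<n. [:- z j, 1:])"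
  shows "roots_upper p \<longleftrightarrow> (\<forall>j<n. Im (z j) > 0)"
  unfolding roots_upper_def assms(2) by (auto simp: poly_prod)

lemma param_density_nonneg:
  assumes "\<beta> > 0" "\<And>x. 0 < x \<Longrightarrow> 0 \<le> F x"
  shows "0 \<le> param_density \<beta> n F k \<zeta>"
  using assms by (auto simp: param_density_def intro!: divide_nonneg_nonneg mult_nonneg_nonneg less_imp_le[OF Gamma_real_pos])

text \<open>
  Every listing of the roots of the polynomial gives the same value of the weight; so the parameter density can
  be moved inside the sum over the listings.
\<close>

lemma param_density_mult_root_sum:
  assumes n: "n > 0" and \<beta>: "\<beta> > 0" and F: "\<And>x. 0 < x \<Longrightarrow> 0 \<le> F x"
  shows "(\<Prod>k<n. ennreal (param_density \<beta> n F k (\<zeta> k))) * root_sum n \<phi> (param_poly n \<zeta>)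
    = (if \<forall>k<n. Im (\<zeta> k) > 0 then root_sum n (\<lambda>z. \<phi> z * ennreal (fact n * eigenvalue_weight \<beta> n F z)) (param_poly n \<zeta>)
        * ennreal (\<Prod>k<n. Im (\<zeta> k) ^ k) else 0)"
proof (cases "\<forall>k<n. Im (\<zeta> k) > 0")
  case False
  then obtain k where "k < n" "\<not> Im (\<zeta> k) > 0" by blast
  then have "(\<Prod>k<n. ennreal (param_density \<beta> n F k (\<zeta> k))) = 0"
    by (intro prod_zero) (auto simp: param_density_def intro!: bexI[of _ k])
  then show ?thesis unfolding if_not_P[OF False] by (simp only: mult_zero_left)
next
  case True
  obtain m where m: "n = Suc m" using n by (cases n) auto
  let ?p = "param_poly n \<zeta>"
  have "root_sum n \<phi> ?p * (\<Prod>k<n. ennreal (param_density \<beta> n F k (\<zeta> k)))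
    = root_sum n (\<lambda>z. \<phi> z * ennreal (fact n * eigenvalue_weight \<beta> n F z)) ?p * ennreal (\<Prod>k<n. Im (\<zeta> k) ^ k)"
    unfolding root_sum_def sum_distrib_right
  proof (rule sum.cong[OF refl])
    fix \<pi> assume "\<pi> \<in> {\<pi>. \<pi> permutes {..<n}}"
    then have \<pi>: "\<pi> permutes {..<n}" by simp
    define z where "z = (\<lambda>j\<in>{..<n}. root_at ?p (\<pi> j))"
    have z: "?p = (\<Prod>j<n. [:- z j, 1:])"
      unfolding z_def by (rule monic_eq_prod_listing[OF monic_deg_param_poly \<pi>])
    have zup: "\<forall>j<n. Im (z j) > 0"
      using roots_upper_iff_listing[OF monic_deg_param_poly z] roots_upper_param_poly[of n \<zeta>] True by simp
    have cp: "conj_prod n z = 2 ^ n * (\<Prod>k<n. Im (\<zeta> k) ^ Suc k)"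
      unfolding z_def conj_prod_permute[OF \<pi>] by (rule conj_prod_param_poly[OF True])
    have "(\<Prod>k<n. ennreal (param_density \<beta> n F k (\<zeta> k))) = ennreal (\<Prod>k<n. param_density \<beta> n F k (\<zeta> k))"
      by (rule prod_ennreal) (rule param_density_nonneg[OF \<beta> F])
    also have "(\<Prod>k<n. param_density \<beta> n F k (\<zeta> k)) = (fact n * eigenvalue_weight \<beta> n F z) * (\<Prod>k<n. Im (\<zeta> k) ^ k)"
      using eigenvalue_weight_eq[OF \<beta> z[unfolded m] True[unfolded m] cp[unfolded m] zup[unfolded m], of F]
      unfolding m[symmetric] by (simp only: mult_ac)
    also have "ennreal \<dots> = ennreal (fact n * eigenvalue_weight \<beta> n F z) * ennreal (\<Prod>k<n. Im (\<zeta> k) ^ k)"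
      using True by (intro ennreal_mult'' prod_nonneg zero_le_power) (auto intro: less_imp_le)
    finally show "\<phi> (\<lambda>j\<in>{..<n}. root_at ?p (\<pi> j)) * (\<Prod>k<n. ennreal (param_density \<beta> n F k (\<zeta> k)))
      = \<phi> (\<lambda>j\<in>{..<n}. root_at ?p (\<pi> j)) * ennreal (fact n * eigenvalue_weight \<beta> n F (\<lambda>j\<in>{..<n}. root_at ?p (\<pi> j))) * ennreal (\<Prod>k<n. Im (\<zeta> k) ^ k)"
      unfolding z_def[symmetric] by (simp add: mult.assoc)
  qed
  then show ?thesis using True by (simp add: mult.commute)
qed

text \<open>
  The composition of the two changes of variables, from the parameters to the coefficients and from the
  coefficients to the roots.
\<close>

lemma nn_integral_param_density:
  assumes n: "n > 0" and \<beta>: "\<beta> > 0" and F: "\<And>x. 0 < x \<Longrightarrow> 0 \<le> F x"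
    and Fm: "(\<lambda>t. if 0 < t then F t else 0) \<in> borel_measurable borel" and [measurable]: "\<phi> \<in> borel_measurable (CC n)"
  shows "(\<integral>\<^sup>+\<zeta>. (\<Prod>k<n. ennreal (param_density \<beta> n F k (\<zeta> k))) * root_sum n \<phi> (param_poly n \<zeta>) \<partial>CC n)
    = (\<integral>\<^sup>+z. ennreal (fact n) * (ennreal (eigenvalue_density \<beta> n F z) * \<phi> z) \<partial>CC n)"
proof -
  note [measurable] = eigenvalue_weight_measurable[OF n Fm]
  let ?K = "\<lambda>z. \<phi> z * ennreal (fact n * eigenvalue_weight \<beta> n F z)"
  have K: "?K \<in> borel_measurable (CC n)" by measurable
  have Km: "(\<lambda>(c, z). ?K z) \<in> borel_measurable (CC n \<Otimes>\<^sub>M CC n)" by measurable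
  \<comment> \<open>The weight vanishes unless all roots lie in the upper half-plane, so that restriction is automatic.\<close>
  have K0: "root_sum n ?K p = 0" if p: "monic_deg n p" and "\<not> roots_upper p" for p
    unfolding root_sum_def
  proof (rule sum.neutral, rule ballI)
    fix \<pi> assume "\<pi> \<in> {\<pi>. \<pi> permutes {..<n}}"
    then have "\<pi> permutes {..<n}" by simp
    from roots_upper_iff_listing[OF p monic_eq_prod_listing[OF p this]] \<open>\<not> roots_upper p\<close>
    have "eigenvalue_weight \<beta> n F (\<lambda>j\<in>{..<n}. root_at p (\<pi> j)) = 0" by (auto simp: eigenvalue_weight_def)
    then show "?K (\<lambda>j\<in>{..<n}. root_at p (\<pi> j)) = 0" by simp
  qed
  have "(\<integral>\<^sup>+\<zeta>. (\<Prod>k<n. ennreal (param_density \<beta> n F k (\<zeta> k))) * root_sum n \<phi> (param_poly n \<zeta>) \<partial>CC n)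
    = (\<integral>\<^sup>+c. (if roots_upper (asc_poly n c) then root_sum n ?K (asc_poly n c) else 0) \<partial>CC n)"
    (is "?L = _")
  proof -
    have "?L = (\<integral>\<^sup>+\<zeta>. (if \<forall>k<n. Im (\<zeta> k) > 0 then root_sum n ?K (param_poly n \<zeta>) * ennreal (\<Prod>k<n. Im (\<zeta> k) ^ k) else 0) \<partial>CC n)"
      by (intro nn_integral_cong param_density_mult_root_sum n \<beta> F)
    also have "\<dots> = (\<integral>\<^sup>+c. (if roots_upper (asc_poly n c) then root_sum n ?K (asc_poly n c) else 0) \<partial>CC n)"
    by (rule param_poly_change_of_variables[where \<Phi> = "root_sum n ?K"])
       (intro root_sum_measurable[OF _ _ Km] asc_poly_coeff_measurable, auto simp: asc_poly_def)
    finally show ?thesis .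
  qed
  also have "\<dots> = (\<integral>\<^sup>+c. root_sum n ?K (asc_poly n c) \<partial>CC n)"
    using K0[OF monic_deg_asc_poly] by (intro nn_integral_cong) auto
  also have "\<dots> = (\<integral>\<^sup>+c. root_sum n ?K (desc_poly n c) \<partial>CC n)"
    by (rule nn_integral_asc_poly_eq_desc_poly) (intro root_sum_measurable[OF _ _ Km] desc_poly_coeff_measurable, auto)
  also have "\<dots> = (\<integral>\<^sup>+z. ?K z * ennreal (vandermonde_sq n z) \<partial>CC n)"
    by (rule vieta_change_of_variables[symmetric, OF K])
  also have "\<dots> = (\<integral>\<^sup>+z. ennreal (fact n) * (ennreal (eigenvalue_density \<beta> n F z) * \<phi> z) \<partial>CC n)"
  proof (rule nn_integral_cong)
    fix z
    have "ennreal (eigenvalue_density \<beta> n F z) = ennreal (eigenvalue_weight \<beta> n F z) * ennreal (vandermonde_sq n z)"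
      unfolding eigenvalue_density_eq by (rule ennreal_mult''[OF vandermonde_sq_nonneg])
    moreover have "ennreal (fact n * eigenvalue_weight \<beta> n F z) = ennreal (fact n) * ennreal (eigenvalue_weight \<beta> n F z)"
      by (rule ennreal_mult') simp
    ultimately show "?K z * ennreal (vandermonde_sq n z) = ennreal (fact n) * (ennreal (eigenvalue_density \<beta> n F z) * \<phi> z)"
      by (simp add: mult_ac)
  qed
  finally show ?thesis .
qed

theorem theorem2:
  fixes M :: "'w measure" and n :: nat and \<beta> :: real
    and J :: "'w \<Rightarrow> real mat" and l :: "'w \<Rightarrow> real" and F :: "real \<Rightarrow> real"
  assumes "prob_space M"
    and "0 < n"
    and "0 < \<beta>"
    and "gaussian_beta_ensemble M \<beta> n J"
    and "\<And>x. 0 < x \<Longrightarrow> 0 \<le> F x"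
    and "distributed M lborel l (\<lambda>x. ennreal (if 0 < x then F x else 0))"
    and "indep_rv M
           (\<Pi>\<^sub>M p\<in>{..<n} \<times> {..<n}. borel) (\<lambda>\<omega>. \<lambda>p\<in>{..<n} \<times> {..<n}. J \<omega> $$ p)
           borel l"
  shows "distributed (shuffle_space n M) (\<Pi>\<^sub>M j\<in>{..<n}. lborel)
           (random_order n (\<lambda>\<omega>. eigenvalue_list
              (map_mat complex_of_real (J \<omega>) + (\<i> * complex_of_real (l \<omega>)) \<cdot>\<^sub>m I11 n)))
           (\<lambda>z. ennreal (eigenvalue_density \<beta> n F z))"
proof -
  interpret prob_space M by fact
  let ?zs = "\<lambda>\<omega>. eigenvalue_list (map_mat complex_of_real (J \<omega>) + (\<i> * complex_of_real (l \<omega>)) \<cdot>\<^sub>m I11 n)"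
  let ?P = "{\<pi>. \<pi> permutes {..<n}}"
  let ?U = "uniform_count_measure ?P"
  obtain a b :: "nat \<Rightarrow> 'w \<Rightarrow> real" where
    Jab: "\<And>\<omega>. \<omega> \<in> space M \<Longrightarrow> J \<omega> = jacobi_matrix n (\<lambda>j. a j \<omega>) (\<lambda>j. b j \<omega>)"
    and \<zeta>m: "(\<lambda>\<omega>. \<lambda>k\<in>{..<n}. jacobi_param n (\<lambda>j. a j \<omega>) (\<lambda>j. b j \<omega>) (l \<omega>) k) \<in> M \<rightarrow>\<^sub>M CC n"
    and \<zeta>d: "distr M (CC n) (\<lambda>\<omega>. \<lambda>k\<in>{..<n}. jacobi_param n (\<lambda>j. a j \<omega>) (\<lambda>j. b j \<omega>) (l \<omega>) k)
      = density (CC n) (\<lambda>z. \<Prod>k<n. ennreal (param_density \<beta> n F k (z k)))"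
  proof (rule jacobi_param_law[OF assms(1-4) _ assms(6,7)])
    show "0 \<le> F x" if "0 < x" for x using assms(5) that .
  qed (rule that)
  define \<zeta> where "\<zeta> \<omega> = (\<lambda>k\<in>{..<n}. jacobi_param n (\<lambda>j. a j \<omega>) (\<lambda>j. b j \<omega>) (l \<omega>) k)" for \<omega>
  have \<zeta>[measurable]: "\<zeta> \<in> M \<rightarrow>\<^sub>M CC n" using \<zeta>m by (simp add: \<zeta>_def[abs_def])
  have zs: "?zs \<omega> = root_list (param_poly n (\<zeta> \<omega>))" if "\<omega> \<in> space M" for \<omega>
    unfolding eigenvalue_list_eq_root_list Jab[OF that] char_poly_perturbed_jacobi[OF \<open>0 < n\<close>]
    by (rule arg_cong[where f = root_list], rule param_poly_cong) (simp add: \<zeta>_def)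
  have Fm: "(\<lambda>t. if 0 < t then F t else 0) \<in> borel_measurable borel"
    by (rule distributed_density_measurable[OF assms(5,6)])
  have edm[measurable]: "(\<lambda>z. ennreal (eigenvalue_density \<beta> n F z)) \<in> borel_measurable (CC n)"
    using eigenvalue_weight_measurable[OF assms(2) Fm] unfolding eigenvalue_density_eq by measurable
  have finP: "finite ?P" and cardP: "card ?P = fact n"
    using card_permutations[of "{..<n}" n] by (auto intro: finite_permutations)
  have neP: "?P \<noteq> {}" using permutes_id[of "{..<n}"] by blast
  have setsU: "sets ?U = sets (count_space ?P)" by (simp add: sets_uniform_count_measure)
  interpret U: prob_space ?U by (rule prob_space_uniform_count_measure[OF finP neP])
  have comp_m: "(\<lambda>\<zeta>. \<zeta> k) \<in> borel_measurable (CC n)" if "k < n" for k using that by simp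
  have fpm: "(\<lambda>\<omega>. coeff (param_poly n (\<zeta> \<omega>)) k) \<in> borel_measurable M" for k
    using measurable_compose[OF \<zeta> comp_m] by (rule param_poly_coeff_measurable)
  have RO[measurable]: "random_order n ?zs \<in> shuffle_space n M \<rightarrow>\<^sub>M CC n"
  proof -
    have "(\<lambda>p. (\<lambda>\<pi> p. \<lambda>j\<in>{..<n}. ?zs (fst p) ! \<pi> j) (snd p) p) \<in> M \<Otimes>\<^sub>M ?U \<rightarrow>\<^sub>M CC n"
    proof (rule measurable_compose_countable'[where I = ?P and f = "\<lambda>\<pi> p. \<lambda>j\<in>{..<n}. ?zs (fst p) ! \<pi> j" and g = snd])
      fix \<pi> assume "\<pi> \<in> ?P"
      then have "(\<lambda>\<omega>. \<lambda>j\<in>{..<n}. root_list (param_poly n (\<zeta> \<omega>)) ! \<pi> j) \<in> M \<rightarrow>\<^sub>M CC n"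
        using monic_deg_param_poly by (intro root_listing_measurable fpm) (auto simp: monic_deg_def)
      then have "(\<lambda>\<omega>. \<lambda>j\<in>{..<n}. ?zs \<omega> ! \<pi> j) \<in> M \<rightarrow>\<^sub>M CC n"
        by (rule measurable_cong[THEN iffD1, rotated]) (simp add: zs)
      from measurable_compose[OF measurable_fst this]
      show "(\<lambda>p. \<lambda>j\<in>{..<n}. ?zs (fst p) ! \<pi> j) \<in> M \<Otimes>\<^sub>M ?U \<rightarrow>\<^sub>M CC n" .
    next
      show "snd \<in> M \<Otimes>\<^sub>M ?U \<rightarrow>\<^sub>M count_space ?P"
        using measurable_snd[of M ?U] measurable_cong_sets[OF refl setsU] by blast
      show "countable ?P" using finP by (rule countable_finite)
    qed
    then show ?thesis by (simp add: random_order_def shuffle_space_def split_beta')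
  qed
  have "distr (shuffle_space n M) (CC n) (random_order n ?zs) = density (CC n) (\<lambda>z. ennreal (eigenvalue_density \<beta> n F z))"
  proof (rule measure_eqI)
    fix A assume "A \<in> sets (distr (shuffle_space n M) (CC n) (random_order n ?zs))"
    then have A[measurable]: "A \<in> sets (CC n)" by simp
    have "sets (CC n) = sets (\<Pi>\<^sub>M j\<in>{..<n}. borel)" by (rule sets_PiM_cong) simp_all
    with A have [measurable]: "A \<in> sets (\<Pi>\<^sub>M j\<in>{..<n}. borel)" by simp
    let ?c = "ennreal (1 / fact n)"
    have Am: "(\<lambda>p. indicator A (random_order n ?zs p) :: ennreal) \<in> borel_measurable (M \<Otimes>\<^sub>M ?U)"
      using measurable_compose[OF RO borel_measurable_indicator[OF A]] by (simp add: shuffle_space_def)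
    have rsm: "(\<lambda>\<zeta>. root_sum n (indicator A) (param_poly n \<zeta>)) \<in> borel_measurable (CC n)"
    proof (rule root_sum_measurable)
      show "(\<lambda>(\<zeta>, z). indicator A z :: ennreal) \<in> borel_measurable (CC n \<Otimes>\<^sub>M CC n)" by measurable
      show "(\<lambda>\<zeta>. coeff (param_poly n \<zeta>) k) \<in> borel_measurable (CC n)" for k
        by (intro param_poly_coeff_measurable comp_m)
      show "degree (param_poly n \<zeta>) = n" for \<zeta> using monic_deg_param_poly[of n \<zeta>] by (simp add: monic_deg_def)
    qed
    have pdm: "(\<lambda>z. \<Prod>k<n. ennreal (param_density \<beta> n F k (z k))) \<in> borel_measurable (CC n)"
    proof (intro borel_measurable_prod_ennreal)
      fix k assume "k \<in> {..<n}"
      then have [measurable]: "(\<lambda>z. z k) \<in> borel_measurable (CC n)" by simp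
      have [measurable]: "(\<lambda>z. if 0 < Im (z k) then F (Im (z k)) else 0) \<in> borel_measurable (CC n)"
        using measurable_compose[OF _ Fm, of "\<lambda>z. Im (z k)" "CC n"] by simp
      have "param_density \<beta> n F k = (\<lambda>\<zeta>. if Im \<zeta> > 0 then std_normal_density (Re \<zeta>) *
         (if Suc k = n then (if 0 < Im \<zeta> then F (Im \<zeta>) else 0)
          else Im \<zeta> powr (\<beta> * real (Suc k) / 2 - 1) * exp (- Im \<zeta>) / Gamma (\<beta> * real (Suc k) / 2)) else 0)"
        by (auto simp: param_density_def fun_eq_iff)
      then show "(\<lambda>z. ennreal (param_density \<beta> n F k (z k))) \<in> borel_measurable (CC n)"
        by simp
    qed
    have "emeasure (distr (shuffle_space n M) (CC n) (random_order n ?zs)) A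
      = (\<integral>\<^sup>+p. indicator A (random_order n ?zs p) \<partial>shuffle_space n M)"
      by (subst nn_integral_indicator[symmetric], simp, subst nn_integral_distr) auto
    also have "\<dots> = (\<integral>\<^sup>+\<omega>. \<integral>\<^sup>+\<pi>. indicator A (random_order n ?zs (\<omega>, \<pi>)) \<partial>?U \<partial>M)"
      unfolding shuffle_space_def using Am by (subst U.nn_integral_fst[symmetric]) auto
    also have "\<dots> = (\<integral>\<^sup>+\<omega>. ?c * root_sum n (indicator A) (param_poly n (\<zeta> \<omega>)) \<partial>M)"
    proof (rule nn_integral_cong)
      fix \<omega> assume \<omega>: "\<omega> \<in> space M"
      have "(\<integral>\<^sup>+\<pi>. indicator A (random_order n ?zs (\<omega>, \<pi>)) \<partial>?U)
        = (\<Sum>\<pi>\<in>?P. ?c * indicator A (random_order n ?zs (\<omega>, \<pi>)))"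
        unfolding uniform_count_measure_def by (subst nn_integral_point_measure_finite[OF finP]) (simp add: cardP)
      also have "\<dots> = ?c * root_sum n (indicator A) (param_poly n (\<zeta> \<omega>))"
        unfolding root_sum_def sum_distrib_left by (simp add: random_order_def zs[OF \<omega>])
      finally show "(\<integral>\<^sup>+\<pi>. indicator A (random_order n ?zs (\<omega>, \<pi>)) \<partial>?U) = ?c * root_sum n (indicator A) (param_poly n (\<zeta> \<omega>))" .
    qed
    also have "\<dots> = (\<integral>\<^sup>+\<zeta>. ?c * root_sum n (indicator A) (param_poly n \<zeta>) \<partial>distr M (CC n) \<zeta>)"
      using rsm by (subst nn_integral_distr) auto
    also have "\<dots> = (\<integral>\<^sup>+\<zeta>. ?c * ((\<Prod>k<n. ennreal (param_density \<beta> n F k (\<zeta> k))) * root_sum n (indicator A) (param_poly n \<zeta>)) \<partial>CC n)"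
      unfolding \<zeta>_def[abs_def] \<zeta>d using rsm pdm by (subst nn_integral_density) (auto simp: mult_ac)
    also have "\<dots> = ?c * (\<integral>\<^sup>+\<zeta>. (\<Prod>k<n. ennreal (param_density \<beta> n F k (\<zeta> k))) * root_sum n (indicator A) (param_poly n \<zeta>) \<partial>CC n)"
      using rsm pdm by (intro nn_integral_cmult) auto
    also have "\<dots> = ?c * (\<integral>\<^sup>+z. ennreal (fact n) * (ennreal (eigenvalue_density \<beta> n F z) * indicator A z) \<partial>CC n)"
      by (subst nn_integral_param_density[OF assms(2,3,5) Fm]) auto
    also have "\<dots> = (?c * ennreal (fact n)) * (\<integral>\<^sup>+z. ennreal (eigenvalue_density \<beta> n F z) * indicator A z \<partial>CC n)"
      by (subst nn_integral_cmult) (auto simp: mult.assoc)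
    also have "?c * ennreal (fact n) = 1" by (simp flip: ennreal_mult)
    also have "1 * (\<integral>\<^sup>+z. ennreal (eigenvalue_density \<beta> n F z) * indicator A z \<partial>CC n)
      = emeasure (density (CC n) (\<lambda>z. ennreal (eigenvalue_density \<beta> n F z))) A"
      by (simp add: emeasure_density)
    finally show "emeasure (distr (shuffle_space n M) (CC n) (random_order n ?zs)) A
      = emeasure (density (CC n) (\<lambda>z. ennreal (eigenvalue_density \<beta> n F z))) A" .
  qed simp
  then show ?thesis unfolding distributed_def using RO edm by simp
qed

end
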